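(* Parity is not in $\tilde{\mathrm C}$PTime; that is, the class of finite naked sets of even cardinality is not in $\tilde{\mathrm C}$PTime. Moreover, if $K_1,K_2$ are disjoint infinite classes of finite naked sets, each containing structures of infinitely many cardinalities, then the pair $(K_1,K_2)$ is not in $\tilde{\mathrm C}$PTime.
   Context: A naked set is an input structure of the empty (input) vocabulary. ASM MODEL. "Object" means an atom (a non-set) or a set. For a finite set $X$ of atoms, $\mathrm{HF}(X)$ is the smallest set $Y$ such that $X\subseteq Y$ and every finite subset of $Y$ is a member of $Y$. $\mathrm{TC}(x)$ is the least transitive set $Y$ with $x\in Y$. Natural numbers are von Neumann ordinals; $\mathit{false}=0=\emptyset$, $\mathit{true}=1=\{\emptyset\}$. Vocabulary: finitely many function names with arities (some marked relational, called predicates), consisting of: static logic predicates ($=$, nullary $\mathit{true},\mathit{false}$, Boolean connectives); static set-theoretic names (binary predicate $\in$; nullary $\emptyset$, $\mathrm{Atoms}$; unary $\bigcup$, $\mathrm{TheUnique}$; binary $\mathrm{Pair}$); finitely many static input predicates; finitely many dynamic names, including nullary predicates $\mathrm{Halt}$ and $\mathrm{Output}$. State: a structure with base set $\mathrm{HF}(X)$, $X$ a finite set of atoms. Predicates take values in $\{0,1\}$; Boolean connectives are as usual on $\{0,1\}$ and $0$ if some argument is not Boolean; $\in,\emptyset$ are standard; $\mathrm{Atoms}=X$; $\bigcup a$ is the union of those elements of $a$ that are sets ($\emptyset$ if $a$ is an atom); $\mathrm{TheUnique}(a)$ is the unique element of $a$ if $a$ is a singleton and $\emptyset$ otherwise;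 $\mathrm{Pair}(a,b)=\{a,b\}$; input predicates hold only of tuples of atoms; for each dynamic $f$ of arity $j$ the set $\mathrm{Extent}(f)=\{(x_0,\dots,x_j): f(x_0,\dots,x_{j-1})=x_j\neq 0\}$ is finite. An input structure is a finite structure of the input vocabulary (replaced by an isomorphic copy whose elements are atoms); it determines the initial state whose atoms with the input predicates form that structure and in which all dynamic functions have empty extent. Terms: variables; $f(t_1,\dots,t_j)$ (Boolean if $f$ is a predicate); $\{t(v):v\in r:g(v)\}$ with $r$ a term without $v$ free and $g$ a Boolean term ($v$ becomes bound), whose value is the set of values of $t(v)$ for those $v\in r$ with $g(v)$ true. Rules: Skip; $f(t_1,\dots,t_j):=t_0$ with $f$ dynamic ($t_0$ Boolean if $f$ is relational); "if $g$ then $R_1$ else $R_2$ endif" with $g$ a Boolean term; "do forall $v\in r$, $R_0(v)$ enddo" with $r$ a term without $v$ free ($v$ becomes bound). An expanded state is a state with an assignment of values to finitely many variables; $A(v\mapsto a)$ is $A$ with $v$ (re)assigned $a$. $\mathrm{Den}(R,A)$ is a set of updates $(f,\bar a,b)$: $\mathrm{Den}(\text{Skip},A)=\emptyset$; for $f(\bar s):=t$ it is $\{(f,\mathrm{Val}_A(\bar s),\mathrm{Val}_A(t))\}$; for a conditional it is $\mathrm{Den}(R_1,A)$ or $\mathrm{Den}(R_2,A)$ according as $g$ is true or not in $A$; for do-forall it is $\bigcup\{\mathrm{Den}(R_0(v),A(v\mapsto a)):a\in\mathrm{Val}_A(r)\}$. The sequel of $A$ with respect to $R$ is obtained by simultaneously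 setting $f(\bar a)=b$ for all $(f,\bar a,b)\in\mathrm{Den}(R,A)$ if no two updates clash (same $(f,\bar a)$, different $b$); otherwise it is the state $A$ itself. A program is a rule without free variables. The run of a program $\Pi$ on an input structure $I$ is the finite or infinite sequence $A_0,A_1,\dots$ with $A_0$ the initial state of $I$ and each $A_{i+1}$ the sequel of $A_i$ with respect to $\Pi$, which stops at the first state in which $\mathrm{Halt}$ holds (and is infinite if there is none). The length of a finite run $\langle A_i:i\le l\rangle$ is $l$. PTIME PROGRAMS. An object is critical at a state if it is an atom, or $0$ or $1$, or a value of a dynamic function, or a component of a location (argument tuple) where some dynamic function takes a value different from $\emptyset$. It is active at a state if it belongs to $\mathrm{TC}(y)$ for some critical $y$, and active in a run if active at some state of the run. A PTime (ASM) program is $\bar\Pi=(\Pi,p(n),q(n))$ with $\Pi$ a program and $p,q$ integer polynomials; its run on an input structure $I$ of size $n$ is the longest initial segment of the run of $\Pi$ on $I$ that has length $\le p(n)$ and at most $q(n)$ active objects. $\bar\Pi$ accepts (rejects) $I$ if this run halts (i.e. $\mathrm{Halt}$ holds in its final state) and $\mathrm{Output}$ is true (false) in the final state. $\tilde{\mathrm C}$PTIME. A pair $(K_1,K_2)$ of disjoint classes of finite structures of the same vocabulary is in $\tilde{\mathrm C}$PTime if there is a PTime program that accepts all structures in $K_1$ and rejects all structures in $K_2$. A class $K$ of finite structures of vocabulary $\Upsilon$ is in $\tilde{\mathrm C}$PTime if the pair $(K,K')$ is, where $K'$ is the complement of $K$ in the class of finite $\Upsilon$-structures. *)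

theory Defs
  imports
    "HOL-Library.FSet"
    "HOL-Library.Finite_Map"
    "HOL-Computational_Algebra.Polynomial"
begin

section \<open>Hereditarily finite objects over atoms\<close>

datatype 'a obj = Atom 'a | HSet "'a obj fset"

text \<open>Atoms have no elements.\<close>

primrec elems :: "'a obj \<Rightarrow> 'a obj fset" where
  "elems (Atom a) = {||}"
| "elems (HSet s) = s"

inductive_set HF :: "'a set \<Rightarrow> 'a obj set" for X where
  HF_atom: "a \<in> X \<Longrightarrow> Atom a \<in> HF X"
| HF_set: "\<forall>y. y |\<in>| s \<longrightarrow> y \<in> HF X \<Longrightarrow> HSet s \<in> HF X"

definition transitive_set :: "'a obj set \<Rightarrow> bool" where
  "transitive_set Y \<longleftrightarrow> (\<forall>y\<in>Y. \<forall>z. z |\<in>| elems y \<longrightarrow> z \<in> Y)"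

definition TC :: "'a obj \<Rightarrow> 'a obj set" where
  "TC x = \<Inter>{Y. transitive_set Y \<and> x \<in> Y}"

definition zero_obj :: "'a obj" where
  "zero_obj = HSet {||}"

definition one_obj :: "'a obj" where
  "one_obj = HSet {|zero_obj|}"

definition is_boolean :: "'a obj \<Rightarrow> bool" where
  "is_boolean x \<longleftrightarrow> x = zero_obj \<or> x = one_obj"

definition truth_value :: "bool \<Rightarrow> 'a obj" where
  "truth_value b = (if b then one_obj else zero_obj)"


section \<open>Vocabularies\<close>

datatype dyn_name = Halt | Output | Dyn nat

datatype fun_name =
    EqN | TrueN | FalseN | NotN | AndN | OrN | ImpN | IffN
  | MemN | EmptyN | AtomsN | UnionN | TheUniqueN | PairN
  | InputN nat
  | DynN dyn_name

text \<open>An input vocabulary assigns arities to finitely many predicate names; a dynamic vocabulary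
  assigns to finitely many names an arity and a flag telling whether the name is relational.\<close>

type_synonym input_voc = "(nat, nat) fmap"
type_synonym dyn_voc = "(dyn_name, nat \<times> bool) fmap"

definition is_dyn_voc :: "dyn_voc \<Rightarrow> bool" where
  "is_dyn_voc D \<longleftrightarrow> fmlookup D Halt = Some (0, True) \<and> fmlookup D Output = Some (0, True)"

primrec signature :: "input_voc \<Rightarrow> dyn_voc \<Rightarrow> fun_name \<Rightarrow> (nat \<times> bool) option" where
  "signature V D EqN = Some (2, True)"
| "signature V D TrueN = Some (0, True)"
| "signature V D FalseN = Some (0, True)"
| "signature V D NotN = Some (1, True)"
| "signature V D AndN = Some (2, True)"
| "signature V D OrN = Some (2, True)"
| "signature V D ImpN = Some (2, True)"
| "signature V D IffN = Some (2, True)"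
| "signature V D MemN = Some (2, True)"
| "signature V D EmptyN = Some (0, False)"
| "signature V D AtomsN = Some (0, False)"
| "signature V D UnionN = Some (1, False)"
| "signature V D TheUniqueN = Some (1, False)"
| "signature V D PairN = Some (2, False)"
| "signature V D (InputN P) = map_option (\<lambda>k. (k, True)) (fmlookup V P)"
| "signature V D (DynN f) = fmlookup D f"


section \<open>Input structures and states\<close>

text \<open>The elements of an input structure serve directly as the atoms of its states.\<close>

record 'a istruct =
  universe :: "'a fset"
  holds :: "nat \<Rightarrow> 'a list \<Rightarrow> bool"

text \<open>Relations are required to be empty outside the vocabulary and outside the universe, so that
  a structure has exactly one representation.\<close>

definition structures :: "input_voc \<Rightarrow> 'a istruct set" where
  "structures V = {I. \<forall>P as. holds I P as \<longrightarrow>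
     fmlookup V P = Some (length as) \<and> set as \<subseteq> fset (universe I)}"

definition naked_sets :: "'a istruct set" where
  "naked_sets = structures fmempty"

definition struct_size :: "'a istruct \<Rightarrow> nat" where
  "struct_size I = fcard (universe I)"

record 'a state =
  input :: "'a istruct"
  dyn :: "dyn_name \<Rightarrow> 'a obj list \<Rightarrow> 'a obj"

definition base_set :: "'a state \<Rightarrow> 'a obj set" where
  "base_set A = HF (fset (universe (input A)))"

definition Extent :: "'a state \<Rightarrow> dyn_name \<Rightarrow> ('a obj list \<times> 'a obj) set" where
  "Extent A f = {(xs, y). dyn A f xs = y \<and> y \<noteq> zero_obj}"

text \<open>Dynamic functions are total on lists of objects here; they are \<open>zero_obj\<close> at argument lists
  of the wrong length or not over the base set.\<close>

definition is_state :: "input_voc \<Rightarrow> dyn_voc \<Rightarrow> 'a state \<Rightarrow> bool" where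
  "is_state V D A \<longleftrightarrow>
     input A \<in> structures V \<and>
     (\<forall>f xs y. (xs, y) \<in> Extent A f \<longrightarrow>
        (\<exists>b. fmlookup D f = Some (length xs, b) \<and> set xs \<subseteq> base_set A \<and> y \<in> base_set A \<and>
             (b \<longrightarrow> is_boolean y))) \<and>
     (\<forall>f. finite (Extent A f))"

definition initial_state :: "'a istruct \<Rightarrow> 'a state" where
  "initial_state I = \<lparr>input = I, dyn = (\<lambda>f xs. zero_obj)\<rparr>"

definition connective :: "(bool \<Rightarrow> bool \<Rightarrow> bool) \<Rightarrow> 'a obj \<Rightarrow> 'a obj \<Rightarrow> 'a obj" where
  "connective c x y =
     truth_value (is_boolean x \<and> is_boolean y \<and> c (x = one_obj) (y = one_obj))"

text \<open>Only argument lists of the length prescribed by \<open>signature\<close> matter.\<close>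

primrec interp :: "'a state \<Rightarrow> fun_name \<Rightarrow> 'a obj list \<Rightarrow> 'a obj" where
  "interp A EqN xs = truth_value (xs ! 0 = xs ! 1)"
| "interp A TrueN xs = one_obj"
| "interp A FalseN xs = zero_obj"
| "interp A NotN xs = truth_value (is_boolean (xs ! 0) \<and> xs ! 0 \<noteq> one_obj)"
| "interp A AndN xs = connective (\<and>) (xs ! 0) (xs ! 1)"
| "interp A OrN xs = connective (\<or>) (xs ! 0) (xs ! 1)"
| "interp A ImpN xs = connective (\<longrightarrow>) (xs ! 0) (xs ! 1)"
| "interp A IffN xs = connective (\<longleftrightarrow>) (xs ! 0) (xs ! 1)"
| "interp A MemN xs = truth_value (xs ! 0 |\<in>| elems (xs ! 1))"
| "interp A EmptyN xs = zero_obj"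
| "interp A AtomsN xs = HSet (Atom |`| universe (input A))"
| "interp A UnionN xs = HSet (ffUnion (elems |`| elems (xs ! 0)))"
| "interp A TheUniqueN xs =
     (if \<exists>!x. x |\<in>| elems (xs ! 0) then THE x. x |\<in>| elems (xs ! 0) else zero_obj)"
| "interp A PairN xs = HSet {|xs ! 0, xs ! 1|}"
| "interp A (InputN P) xs = truth_value (\<exists>as. xs = map Atom as \<and> holds (input A) P as)"
| "interp A (DynN f) xs = dyn A f xs"


section \<open>Terms\<close>

text \<open>\<open>Compr t v r g\<close> stands for \<open>{t(v) : v \<in> r : g(v)}\<close>.\<close>

datatype trm =
    Var nat
  | App fun_name "trm list"
  | Compr trm nat trm trm

fun free_vars :: "trm \<Rightarrow> nat set" where
  "free_vars (Var v) = {v}"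
| "free_vars (App f ts) = (\<Union>t\<in>set ts. free_vars t)"
| "free_vars (Compr t v r g) = (free_vars t \<union> free_vars g - {v}) \<union> free_vars r"

fun boolean_trm :: "input_voc \<Rightarrow> dyn_voc \<Rightarrow> trm \<Rightarrow> bool" where
  "boolean_trm V D (App f ts) = (\<exists>j. signature V D f = Some (j, True))"
| "boolean_trm V D _ = False"

fun wf_trm :: "input_voc \<Rightarrow> dyn_voc \<Rightarrow> trm \<Rightarrow> bool" where
  "wf_trm V D (Var v) = True"
| "wf_trm V D (App f ts) =
     ((\<exists>b. signature V D f = Some (length ts, b)) \<and> (\<forall>t\<in>set ts. wf_trm V D t))"
| "wf_trm V D (Compr t v r g) =
     (wf_trm V D t \<and> wf_trm V D r \<and> v \<notin> free_vars r \<and> wf_trm V D g \<and> boolean_trm V D g)"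

type_synonym 'a assignment = "nat \<rightharpoonup> 'a obj"

fun val :: "'a state \<Rightarrow> 'a assignment \<Rightarrow> trm \<Rightarrow> 'a obj" where
  "val A e (Var v) = the (e v)"
| "val A e (App f ts) = interp A f (map (val A e) ts)"
| "val A e (Compr t v r g) =
     HSet ((\<lambda>a. val A (e(v \<mapsto> a)) t) |`|
       ffilter (\<lambda>a. val A (e(v \<mapsto> a)) g = one_obj) (elems (val A e r)))"


section \<open>Rules and programs\<close>

text \<open>\<open>Forall v r R\<close> stands for \<open>do forall v \<in> r, R(v) enddo\<close>.\<close>

datatype rule =
    Skip
  | Update dyn_name "trm list" trm
  | Cond trm rule rule
  | Forall nat trm rule

primrec free_vars_rule :: "rule \<Rightarrow> nat set" where
  "free_vars_rule Skip = {}"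
| "free_vars_rule (Update f ts t) = (\<Union>s\<in>set ts. free_vars s) \<union> free_vars t"
| "free_vars_rule (Cond g R1 R2) = free_vars g \<union> free_vars_rule R1 \<union> free_vars_rule R2"
| "free_vars_rule (Forall v r R) = free_vars r \<union> (free_vars_rule R - {v})"

primrec wf_rule :: "input_voc \<Rightarrow> dyn_voc \<Rightarrow> rule \<Rightarrow> bool" where
  "wf_rule V D Skip = True"
| "wf_rule V D (Update f ts t) =
     ((\<exists>b. fmlookup D f = Some (length ts, b) \<and> (b \<longrightarrow> boolean_trm V D t)) \<and>
      (\<forall>s\<in>set ts. wf_trm V D s) \<and> wf_trm V D t)"
| "wf_rule V D (Cond g R1 R2) =
     (wf_trm V D g \<and> boolean_trm V D g \<and> wf_rule V D R1 \<and> wf_rule V D R2)"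
| "wf_rule V D (Forall v r R) =
     (wf_trm V D r \<and> v \<notin> free_vars r \<and> wf_rule V D R)"

definition is_program :: "input_voc \<Rightarrow> dyn_voc \<Rightarrow> rule \<Rightarrow> bool" where
  "is_program V D \<Pi> \<longleftrightarrow> is_dyn_voc D \<and> wf_rule V D \<Pi> \<and> free_vars_rule \<Pi> = {}"

primrec Den :: "'a state \<Rightarrow> 'a assignment \<Rightarrow> rule \<Rightarrow> (dyn_name \<times> 'a obj list \<times> 'a obj) set" where
  "Den A e Skip = {}"
| "Den A e (Update f ts t) = {(f, map (val A e) ts, val A e t)}"
| "Den A e (Cond g R1 R2) = (if val A e g = one_obj then Den A e R1 else Den A e R2)"
| "Den A e (Forall v r R) = (\<Union>a\<in>fset (elems (val A e r)). Den A (e(v \<mapsto> a)) R)"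

definition clash :: "(dyn_name \<times> 'a obj list \<times> 'a obj) set \<Rightarrow> bool" where
  "clash U \<longleftrightarrow> (\<exists>f xs b c. (f, xs, b) \<in> U \<and> (f, xs, c) \<in> U \<and> b \<noteq> c)"

definition sequel :: "rule \<Rightarrow> 'a state \<Rightarrow> 'a state" where
  "sequel \<Pi> A = (let U = Den A Map.empty \<Pi> in
     if clash U then A
     else A\<lparr>dyn := (\<lambda>f xs. if \<exists>b. (f, xs, b) \<in> U then THE b. (f, xs, b) \<in> U else dyn A f xs)\<rparr>)"


section \<open>Runs\<close>

definition halted :: "'a state \<Rightarrow> bool" where
  "halted A \<longleftrightarrow> dyn A Halt [] = one_obj"

definition output_true :: "'a state \<Rightarrow> bool" where
  "output_true A \<longleftrightarrow> dyn A Output [] = one_obj"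

text \<open>\<open>run \<Pi> I i\<close> is \<open>Some\<close> of the \<open>i\<close>-th state, or \<open>None\<close> if the run stops before step \<open>i\<close>.\<close>

primrec run :: "rule \<Rightarrow> 'a istruct \<Rightarrow> nat \<Rightarrow> 'a state option" where
  "run \<Pi> I 0 = Some (initial_state I)"
| "run \<Pi> I (Suc i) =
     (case run \<Pi> I i of
        None \<Rightarrow> None
      | Some A \<Rightarrow> if halted A then None else Some (sequel \<Pi> A))"

text \<open>Every element of a run is a state.\<close>

lemma zero_in_HF [simp]: "zero_obj \<in> HF X"
  by (auto simp: zero_obj_def intro: HF.intros)

lemma one_in_HF [simp]: "one_obj \<in> HF X"
  by (auto simp: one_obj_def zero_obj_def intro!: HF.intros)

lemma truth_value_in_HF [simp]: "truth_value b \<in> HF X"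
  by (simp add: truth_value_def)

lemma is_boolean_simps [simp]:
  "is_boolean zero_obj" "is_boolean one_obj" "is_boolean (truth_value b)" "is_boolean (connective c x y)"
  by (auto simp: is_boolean_def truth_value_def connective_def)

lemma elems_in_HF: "x \<in> HF X \<Longrightarrow> y |\<in>| elems x \<Longrightarrow> y \<in> HF X"
  by (erule HF.cases) auto

lemma initial_state_is_state:
  assumes "I \<in> structures V"
  shows "is_state V D (initial_state I)"
proof -
  have "Extent (initial_state I) f = {}" for f
    by (auto simp: Extent_def initial_state_def)
  then show ?thesis using assms by (simp add: is_state_def initial_state_def)
qed

lemma dyn_in_base_set:
  assumes "is_state V D A"
  shows "dyn A f xs \<in> base_set A"
proof (cases "dyn A f xs = zero_obj")
  case False
  then have "(xs, dyn A f xs) \<in> Extent A f" by (simp add: Extent_def)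
  then show ?thesis using assms by (fastforce simp: is_state_def)
qed (simp add: base_set_def)

lemma interp_in_base_set:
  assumes A: "is_state V D A" and sig: "signature V D f = Some (length xs, b)"
    and xs: "set xs \<subseteq> base_set A"
  shows "interp A f xs \<in> base_set A"
proof -
  have nth: "xs ! i \<in> HF (fset (universe (input A)))" if "i < length xs" for i
    using xs that by (auto simp: base_set_def)
  show ?thesis
  proof (cases f)
    case UnionN
    have "y \<in> HF (fset (universe (input A)))" if y: "y |\<in>| ffUnion (elems |`| elems (xs ! 0))" for y
    proof -
      have "xs ! 0 \<in> HF (fset (universe (input A)))" using UnionN sig by (intro nth) auto
      moreover obtain z where "z |\<in>| elems (xs ! 0)" "y |\<in>| elems z" using y by (auto simp: ffUnion.rep_eq)
      ultimately show ?thesis using elems_in_HF by blast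
    qed
    with UnionN show ?thesis by (auto simp: base_set_def intro!: HF_set)
  next
    case TheUniqueN
    then have 0: "xs ! 0 \<in> HF (fset (universe (input A)))" using sig by (intro nth) auto
    show ?thesis
    proof (cases "\<exists>!x. x |\<in>| elems (xs ! 0)")
      case True
      then have "(THE x. x |\<in>| elems (xs ! 0)) \<in> HF (fset (universe (input A)))"
        using elems_in_HF[OF 0] theI'[OF True] by blast
      with True show ?thesis by (simp add: TheUniqueN base_set_def)
    next
      case False
      then show ?thesis by (simp add: TheUniqueN base_set_def)
    qed
  next
    case AtomsN
    then show ?thesis by (auto simp: base_set_def intro!: HF.intros)
  next
    case PairN
    then show ?thesis using sig nth[of 0] nth[of 1]
      by (auto simp: base_set_def intro!: HF_set)
  next
    case (DynN g)
    then show ?thesis using dyn_in_base_set[OF A] by simp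
  qed (auto simp: base_set_def connective_def)
qed

lemma val_in_base_set:
  assumes A: "is_state V D A"
  shows "wf_trm V D t \<Longrightarrow> \<forall>v\<in>free_vars t. \<exists>x\<in>base_set A. e v = Some x \<Longrightarrow> val A e t \<in> base_set A"
proof (induction t arbitrary: e)
  case (App f ts)
  then obtain b where "signature V D f = Some (length (map (val A e) ts), b)" by auto
  moreover have "set (map (val A e) ts) \<subseteq> base_set A" using App by fastforce
  ultimately show ?case using interp_in_base_set[OF A] by simp
next
  case (Compr t v r g)
  have r: "val A e r \<in> base_set A" using Compr by simp
  have "val A (e(v \<mapsto> a)) t \<in> base_set A" if "a |\<in>| elems (val A e r)" for a
  proof -
    have "a \<in> base_set A" using r that elems_in_HF by (auto simp: base_set_def)
    then show ?thesis using Compr.prems by (intro Compr.IH(1)) auto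
  qed
  then show ?case by (auto simp: base_set_def intro!: HF_set)
qed auto

lemma val_boolean:
  assumes A: "is_state V D A" and "boolean_trm V D t"
  shows "is_boolean (val A e t)"
proof -
  obtain f ts j where t: "t = App f ts" and sig: "signature V D f = Some (j, True)"
    using assms(2) by (cases t) auto
  show ?thesis
  proof (cases f)
    case (DynN g)
    define xs where "xs = map (val A e) ts"
    have "is_boolean (dyn A g xs)"
    proof (cases "dyn A g xs = zero_obj")
      case False
      then have "(xs, dyn A g xs) \<in> Extent A g" by (simp add: Extent_def)
      then show ?thesis using A DynN sig by (fastforce simp: is_state_def)
    qed simp
    then show ?thesis using DynN t by (simp add: xs_def)
  qed (use t sig in auto)
qed

lemma Den_wf:
  assumes A: "is_state V D A"
  shows "wf_rule V D R \<Longrightarrow> \<forall>v\<in>free_vars_rule R. \<exists>x\<in>base_set A. e v = Some x \<Longrightarrow>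
    finite (Den A e R) \<and> (\<forall>(f, xs, y)\<in>Den A e R. \<exists>b. fmlookup D f = Some (length xs, b) \<and>
       set xs \<subseteq> base_set A \<and> y \<in> base_set A \<and> (b \<longrightarrow> is_boolean y))"
proof (induction R arbitrary: e)
  case (Update f ts t)
  have "val A e t \<in> base_set A" using Update.prems by (intro val_in_base_set[OF A]) auto
  moreover have "val A e s \<in> base_set A" if "s \<in> set ts" for s
    using Update.prems that by (intro val_in_base_set[OF A]) auto
  ultimately
  show ?case using Update.prems val_boolean[OF A] by auto
next
  case (Forall v r R)
  have r: "val A e r \<in> base_set A" using Forall val_in_base_set[OF A] by simp
  have "finite (Den A (e(v \<mapsto> a)) R) \<and> (\<forall>(f, xs, y)\<in>Den A (e(v \<mapsto> a)) R. \<exists>b. fmlookup D f = Some (length xs, b) \<and>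
       set xs \<subseteq> base_set A \<and> y \<in> base_set A \<and> (b \<longrightarrow> is_boolean y))"
    if "a |\<in>| elems (val A e r)" for a
  proof -
    have "a \<in> base_set A" using r that elems_in_HF by (auto simp: base_set_def)
    then show ?thesis using Forall.prems by (intro Forall.IH) auto
  qed
  then show ?case by fastforce
next
  case (Cond g R1 R2)
  show ?case
  proof (cases "val A e g = one_obj")
    case True
    then have "Den A e (Cond g R1 R2) = Den A e R1" by simp
    then show ?thesis using Cond.prems by (simp only:) (intro Cond.IH(1); simp)
  next
    case False
    then have "Den A e (Cond g R1 R2) = Den A e R2" by simp
    then show ?thesis using Cond.prems by (simp only:) (intro Cond.IH(2); simp)
  qed
qed auto

lemma sequel_is_state:
  assumes A: "is_state V D A" and \<Pi>: "is_program V D \<Pi>"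
  shows "is_state V D (sequel \<Pi> A)"
proof (cases "clash (Den A Map.empty \<Pi>)")
  case True
  then show ?thesis using A by (simp add: sequel_def)
next
  case False
  define U where "U = Den A Map.empty \<Pi>"
  have U: "finite U" "\<And>f xs y. (f, xs, y) \<in> U \<Longrightarrow> \<exists>b. fmlookup D f = Some (length xs, b) \<and>
       set xs \<subseteq> base_set A \<and> y \<in> base_set A \<and> (b \<longrightarrow> is_boolean y)"
    using Den_wf[OF A, of \<Pi> Map.empty] \<Pi> by (auto simp: is_program_def U_def)
  have the: "(THE b. (f, xs, b) \<in> U) = b" if "(f, xs, b) \<in> U" for f xs b
    using that False by (auto simp: clash_def U_def)
  have ext: "(xs, y) \<in> Extent A f \<or> (f, xs, y) \<in> U" if "(xs, y) \<in> Extent (sequel \<Pi> A) f" for f xs y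
    using that False the by (auto simp: Extent_def sequel_def U_def[symmetric] Let_def split: if_splits)
  have inp: "input (sequel \<Pi> A) = input A" by (simp add: sequel_def Let_def)
  then have base: "base_set (sequel \<Pi> A) = base_set A" by (simp add: base_set_def)
  have "finite (Extent (sequel \<Pi> A) f)" for f
  proof (rule finite_subset)
    show "Extent (sequel \<Pi> A) f \<subseteq> Extent A f \<union> snd ` U" using ext by force
    show "finite (Extent A f \<union> snd ` U)" using A U(1) by (simp add: is_state_def)
  qed
  moreover have "\<exists>b. fmlookup D f = Some (length xs, b) \<and> set xs \<subseteq> base_set A \<and> y \<in> base_set A \<and>
             (b \<longrightarrow> is_boolean y)" if "(xs, y) \<in> Extent (sequel \<Pi> A) f" for f xs y
    using ext[OF that] U(2) A by (auto simp: is_state_def)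
  ultimately show ?thesis using A inp base by (auto simp: is_state_def)
qed

lemma run_is_state:
  assumes "I \<in> structures V" "is_program V D \<Pi>"
  shows "run \<Pi> I i = Some A \<Longrightarrow> is_state V D A"
  using assms
  by (induction i arbitrary: A)
     (auto simp: initial_state_is_state sequel_is_state split: option.splits if_splits)

definition critical :: "dyn_voc \<Rightarrow> 'a state \<Rightarrow> 'a obj set" where
  "critical D A =
     Atom ` fset (universe (input A)) \<union> {zero_obj, one_obj} \<union>
     {dyn A f xs | f xs b. fmlookup D f = Some (length xs, b) \<and> set xs \<subseteq> base_set A} \<union>
     {x. \<exists>f xs b. fmlookup D f = Some (length xs, b) \<and> set xs \<subseteq> base_set A \<and>
           dyn A f xs \<noteq> zero_obj \<and> x \<in> set xs}"

definition active :: "dyn_voc \<Rightarrow> 'a state \<Rightarrow> 'a obj set" where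
  "active D A = (\<Union>y\<in>critical D A. TC y)"

text \<open>The objects active at one of the first \<open>l + 1\<close> states of the run.\<close>

definition active_upto :: "dyn_voc \<Rightarrow> rule \<Rightarrow> 'a istruct \<Rightarrow> nat \<Rightarrow> 'a obj set" where
  "active_upto D \<Pi> I l = \<Union>{active D A | A i. i \<le> l \<and> run \<Pi> I i = Some A}"


section \<open>PTime programs\<close>

record ptime_program =
  dynamics :: dyn_voc
  program :: rule
  time_bound :: "int poly"
  active_bound :: "int poly"

definition is_ptime_program :: "input_voc \<Rightarrow> ptime_program \<Rightarrow> bool" where
  "is_ptime_program V P \<longleftrightarrow> is_program V (dynamics P) (program P)"

text \<open>The initial segment of length \<open>l\<close>, consisting of \<open>l + 1\<close> states, exists and obeys both
  bounds.\<close>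

definition within_bounds :: "ptime_program \<Rightarrow> 'a istruct \<Rightarrow> nat \<Rightarrow> bool" where
  "within_bounds P I l \<longleftrightarrow>
     run (program P) I l \<noteq> None \<and>
     int l \<le> poly (time_bound P) (int (struct_size I)) \<and>
     finite (active_upto (dynamics P) (program P) I l) \<and>
     int (card (active_upto (dynamics P) (program P) I l))
       \<le> poly (active_bound P) (int (struct_size I))"

text \<open>If already the initial state exceeds the bounds, then the run of the PTime program is empty
  and has no final state.\<close>

definition final_state :: "ptime_program \<Rightarrow> 'a istruct \<Rightarrow> 'a state \<Rightarrow> bool" where
  "final_state P I A \<longleftrightarrow>
     (\<exists>l. within_bounds P I l \<and> (\<forall>m. within_bounds P I m \<longrightarrow> m \<le> l) \<and>
          run (program P) I l = Some A)"

definition accepts :: "ptime_program \<Rightarrow> 'a istruct \<Rightarrow> bool" where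
  "accepts P I \<longleftrightarrow> (\<exists>A. final_state P I A \<and> halted A \<and> output_true A)"

definition rejects :: "ptime_program \<Rightarrow> 'a istruct \<Rightarrow> bool" where
  "rejects P I \<longleftrightarrow> (\<exists>A. final_state P I A \<and> halted A \<and> \<not> output_true A)"

definition CPTime_pairs :: "input_voc \<Rightarrow> ('a istruct set \<times> 'a istruct set) set" where
  "CPTime_pairs V = {(K1, K2). K1 \<subseteq> structures V \<and> K2 \<subseteq> structures V \<and> K1 \<inter> K2 = {} \<and>
     (\<exists>P. is_ptime_program V P \<and> (\<forall>I\<in>K1. accepts P I) \<and> (\<forall>I\<in>K2. rejects P I))}"

definition CPTime :: "input_voc \<Rightarrow> 'a istruct set set" where
  "CPTime V = {K. K \<subseteq> structures V \<and> (K, structures V - K) \<in> CPTime_pairs V}"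

end

(* Over a naked set with atom set X, every state of a run is invariant under all permutations of X.
   A polynomially large, transitive, permutation-invariant family of objects can only contain
   objects that depend, hereditarily, on a bounded number k of atoms: an object with an
   intermediate support has too many images of its support, and an object without a dominating
   class of interchangeable atoms has exponentially many images.  For a larger atom set Y, there is
   an embedding of the hereditarily k-supported objects over X into the objects over Y, which
   replaces every set by the closure of the embedded elements under the permutations of Y that fix
   the support of the set.  If X is large, the embedding commutes with the evaluation of terms and
   rules, so that the run on Y follows the run on X and halts with the same output.  A PTime program
   therefore gives the same answer on all sufficiently large naked sets; only the smaller of the two
   structures needs the resource bounds. *)
theory Submission
  imports Defs "HOL-Combinatorics.Permutations"
begin

section \<open>Atom permutations acting on objects\<close>

text \<open>The resource bound limits the active objects of the states, whereas a single step also
  meets intermediate values of terms. These stay in a transitive invariant family of at most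
  \<open>N ^ d\<close> objects, where \<open>N\<close> counts the active objects and
  \<open>d\<close> depends only on the program. With \<open>n ^ c\<close> bounding the active
  objects over \<open>n\<close> atoms, this leads to \<open>k = c * d + 1\<close>: the bound
  \<open>k\<close> is fixed before \<open>n\<close>, and for large \<open>n\<close> the number
  \<open>n ^ k\<close> is below both \<open>n choose (k + 1)\<close> and an exponential in
  \<open>n\<close>.

  The obstacle to following the run over Y is that the embedding is not onto: bound variables over Y
  range over objects outside its image. The remedy is to move. Any element of an embedded set is
  carried to an embedded element by a permutation of Y that fixes a prescribed small set of atoms,
  chosen to contain the supports of everything named so far. Such permutations are automorphisms of
  the state over Y, so an evaluation at an arbitrary element is reduced to one at an embedded
  element. The same device compares set values, updates and clashes.\<close>

lemma elems_map_obj [simp]: "elems (map_obj f x) = map_obj f |`| elems x"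
  by (cases x) auto

lemma map_obj_comp: "map_obj f (map_obj g x) = map_obj (f \<circ> g) x"
  by (simp add: obj.map_comp)

lemma map_obj_o: "map_obj (f \<circ> g) x = map_obj f (map_obj g x)"
  by (simp only: map_obj_comp)

lemma map_obj_inv:
  assumes "bij f"
  shows "map_obj (inv f) (map_obj f x) = x" "map_obj f (map_obj (inv f) x) = x"
proof -
  have "inv f \<circ> f = id" "f \<circ> inv f = id"
    using assms by (simp_all add: bij_is_inj bij_is_surj flip: surj_iff)
  then show "map_obj (inv f) (map_obj f x) = x" "map_obj f (map_obj (inv f) x) = x"
    by (simp_all add: map_obj_comp obj.map_id)
qed

lemma map_obj_inject: "bij f \<Longrightarrow> map_obj f x = map_obj f y \<longleftrightarrow> x = y"
  by (meson bij_is_inj injD obj.inj_map)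

lemma map_obj_elem_iff: "bij f \<Longrightarrow> map_obj f y |\<in>| elems (map_obj f x) \<longleftrightarrow> y |\<in>| elems x"
  by (auto simp: map_obj_inject)

lemma map_obj_zero [simp]: "map_obj f zero_obj = zero_obj"
  by (simp add: zero_obj_def)

lemma map_obj_one [simp]: "map_obj f one_obj = one_obj"
  by (simp add: one_obj_def)

lemma map_obj_HF: "x \<in> HF X \<Longrightarrow> f ` X \<subseteq> Z \<Longrightarrow> map_obj f x \<in> HF Z"
  by (induction rule: HF.induct) (auto intro!: HF.intros)

text \<open>The complements of \<open>B\<close> and of its image in the finite set \<open>Z\<close>
  have equal size, so a bijection between them completes \<open>f\<close>. This realises any
  prescribed motion of a support.\<close>

lemma permutes_extension:
  assumes "finite Z" "B \<subseteq> Z" "inj_on f B" "f ` B \<subseteq> Z"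
  obtains p where "p permutes Z" "\<And>b. b \<in> B \<Longrightarrow> p b = f b"
proof -
  have "card (Z - B) = card (Z - f ` B)"
    using assms by (simp add: card_Diff_subset finite_subset card_image)
  then obtain h where h: "bij_betw h (Z - B) (Z - f ` B)"
    using assms(1) by (meson finite_Diff finite_same_card_bij)
  define p where "p a = (if a \<in> B then f a else if a \<in> Z then h a else a)" for a
  have "bij_betw p (B \<union> (Z - B)) (f ` B \<union> (Z - f ` B))"
  proof (rule bij_betw_combine)
    show "bij_betw p B (f ` B)"
      using assms(3) by (subst bij_betw_cong[where g = f]) (auto simp: p_def inj_on_imp_bij_betw)
    show "bij_betw p (Z - B) (Z - f ` B)"
      using h by (subst bij_betw_cong[where g = h]) (auto simp: p_def)
  qed auto
  then have "bij_betw p Z Z" using assms(2,4) by (simp add: Un_absorb1)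
  then have "p permutes Z" by (rule bij_imp_permutes) (use assms(2) in \<open>auto simp: p_def\<close>)
  then show thesis by (rule that) (simp add: p_def)
qed

lemma permutes_Diff:
  assumes "p permutes Y" "\<And>a. a \<in> S \<Longrightarrow> p a = a"
  shows "p permutes (Y - S)"
  using assms by (auto simp: permutes_def)

section \<open>Supports\<close>

definition interchangeable :: "'a obj \<Rightarrow> 'a \<Rightarrow> 'a \<Rightarrow> bool" where
  "interchangeable x a b \<longleftrightarrow> map_obj (transpose a b) x = x"

lemma interchangeable_refl [simp]: "interchangeable x a a"
  by (simp add: interchangeable_def obj.map_id)

lemma interchangeable_sym: "interchangeable x a b \<Longrightarrow> interchangeable x b a"
  by (simp add: interchangeable_def transpose_commute)

text \<open>The transposition of \<open>a\<close> and \<open>c\<close> is the conjugate of that of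
  \<open>b\<close> and \<open>c\<close> by that of \<open>a\<close> and \<open>b\<close>, unless the
  atoms coincide.\<close>

lemma interchangeable_trans:
  assumes "interchangeable x a b" "interchangeable x b c"
  shows "interchangeable x a c"
proof (cases "a = c \<or> b = c")
  case False
  then have "transpose a c = transpose a b \<circ> transpose b c \<circ> transpose a b"
    by (simp add: transpose_comp_triple)
  then show ?thesis
    using assms by (simp only: interchangeable_def map_obj_o)
qed (use assms in auto)

text \<open>If fewer than half of the atoms suffice to support \<open>x\<close>, then \<open>supp X x\<close> is the least support:
  the atoms outside it form the only interchangeability class with more than half of the atoms.\<close>

definition supp :: "'a set \<Rightarrow> 'a obj \<Rightarrow> 'a set" where
  "supp X x = {a \<in> X. 2 * card {b \<in> X. interchangeable x a b} \<le> card X}"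

lemma supp_subset [simp]: "supp X x \<subseteq> X"
  by (auto simp: supp_def)

text \<open>Each of the two atoms has a class with more than half of the atoms of \<open>X\<close>;
  two such classes meet, hence are equal.\<close>

lemma interchangeable_outside_supp:
  assumes "finite X" "a \<in> X - supp X x" "b \<in> X - supp X x"
  shows "interchangeable x a b"
proof -
  let ?c = "\<lambda>a. {b \<in> X. interchangeable x a b}"
  have "?c a \<inter> ?c b \<noteq> {}"
  proof
    assume "?c a \<inter> ?c b = {}"
    then have "card (?c a) + card (?c b) = card (?c a \<union> ?c b)"
      using assms(1) by (subst card_Un_disjoint) auto
    also have "\<dots> \<le> card X" using assms(1) by (intro card_mono) auto
    finally show False using assms by (auto simp: supp_def)
  qed
  then show ?thesis using interchangeable_sym interchangeable_trans by fast
qed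

text \<open>Permutations of a finite set are products of transpositions, and a transposition of two
  atoms outside the support fixes \<open>x\<close>.\<close>

lemma supp_fixes:
  assumes "finite X" "p permutes (X - supp X x)"
  shows "map_obj p x = x"
  using assms(2) finite_Diff[OF assms(1)]
proof (induction rule: permutes_induct)
  case (swap a b p)
  then have "interchangeable x a b"
    by (intro interchangeable_outside_supp[OF assms(1)])
  then show ?case using swap.IH by (simp only: interchangeable_def map_obj_o)
qed (rule obj.map_id)

lemma supp_fixes':
  assumes "finite X" "p permutes X" "\<And>a. a \<in> supp X x \<Longrightarrow> p a = a"
  shows "map_obj p x = x"
  using supp_fixes[OF assms(1) permutes_Diff[OF assms(2,3)]] .

text \<open>The atoms outside \<open>S\<close> are pairwise interchangeable and more than half of
  \<open>X\<close>, so none of them has a class small enough to belong to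
  \<open>supp X x\<close>.\<close>

lemma supp_least:
  assumes X: "finite X" and S: "2 * card S < card X" "S \<subseteq> X"
    and fixed: "\<And>p. p permutes (X - S) \<Longrightarrow> map_obj p x = x"
  shows "supp X x \<subseteq> S"
proof
  fix a assume a: "a \<in> supp X x"
  show "a \<in> S"
  proof (rule ccontr)
    assume "a \<notin> S"
    with a have aX: "a \<in> X - S" by (simp add: supp_def)
    have "X - S \<subseteq> {b \<in> X. interchangeable x a b}"
      using fixed aX by (auto simp: interchangeable_def permutes_swap_id)
    then have "card (X - S) \<le> card {b \<in> X. interchangeable x a b}"
      using X by (intro card_mono) auto
    moreover have "card (X - S) = card X - card S"
      using S X by (simp add: card_Diff_subset finite_subset)
    moreover have "2 * card {b \<in> X. interchangeable x a b} \<le> card X"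
      using a by (simp add: supp_def)
    ultimately show False using S(1) by linarith
  qed
qed

lemma interchangeable_map_obj:
  assumes "bij p"
  shows "interchangeable (map_obj p x) (p a) (p b) \<longleftrightarrow> interchangeable x a b"
proof -
  have "transpose (p a) (p b) \<circ> p = p \<circ> transpose a b"
    using assms by (auto simp: fun_eq_iff transpose_def bij_def inj_eq)
  then have "map_obj (transpose (p a) (p b)) (map_obj p x) = map_obj p (map_obj (transpose a b) x)"
    by (simp only: map_obj_comp)
  then show ?thesis by (simp add: interchangeable_def map_obj_inject[OF assms])
qed

text \<open>The permutation \<open>p\<close> carries the interchangeability classes of
  \<open>x\<close> to those of its image, so class sizes are preserved.\<close>

lemma supp_map_obj:
  assumes "p permutes X"
  shows "supp X (map_obj p x) = p ` supp X x"
proof -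
  have bij: "bij p" using assms by (rule permutes_bij)
  have "card {b \<in> X. interchangeable (map_obj p x) (p a) b} = card {b \<in> X. interchangeable x a b}" for a
  proof -
    have "{b \<in> X. interchangeable (map_obj p x) (p a) b} = p ` {b \<in> X. interchangeable x a b}"
    proof (intro set_eqI iffI)
      fix b assume b: "b \<in> {b \<in> X. interchangeable (map_obj p x) (p a) b}"
      then obtain c where "b = p c" "c \<in> X"
        using permutes_image[OF assms] by blast
      with b show "b \<in> p ` {b \<in> X. interchangeable x a b}"
        by (simp add: interchangeable_map_obj[OF bij])
    qed (auto simp: interchangeable_map_obj[OF bij] permutes_in_image[OF assms])
    then show ?thesis
      using bij by (simp add: card_image bij_def inj_on_def)
  qed
  note card = this
  show ?thesis
  proof (intro set_eqI iffI)
    fix b assume b: "b \<in> supp X (map_obj p x)"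
    then have "b \<in> p ` X" by (simp add: supp_def permutes_image[OF assms])
    then obtain c where "b = p c" "c \<in> X" by blast
    with b show "b \<in> p ` supp X x" by (simp add: supp_def card)
  qed (auto simp: supp_def card permutes_in_image[OF assms])
qed

lemma supp_Atom:
  assumes "a \<in> X" "2 \<le> card X"
  shows "a \<in> supp X (Atom a)"
proof -
  have "{b \<in> X. interchangeable (Atom a) a b} = {a}"
    using assms(1) by (auto simp: interchangeable_def)
  then show ?thesis using assms by (simp add: supp_def)
qed

lemma card_supp_Atom:
  assumes "finite X" "a \<in> X" "3 \<le> card X"
  shows "card (supp X (Atom a)) \<le> 1"
proof -
  have "supp X (Atom a) \<subseteq> {a}"
    \<comment> \<open>Three atoms are what makes the support \<open>{a}\<close> smaller than half of
      \<open>X\<close>.\<close>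
    using assms by (intro supp_least) (auto simp: permutes_def)
  then show ?thesis using card_mono[of "{a}"] by fastforce
qed

section \<open>Objects with hereditarily small supports\<close>

lemma map_obj_fixed_elem:
  assumes "map_obj f x = x" "y |\<in>| elems x"
  shows "map_obj f y |\<in>| elems x"
  using fimage_eqI[OF refl assms(2), of "map_obj f"] assms(1) by (simp flip: elems_map_obj)

text \<open>Atoms enter without a bound on their support, which has at most one element as soon as
  there are three atoms.\<close>

inductive_set symm :: "'a set \<Rightarrow> nat \<Rightarrow> 'a obj set" for X k where
  symm_Atom: "a \<in> X \<Longrightarrow> Atom a \<in> symm X k"
| symm_HSet: "(\<And>y. y |\<in>| s \<Longrightarrow> y \<in> symm X k) \<Longrightarrow> card (supp X (HSet s)) \<le> k \<Longrightarrow>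
    HSet s \<in> symm X k"

lemma symm_elems: "x \<in> symm X k \<Longrightarrow> y |\<in>| elems x \<Longrightarrow> y \<in> symm X k"
  by (erule symm.cases) auto

lemma symm_HF: "x \<in> symm X k \<Longrightarrow> x \<in> HF X"
  by (induction rule: symm.induct) (auto intro: HF.intros)

lemma symm_map_obj:
  assumes p: "p permutes X"
  shows "x \<in> symm X k \<Longrightarrow> map_obj p x \<in> symm X k"
proof (induction rule: symm.induct)
  case (symm_Atom a)
  then show ?case by (simp add: symm.symm_Atom permutes_in_image[OF p])
next
  case (symm_HSet s)
  have "card (supp X (map_obj p (HSet s))) = card (supp X (HSet s))"
    using permutes_inj_on[OF p] by (simp only: supp_map_obj[OF p] card_image)
  then show ?case using symm_HSet by (auto intro!: symm.symm_HSet)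
qed

lemma card_supp_symm:
  assumes "finite X" "3 \<le> card X" "1 \<le> k"
  shows "x \<in> symm X k \<Longrightarrow> card (supp X x) \<le> k"
proof (induction rule: symm.induct)
  case (symm_Atom a)
  then show ?case using card_supp_Atom[of X a] assms by simp
qed

section \<open>Small invariant families of objects\<close>

text \<open>A transposition is an involution, so a set that it maps into itself is mapped onto
  itself.\<close>

lemma moved_elem:
  assumes "\<not> interchangeable (HSet s) a b"
  shows "\<exists>y. y |\<in>| s \<and> map_obj (transpose a b) y |\<notin>| s"
proof (rule ccontr)
  let ?t = "transpose a b"
  assume "\<nexists>y. y |\<in>| s \<and> map_obj ?t y |\<notin>| s"
  then have closed: "map_obj ?t y |\<in>| s" if "y |\<in>| s" for y using that by blast
  have twice: "map_obj ?t (map_obj ?t y) = y" for y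
    by (simp add: map_obj_comp obj.map_id)
  have "map_obj ?t |`| s = s"
  proof (intro fset_eqI iffI)
    fix y assume "y |\<in>| s"
    then have "map_obj ?t (map_obj ?t y) |\<in>| map_obj ?t |`| s" using closed by blast
    then show "y |\<in>| map_obj ?t |`| s" unfolding twice .
  qed (use closed in auto)
  then show False using assms by (simp add: interchangeable_def)
qed

text \<open>If \<open>p\<close> and \<open>q\<close> avoid \<open>a\<close>, \<open>b\<close> and the support of \<open>y\<close>, then \<open>p x = (a b) q x\<close> is impossible, because
  \<open>inv q p\<close> fixes \<open>y\<close> and would act on \<open>x\<close> as the transposition, which expels \<open>y\<close>.\<close>

lemma card_images_doubling:
  assumes X: "finite X" and y: "y |\<in>| elems x" "map_obj (transpose a b) y |\<notin>| elems x"
    and ab: "a \<in> Z" "b \<in> Z" and Z: "Z \<subseteq> X" and Z': "Z' \<subseteq> Z - supp X y - {a, b}"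
  defines "images \<equiv> \<lambda>Z. (\<lambda>p. map_obj p x) ` {p. p permutes Z}"
  shows "2 * card (images Z') \<le> card (images Z)"
proof -
  let ?t = "transpose a b"
  have fin: "finite (images V)" if "V \<subseteq> X" for V
    unfolding images_def using finite_permutations finite_subset[OF that X] by blast
  have t: "?t permutes Z" using ab by (rule permutes_swap_id)
  have twice: "map_obj ?t (map_obj ?t y) = y" for y :: "'a obj"
    by (simp add: map_obj_comp obj.map_id)
  have inj_t: "inj (map_obj ?t)" by (simp add: obj.inj_map)
  have "images Z' \<inter> map_obj ?t ` images Z' = {}"
  proof (rule ccontr)
    assume "images Z' \<inter> map_obj ?t ` images Z' \<noteq> {}"
    then obtain p q where p: "p permutes Z'" and q: "q permutes Z'"
      and eq: "map_obj p x = map_obj ?t (map_obj q x)"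
      unfolding images_def by auto
    have bij: "bij q" using q by (rule permutes_bij)
    have "q a = a" "q b = b" using q Z' by (auto simp: permutes_def)
    then have "?t \<circ> q = q \<circ> ?t"
      using bij by (auto simp: fun_eq_iff transpose_def bij_def inj_eq)
    then have "map_obj ?t (map_obj q x) = map_obj q (map_obj ?t x)" by (simp only: map_obj_comp)
    with eq have eq': "map_obj (inv q \<circ> p) x = map_obj ?t x"
      by (simp only: map_obj_o map_obj_inv[OF bij])
    have "inv q \<circ> p permutes Z'" using p q by (intro permutes_compose permutes_inv)
    then have "inv q \<circ> p permutes (X - supp X y)" by (rule permutes_subset) (use Z Z' in blast)
    then have "map_obj (inv q \<circ> p) y = y" by (rule supp_fixes[OF X])
    moreover have "map_obj (inv q \<circ> p) y |\<in>| elems (map_obj (inv q \<circ> p) x)"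
      unfolding elems_map_obj using y(1) by (rule fimageI)
    ultimately have "y |\<in>| elems (map_obj ?t x)" by (simp only: eq')
    then have "map_obj ?t y |\<in>| elems (map_obj ?t (map_obj ?t x))"
      unfolding elems_map_obj by (rule fimageI)
    then show False using y(2) unfolding twice by blast
  qed
  moreover have "images Z' \<union> map_obj ?t ` images Z' \<subseteq> images Z"
  proof -
    have "p permutes Z" if "p permutes Z'" for p using that Z' by (auto intro: permutes_subset)
    moreover have "map_obj ?t (map_obj p x) = map_obj (?t \<circ> p) x" for p by (simp only: map_obj_o)
    ultimately show ?thesis unfolding images_def using permutes_compose[OF _ t] by blast
  qed
  then have "card (images Z' \<union> map_obj ?t ` images Z') \<le> card (images Z)"
    using fin[OF Z] by (rule card_mono[rotated])
  moreover have "card (map_obj ?t ` images Z') = card (images Z')"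
    using inj_t by (simp add: card_image inj_on_def)
  moreover have "finite (images Z')" using fin Z Z' by blast
  ultimately show ?thesis by (simp add: card_Un_disjoint)
qed

text \<open>In each of \<open>j\<close> rounds two non-interchangeable atoms of \<open>Z\<close> and
  an element \<open>y\<close> expelled by their transposition double the number of images. The round
  discards both atoms and the support of \<open>y\<close>, at most \<open>k + 2\<close> atoms. The
  inequality keeps more than half of \<open>X\<close> in \<open>Z\<close> throughout, so that
  \<open>Z\<close> never fits into one class and a further pair exists.\<close>

lemma card_images_exponential:
  assumes X: "finite X" and elems: "\<And>y. y |\<in>| s \<Longrightarrow> card (supp X y) \<le> k"
    and classes: "\<And>a. a \<in> X \<Longrightarrow> 2 * card {b \<in> X. interchangeable (HSet s) a b} \<le> card X"
  shows "Z \<subseteq> X \<Longrightarrow> card X + 2 * j * (k + 2) < 2 * card Z \<Longrightarrow>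
    2 ^ j \<le> card ((\<lambda>p. map_obj p (HSet s)) ` {p. p permutes Z})"
proof (induction j arbitrary: Z)
  case 0
  have "finite ((\<lambda>p. map_obj p (HSet s)) ` {p. p permutes Z})"
    using finite_permutations finite_subset[OF 0(1) X] by blast
  moreover have "map_obj id (HSet s) \<in> (\<lambda>p. map_obj p (HSet s)) ` {p. p permutes Z}"
    using permutes_id by blast
  ultimately have "card ((\<lambda>p. map_obj p (HSet s)) ` {p. p permutes Z}) \<noteq> 0"
    by (metis card_0_eq empty_iff)
  then show ?case by simp
next
  case (Suc j)
  let ?x = "HSet s"
  have fZ: "finite Z" using Suc.prems(1) X by (rule finite_subset)
  have "card Z \<noteq> 0" using Suc.prems(2) by linarith
  then obtain a where a: "a \<in> Z" by (metis card.empty ex_in_conv)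
  have "\<not> Z \<subseteq> {b \<in> X. interchangeable ?x a b}"
  proof
    assume "Z \<subseteq> {b \<in> X. interchangeable ?x a b}"
    then have "card Z \<le> card {b \<in> X. interchangeable ?x a b}" using X by (intro card_mono) auto
    moreover have "2 * card {b \<in> X. interchangeable ?x a b} \<le> card X"
      using classes a Suc.prems(1) by blast
    ultimately show False using Suc.prems(2) by linarith
  qed
  then obtain b where b: "b \<in> Z" "\<not> interchangeable ?x a b" using Suc.prems(1) by blast
  obtain y where y: "y |\<in>| s" "map_obj (transpose a b) y |\<notin>| s" using moved_elem[OF b(2)] by blast
  define Z' where "Z' = Z - (supp X y \<union> {a, b})"
  have "card (supp X y \<union> {a, b}) \<le> card (supp X y) + card {a, b}" by (rule card_Un_le)
  also have "\<dots> \<le> k + 2" using elems[OF y(1)] card_insert_le_m1[of 2 "{b}" a] by simp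
  finally have "card Z - (k + 2) \<le> card Z'"
    unfolding Z'_def using diff_card_le_card_Diff[of "supp X y \<union> {a, b}" Z]
      finite_subset[OF supp_subset X] by fastforce
  then have "card X + 2 * j * (k + 2) < 2 * card Z'"
    using Suc.prems(2) by (simp add: algebra_simps)
  moreover have "Z' \<subseteq> X" using Suc.prems(1) Z'_def by blast
  ultimately have "2 ^ j \<le> card ((\<lambda>p. map_obj p ?x) ` {p. p permutes Z'})" by (rule Suc.IH[rotated])
  moreover have "2 * card ((\<lambda>p. map_obj p ?x) ` {p. p permutes Z'}) \<le>
    card ((\<lambda>p. map_obj p ?x) ` {p. p permutes Z})"
    by (rule card_images_doubling[OF X _ _ a b(1) Suc.prems(1), of y])
      (use y in \<open>auto simp only: elems.simps Z'_def\<close>)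
  ultimately show ?case by simp
qed

text \<open>Every subset of \<open>X\<close> of the size of \<open>supp X x\<close> is the support
  of some image of \<open>x\<close>, and distinct supports belong to distinct images.\<close>

lemma card_images_supp:
  assumes X: "finite X" and W: "finite W" "\<And>p. p permutes X \<Longrightarrow> map_obj p x \<in> W"
  shows "card X choose card (supp X x) \<le> card W"
proof -
  have "{B. B \<subseteq> X \<and> card B = card (supp X x)} \<subseteq> supp X ` W"
  proof (safe)
    fix B assume B: "B \<subseteq> X" "card B = card (supp X x)"
    obtain f where f: "bij_betw f (supp X x) B"
      using finite_same_card_bij[of "supp X x" B] B finite_subset[OF _ X] supp_subset[of X x] by metis
    then obtain p where p: "p permutes X" "\<And>a. a \<in> supp X x \<Longrightarrow> p a = f a"
      using permutes_extension[OF X supp_subset, of f x] B(1) unfolding bij_betw_def by metis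
    have "p ` supp X x = B" using f p(2) by (auto simp: bij_betw_def)
    then have "supp X (map_obj p x) = B" by (simp add: supp_map_obj[OF p(1)])
    then show "B \<in> supp X ` W" using W(2)[OF p(1)] by blast
  qed
  then have "card {B. B \<subseteq> X \<and> card B = card (supp X x)} \<le> card (supp X ` W)"
    using W(1) by (intro card_mono) auto
  then show ?thesis using n_subsets[OF X] card_image_le[OF W(1)] by (metis le_trans)
qed

text \<open>If some class has more than half of the atoms, the support avoids it and has at most
  half of the atoms; a support larger than \<open>k\<close> then has at least
  \<open>card X choose (k + 1)\<close> images. If there is no such class, the number of images of
  the object is exponential.\<close>

lemma small_invariant_set_symm:
  assumes X: "finite X" "3 \<le> card X" and k: "1 \<le> k"
    and W: "finite W" "transitive_set W" "\<And>p x. p permutes X \<Longrightarrow> x \<in> W \<Longrightarrow> map_obj p x \<in> W"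
    and small: "card W < card X choose (k + 1)" "card W < 2 ^ ((card X - 1) div (2 * (k + 2)))"
  shows "x \<in> HF X \<Longrightarrow> x \<in> W \<Longrightarrow> x \<in> symm X k"
proof (induction rule: HF.induct)
  case (HF_set s)
  let ?x = "HSet s"
  have s: "y \<in> symm X k" if "y |\<in>| s" for y
  proof -
    have "y \<in> W" using W(2) HF_set.prems that unfolding transitive_set_def by (metis elems.simps(2))
    then show ?thesis using HF_set.IH that by blast
  qed
  have "card (supp X ?x) \<le> k"
  proof (rule ccontr)
    assume big: "\<not> card (supp X ?x) \<le> k"
    show False
    proof (cases "\<exists>a\<in>X. card X < 2 * card {b \<in> X. interchangeable ?x a b}")
      case True
      then obtain a where a: "a \<in> X" "card X < 2 * card {b \<in> X. interchangeable ?x a b}" by blast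
      have "supp X ?x \<subseteq> X - {b \<in> X. interchangeable ?x a b}"
      proof
        fix b assume b: "b \<in> supp X ?x"
        have "\<not> interchangeable ?x a b"
        proof
          assume ab: "interchangeable ?x a b"
          then have "{c \<in> X. interchangeable ?x b c} = {c \<in> X. interchangeable ?x a c}"
            using interchangeable_sym interchangeable_trans by metis
          then show False using a b by (simp add: supp_def)
        qed
        then show "b \<in> X - {b \<in> X. interchangeable ?x a b}" using b by (simp add: supp_def)
      qed
      then have "card (supp X ?x) \<le> card (X - {b \<in> X. interchangeable ?x a b})"
        using X by (intro card_mono) auto
      also have "\<dots> = card X - card {b \<in> X. interchangeable ?x a b}"
        using X by (intro card_Diff_subset) auto
      finally have "2 * card (supp X ?x) \<le> card X" using a(2) by linarith
      \<comment> \<open>Binomial coefficients increase up to the middle, and the support has between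
        \<open>k + 1\<close> and \<open>card X div 2\<close> atoms.\<close>
      then have "card X choose (k + 1) \<le> card X choose card (supp X ?x)"
        using big by (intro binomial_mono) auto
      also have "\<dots> \<le> card W" using X(1) W(1) W(3)[OF _ HF_set.prems] by (rule card_images_supp)
      finally show False using small(1) by simp
    next
      case False
      \<comment> \<open>The largest number of doubling rounds that can start from
        \<open>Z = X\<close>.\<close>
      let ?j = "(card X - 1) div (2 * (k + 2))"
      have "2 * (k + 2) * ?j \<le> card X - 1" by (rule times_div_less_eq_dividend)
      then have "card X + 2 * ?j * (k + 2) < 2 * card X" using X(2) by (simp add: algebra_simps)
      then have "2 ^ ?j \<le> card ((\<lambda>p. map_obj p ?x) ` {p. p permutes X})"
        using False card_supp_symm[OF X k s]
        by (intro card_images_exponential[OF X(1)]) (auto simp: not_less)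
      also have "\<dots> \<le> card W" using W(1) W(3)[OF _ HF_set.prems] by (intro card_mono) auto
      finally show False using small(2) by simp
    qed
  qed
  then show ?case using s by (intro symm.symm_HSet)
qed (rule symm.symm_Atom)

section \<open>Embedding symmetric objects into a larger universe\<close>

text \<open>The union is a plain set, hence \<open>Abs_fset\<close>; it is finite whenever
  \<open>Y\<close> is. For instance, the set of all atoms of \<open>X\<close> becomes the set of all
  atoms of \<open>Y\<close>.\<close>

primrec spread :: "'a set \<Rightarrow> 'a set \<Rightarrow> 'a obj \<Rightarrow> 'a obj" where
  "spread X Y (Atom a) = Atom a"
| "spread X Y (HSet s) = HSet (Abs_fset (\<Union>z\<in>fset (spread X Y |`| s).
     (\<lambda>p. map_obj p z) ` {p. p permutes (Y - supp X (HSet s))}))"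

lemma spread_HSet: "\<exists>t. spread X Y (HSet s) = HSet t"
  by simp

declare spread.simps(2) [simp del]

text \<open>The condition \<open>2 * k < card X\<close> puts supports of size \<open>k\<close> below
  one half, where \<open>supp_least\<close> applies. With \<open>1 \<le> k\<close> it also provides
  three atoms.\<close>

locale spreading =
  fixes X Y :: "'a set" and k :: nat
  assumes finite_Y: "finite Y" and X_Y: "X \<subseteq> Y" and k_pos: "1 \<le> k"
    and k_X: "2 * k < card X"
begin

lemma finite_X: "finite X"
  using finite_Y X_Y finite_subset by auto

lemma permutes_Y: "p permutes X \<Longrightarrow> p permutes Y"
  using X_Y permutes_subset by blast

abbreviation "T \<equiv> spread X Y"

abbreviation "S \<equiv> symm X k"

lemma elems_spread:
  "z |\<in>| elems (T x) \<longleftrightarrow>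
    (\<exists>y p. y |\<in>| elems x \<and> p permutes (Y - supp X x) \<and> z = map_obj p (T y))"
proof (cases x)
  case (HSet s)
  have "finite (\<Union>z\<in>fset (T |`| s). (\<lambda>p. map_obj p z) ` {p. p permutes (Y - supp X (HSet s))})"
    using finite_Y by (auto intro!: finite_permutations)
  then show ?thesis using HSet by (auto simp: Abs_fset_inverse spread.simps(2))
qed simp

lemma elems_spreadI: "y |\<in>| elems x \<Longrightarrow> T y |\<in>| elems (T x)"
  unfolding elems_spread using permutes_id obj.map_id by metis

lemma elems_spreadE:
  assumes "z |\<in>| elems (T x)"
  obtains y p where "y |\<in>| elems x" "p permutes (Y - supp X x)" "z = map_obj p (T y)"
  using assms elems_spread by blast

text \<open>The elements of \<open>T x\<close> form a union of orbits of these permutations. An atom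
  is its own support, so they fix it.\<close>

lemma supp_fixes_spread:
  assumes p: "p permutes (Y - supp X x)" and x: "x \<in> HF X"
  shows "map_obj p (T x) = T x"
proof (cases x)
  case (Atom a)
  then have "a \<in> X" using x by (auto elim: HF.cases)
  then have "a \<in> supp X x" using Atom supp_Atom[of a X] k_pos k_X by simp
  then have "p a = a" using p by (simp add: permutes_def)
  then show ?thesis using Atom by simp
next
  case (HSet s)
  have *: "map_obj p z |\<in>| elems (T x)" if p: "p permutes (Y - supp X x)" and z: "z |\<in>| elems (T x)" for p z
  proof -
    obtain y q where "y |\<in>| elems x" "q permutes (Y - supp X x)" "z = map_obj q (T y)"
      using z by (rule elems_spreadE)
    then show ?thesis unfolding elems_spread
      by (intro exI[of _ y] exI[of _ "p \<circ> q"]) (simp add: map_obj_comp permutes_compose p)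
  qed
  have bij: "bij p" using p by (rule permutes_bij)
  have "elems (map_obj p (T x)) = elems (T x)"
  proof (rule fset_eqI, rule iffI)
    fix z assume "z |\<in>| elems (T x)"
    then have "map_obj (inv p) z |\<in>| elems (T x)"
      by (rule *[OF permutes_inv[OF p]])
    then have "map_obj p (map_obj (inv p) z) |\<in>| elems (map_obj p (T x))" by simp
    then show "z |\<in>| elems (map_obj p (T x))" by (simp only: map_obj_inv[OF bij])
  qed (use *[OF p] in auto)
  then show ?thesis using HSet spread_HSet[of X Y s] by auto
qed

text \<open>Conjugation by \<open>p\<close> turns the permutations of \<open>Y\<close> that fix the
  support of \<open>x\<close> into those that fix the support of its image; \<open>p\<close> acts on
  \<open>Y\<close> by leaving the new atoms in place.\<close>

lemma spread_map_obj:
  assumes p: "p permutes X"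
  shows "T (map_obj p x) = map_obj p (T x)"
proof (induction x)
  case (HSet s)
  let ?x = "HSet s"
  have bij: "bij p" using p by (rule permutes_bij)
  have pY: "p permutes Y" using p by (rule permutes_Y)
  have IH: "T (map_obj p y) = map_obj p (T y)" if "y |\<in>| elems ?x" for y
    using HSet that by simp
  have conj: "p \<circ> q \<circ> inv p permutes (Y - supp X (map_obj p ?x))" if q: "q permutes (Y - supp X ?x)" for q
  proof (rule permutes_Diff)
    have "q permutes Y" using q permutes_subset by blast
    then show "p \<circ> q \<circ> inv p permutes Y" by (intro permutes_compose permutes_inv pY)
    fix a assume "a \<in> supp X (map_obj p ?x)"
    then obtain b where "a = p b" "b \<in> supp X ?x" using supp_map_obj[OF p] by blast
    moreover have "q b = b" using q \<open>b \<in> supp X ?x\<close> by (simp add: permutes_def)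
    ultimately show "(p \<circ> q \<circ> inv p) a = a" by (simp add: inv_f_f bij_is_inj[OF bij])
  qed
  have conj': "inv p \<circ> q \<circ> p permutes (Y - supp X ?x)" if q: "q permutes (Y - supp X (map_obj p ?x))" for q
  proof (rule permutes_Diff)
    have "q permutes Y" using q permutes_subset by blast
    then show "inv p \<circ> q \<circ> p permutes Y" by (intro permutes_compose permutes_inv pY)
    fix a assume "a \<in> supp X ?x"
    then have "p a \<in> supp X (map_obj p ?x)" using supp_map_obj[OF p] by blast
    then have "q (p a) = p a" using q by (simp add: permutes_def)
    then show "(inv p \<circ> q \<circ> p) a = a" by (simp add: inv_f_f bij_is_inj[OF bij])
  qed
  have "z |\<in>| elems (T (map_obj p ?x)) \<longleftrightarrow> z |\<in>| elems (map_obj p (T ?x))" for z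
  proof
    assume "z |\<in>| elems (T (map_obj p ?x))"
    then obtain y' q where y': "y' |\<in>| elems (map_obj p ?x)" and q: "q permutes (Y - supp X (map_obj p ?x))"
      "z = map_obj q (T y')"
      by (rule elems_spreadE)
    obtain y where y: "y |\<in>| elems ?x" "y' = map_obj p y" using y' by auto
    have "map_obj (inv p \<circ> q \<circ> p) (T y) |\<in>| elems (T ?x)"
      unfolding elems_spread using y(1) conj'[OF q(1)] by blast
    then have "map_obj p (map_obj (inv p \<circ> q \<circ> p) (T y)) |\<in>| elems (map_obj p (T ?x))"
      by (simp only: elems_map_obj fimage_eqI)
    also have "map_obj p (map_obj (inv p \<circ> q \<circ> p) (T y)) = z"
      by (simp only: map_obj_o map_obj_inv[OF bij] q(2) y(2) IH[OF y(1)])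
    finally show "z |\<in>| elems (map_obj p (T ?x))" .
  next
    assume "z |\<in>| elems (map_obj p (T ?x))"
    then obtain w where w: "w |\<in>| elems (T ?x)" "z = map_obj p w" by auto
    obtain y q where y: "y |\<in>| elems ?x" and q: "q permutes (Y - supp X ?x)" "w = map_obj q (T y)"
      using w(1) by (rule elems_spreadE)
    have "map_obj p y |\<in>| elems (map_obj p ?x)" using y by simp
    moreover have "z = map_obj (p \<circ> q \<circ> inv p) (T (map_obj p y))"
      by (simp only: map_obj_o IH[OF y] map_obj_inv[OF bij] w(2) q(2))
    ultimately show "z |\<in>| elems (T (map_obj p ?x))"
      unfolding elems_spread using conj[OF q(1)] by blast
  qed
  then have "elems (T (map_obj p ?x)) = elems (map_obj p (T ?x))" by (rule fset_eqI)
  then show ?case using spread_HSet[of X Y s] spread_HSet[of X Y "map_obj p |`| s"] by auto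
qed simp

lemma card_supp: "x \<in> S \<Longrightarrow> card (supp X x) \<le> k"
  using finite_X k_pos k_X by (intro card_supp_symm) auto

lemma card_Y: "card X \<le> card Y"
  using X_Y finite_Y card_mono by blast

lemma supp_spread_subset:
  assumes "x \<in> S"
  shows "supp Y (T x) \<subseteq> supp X x"
proof (rule supp_least[OF finite_Y])
  show "2 * card (supp X x) < card Y" using card_supp[OF assms] k_X card_Y by simp
  show "supp X x \<subseteq> Y" using subset_trans[OF supp_subset X_Y] .
  show "map_obj p (T x) = T x" if "p permutes Y - supp X x" for p
    using that supp_fixes_spread symm_HF[OF assms] by blast
qed

text \<open>Injectivity pulls symmetries of \<open>T x\<close> back to \<open>x\<close>. An atom of
  \<open>supp X x\<close> outside \<open>supp Y (T x)\<close> could be swapped with an atom outside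
  \<open>supp X x\<close> without changing \<open>T x\<close>, hence without changing
  \<open>x\<close>, and so would join the majority class. Injectivity is assumed at \<open>x\<close>
  alone because the lemma serves the induction that proves it in general.\<close>

lemma supp_spread_eq:
  assumes x: "x \<in> S" and inj: "\<And>x'. x' \<in> S \<Longrightarrow> T x = T x' \<Longrightarrow> x = x'"
  shows "supp Y (T x) = supp X x"
proof (rule antisym[OF supp_spread_subset[OF x]], rule subsetI, rule ccontr)
  fix a assume a: "a \<in> supp X x" "a \<notin> supp Y (T x)"
  have "a \<in> X" using a(1) by (simp add: supp_def)
  have "supp X x \<noteq> X" using card_supp[OF x] k_X by auto
  then obtain b where b: "b \<in> X - supp X x" using supp_subset[of X x] by blast
  have "map_obj (transpose c b) x = x" if "c \<in> X - supp Y (T x)" for c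
  proof -
    have perm: "transpose c b permutes X" using that b by (intro permutes_swap_id) auto
    have "map_obj (transpose c b) (T x) = T x"
      using that b X_Y supp_spread_subset[OF x]
      by (intro supp_fixes[OF finite_Y] permutes_swap_id) auto
    then have "T x = T (map_obj (transpose c b) x)" by (simp add: spread_map_obj[OF perm])
    then show ?thesis using inj[OF symm_map_obj[OF perm x]] by simp
  qed
  then have "interchangeable x a b" and *: "\<And>c. c \<in> X - supp X x \<Longrightarrow> interchangeable x c b"
    using a \<open>a \<in> X\<close> supp_spread_subset[OF x] by (auto simp: interchangeable_def)
  then have "interchangeable x a c" if "c \<in> X - supp X x" for c
    using that interchangeable_sym interchangeable_trans by metis
  then have "X - supp X x \<subseteq> {c \<in> X. interchangeable x a c}" by auto
  then have "card (X - supp X x) \<le> card {c \<in> X. interchangeable x a c}"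
    using finite_X by (intro card_mono) auto
  moreover have "card (X - supp X x) = card X - card (supp X x)"
    using finite_subset[OF supp_subset finite_X] by (simp add: card_Diff_subset)
  moreover have "2 * card {c \<in> X. interchangeable x a c} \<le> card X"
    using a by (simp add: supp_def)
  ultimately show False using card_supp[OF x] k_X by linarith
qed

text \<open>The action of \<open>p\<close> on \<open>w\<close> depends only on its values on
  \<open>supp Y w\<close>. If these stay in \<open>X\<close>, that partial map extends to a
  permutation of \<open>X\<close> fixing \<open>Z\<close>. This replaces permutations of
  \<open>Y\<close>, about which \<open>spread_map_obj\<close> says nothing, by permutations of
  \<open>X\<close>.\<close>

lemma realign:
  assumes Z: "Z \<subseteq> X" and p: "p permutes (Y - Z)"
    and w_X: "supp Y w \<subseteq> X" and into: "p ` supp Y w \<subseteq> X"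
  obtains q where "q permutes (X - Z)" "map_obj q w = map_obj p w"
proof -
  have p_Y: "p permutes Y" using p permutes_subset by blast
  have "p ` (supp Y w - Z) \<subseteq> X - Z"
  proof -
    have "p a \<notin> Z" if "a \<in> supp Y w - Z" for a
      using permutes_in_image[OF p, of a] that w_X X_Y by blast
    then show ?thesis using into by blast
  qed
  moreover have "supp Y w - Z \<subseteq> X - Z" using w_X by blast
  ultimately obtain q where q: "q permutes (X - Z)" "\<And>a. a \<in> supp Y w - Z \<Longrightarrow> q a = p a"
    using permutes_extension[OF finite_Diff[OF finite_X] _ permutes_inj_on[OF p]] by metis
  have eq: "q a = p a" if "a \<in> supp Y w" for a
  proof (cases "a \<in> Z")
    case True
    then show ?thesis using p q(1) by (simp add: permutes_def)
  qed (use q(2) that in simp)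
  have q_X: "q permutes X" using q(1) permutes_subset by blast
  have bij: "bij q" using q_X by (rule permutes_bij)
  have "map_obj (inv q \<circ> p) w = w"
  proof (rule supp_fixes'[OF finite_Y])
    show "inv q \<circ> p permutes Y"
      using p_Y permutes_Y[OF q_X] by (intro permutes_compose permutes_inv)
    show "(inv q \<circ> p) a = a" if "a \<in> supp Y w" for a
      using eq[OF that] bij by (metis bij_inv_eq_iff comp_apply)
  qed
  then have "map_obj q w = map_obj q (map_obj (inv q) (map_obj p w))" by (simp only: map_obj_o)
  then have "map_obj q w = map_obj p w" by (simp only: map_obj_inv[OF bij])
  with q(1) show thesis by (rule that)
qed

text \<open>An element \<open>T y\<close> of \<open>T x'\<close> is an image of some
  \<open>T y'\<close> with \<open>y'\<close> in \<open>x'\<close>. Both supports lie in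
  \<open>X\<close>, so the permutation can be taken in \<open>X\<close>; it then passes inside the
  embedding, the induction hypothesis identifies \<open>y\<close> with the image of
  \<open>y'\<close>, and this image is in \<open>x'\<close> because the permutation fixes
  \<open>x'\<close>.\<close>

lemma spread_inj: "x \<in> S \<Longrightarrow> x' \<in> S \<Longrightarrow> T x = T x' \<Longrightarrow> x = x'"
proof (induction x arbitrary: x' rule: symm.induct)
  case (symm_Atom a)
  then show ?case by (cases x') (simp_all, metis obj.distinct(1) spread_HSet)
next
  case (symm_HSet s)
  let ?x = "HSet s"
  have x: "?x \<in> S" using symm_HSet.hyps by (auto intro: symm.symm_HSet)
  have x': "x' \<in> S" by fact
  have IH: "y = y'" if "y |\<in>| s" "y' \<in> S" "T y = T y'" for y y'
    using symm_HSet.IH that by blast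
  have supp: "supp Y (T y) = supp X y" if "y |\<in>| s" for y
    using symm_HSet.hyps(1)[OF that] IH[OF that] by (rule supp_spread_eq)
  have Teq: "T ?x = T x'" by fact
  have "y |\<in>| elems x'" if y: "y |\<in>| s" for y
  proof -
    have "T y |\<in>| elems (T x')" using elems_spreadI[of y ?x] y unfolding Teq by simp
    then obtain y' p where y': "y' |\<in>| elems x'" "p permutes (Y - supp X x')" "T y = map_obj p (T y')"
      by (rule elems_spreadE)
    have y'S: "y' \<in> S" using symm_elems[OF x' y'(1)] .
    have p: "p permutes Y" using y'(2) permutes_subset by blast
    have "p ` supp Y (T y') = supp X y"
      using supp[OF y] supp_map_obj[OF p, of "T y'"] y'(3) by simp
    then have into: "p ` supp Y (T y') \<subseteq> X" by simp
    have "supp Y (T y') \<subseteq> X" using supp_spread_subset[OF y'S] supp_subset by (rule subset_trans)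
    then obtain q where q: "q permutes (X - supp X x')" "map_obj q (T y') = map_obj p (T y')"
      using realign[OF supp_subset y'(2) _ into] by blast
    have q_X: "q permutes X" using q(1) permutes_subset by blast
    have "T y = T (map_obj q y')" using q(2) y'(3) by (simp add: spread_map_obj[OF q_X])
    then have "y = map_obj q y'" using IH[OF y symm_map_obj[OF q_X y'S]] by simp
    then show ?thesis
      using map_obj_fixed_elem[OF supp_fixes[OF finite_X q(1)] y'(1)] by simp
  qed
  moreover have "y' |\<in>| s" if y': "y' |\<in>| elems x'" for y'
  proof -
    have y'S: "y' \<in> S" using symm_elems[OF x' y'] .
    have "T y' |\<in>| elems (T ?x)" using elems_spreadI[OF y'] unfolding Teq .
    then obtain y p where y: "y |\<in>| elems ?x" "p permutes (Y - supp X ?x)" "T y' = map_obj p (T y)"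
      by (rule elems_spreadE)
    have ys: "y |\<in>| s" using y(1) by simp
    have p: "p permutes Y" using y(2) permutes_subset by blast
    \<comment> \<open>The exact support of \<open>T y'\<close> is not yet known, as the induction
      hypothesis covers elements of \<open>s\<close> only; the inclusion suffices.\<close>
    have "supp Y (T y') \<subseteq> X" using supp_spread_subset[OF y'S] supp_subset by (rule subset_trans)
    then have into: "p ` supp Y (T y) \<subseteq> X"
      using supp_map_obj[OF p, of "T y"] y(3) by simp
    have "supp Y (T y) \<subseteq> X" using supp[OF ys] by simp
    then obtain q where q: "q permutes (X - supp X ?x)" "map_obj q (T y) = map_obj p (T y)"
      using realign[OF supp_subset y(2) _ into] by blast
    have q_X: "q permutes X" using q(1) permutes_subset by blast
    have bij: "bij q" using q_X by (rule permutes_bij)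
    have iq: "inv q permutes X" using permutes_inv[OF q_X] .
    \<comment> \<open>The permutation is moved to the side of \<open>y'\<close>, since the induction
      hypothesis is about \<open>y\<close> itself and not about its images.\<close>
    have "T (map_obj (inv q) y') = map_obj (inv q) (map_obj q (T y))"
      using q(2) y(3) by (simp add: spread_map_obj[OF iq])
    then have "T y = T (map_obj (inv q) y')" by (simp only: map_obj_inv[OF bij])
    then have "y = map_obj (inv q) y'" using IH[OF ys symm_map_obj[OF iq y'S]] by simp
    then have "y' = map_obj q y" by (simp only: map_obj_inv[OF bij])
    then show ?thesis
      using map_obj_fixed_elem[OF supp_fixes[OF finite_X q(1)] y(1)] by simp
  qed
  ultimately have "elems x' = s" by blast
  moreover obtain s' where "x' = HSet s'" using Teq spread_HSet[of X Y s] by (cases x') auto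
  ultimately show ?case by simp
qed

lemma supp_spread: "x \<in> S \<Longrightarrow> supp Y (T x) = supp X x"
  using supp_spread_eq spread_inj by blast

lemma spread_elem_iff:
  assumes "x \<in> S" "y \<in> S"
  shows "T y |\<in>| elems (T x) \<longleftrightarrow> y |\<in>| elems x"
proof
  assume "T y |\<in>| elems (T x)"
  then obtain y' p where y': "y' |\<in>| elems x" "p permutes (Y - supp X x)" "T y = map_obj p (T y')"
    by (rule elems_spreadE)
  have y'S: "y' \<in> S" using symm_elems[OF assms(1) y'(1)] .
  have p: "p permutes Y" using y'(2) permutes_subset by blast
  have into: "p ` supp Y (T y') \<subseteq> X"
    using supp_spread[OF assms(2)] supp_map_obj[OF p, of "T y'"] y'(3) by simp
  have "supp Y (T y') \<subseteq> X" using supp_spread[OF y'S] by simp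
  then obtain q where q: "q permutes (X - supp X x)" "map_obj q (T y') = map_obj p (T y')"
    using realign[OF supp_subset y'(2) _ into] by blast
  have q_X: "q permutes X" using q(1) permutes_subset by blast
  have "T y = T (map_obj q y')" using q(2) y'(3) by (simp add: spread_map_obj[OF q_X])
  then have "y = map_obj q y'" using spread_inj[OF assms(2) symm_map_obj[OF q_X y'S]] by simp
  then show "y |\<in>| elems x"
    using map_obj_fixed_elem[OF supp_fixes[OF finite_X q(1)] y'(1)] by simp
qed (rule elems_spreadI)

lemma spread_eq_iff: "x \<in> S \<Longrightarrow> y \<in> S \<Longrightarrow> T x = T y \<longleftrightarrow> x = y"
  using spread_inj by blast

text \<open>The object \<open>z\<close> is supported by at most \<open>k\<close> atoms of
  \<open>Y\<close>. Since \<open>X - Z\<close> has room for \<open>k\<close> atoms, a permutation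
  fixing \<open>Z\<close> moves this support into \<open>X\<close>, where \<open>realign\<close>
  shows the moved object to be embedded. The permutation also fixes \<open>T x\<close>, so the
  result is still an element of \<open>T x\<close>.\<close>

lemma elems_spread_move:
  assumes x: "x \<in> S" and z: "z |\<in>| elems (T x)" and Z: "supp X x \<subseteq> Z" "Z \<subseteq> X"
    "card Z + k \<le> card X"
  obtains p y where "p permutes (Y - Z)" "y |\<in>| elems x" "map_obj p z = T y"
proof -
  obtain y q where y: "y |\<in>| elems x" "q permutes (Y - supp X x)" "z = map_obj q (T y)"
    using z by (rule elems_spreadE)
  have yS: "y \<in> S" using symm_elems[OF x y(1)] .
  have q_Y: "q permutes Y" using y(2) permutes_subset by blast
  define B where "B = q ` supp X y"
  have B_Y: "B \<subseteq> Y"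
    using permutes_image[OF q_Y] supp_subset[of X y] X_Y unfolding B_def by blast
  have "card (B - Z) \<le> card B" using B_Y finite_Y by (meson Diff_subset card_mono finite_subset)
  also have "\<dots> \<le> card (supp X y)"
    unfolding B_def using finite_subset[OF supp_subset finite_X] by (rule card_image_le)
  also have "\<dots> \<le> card (X - Z)"
    using card_supp[OF yS] Z finite_X by (simp add: card_Diff_subset finite_subset)
  finally obtain f where f: "f ` (B - Z) \<subseteq> X - Z" "inj_on f (B - Z)"
    using card_le_inj[of "B - Z" "X - Z"] finite_subset[OF B_Y finite_Y] finite_X by blast
  have "B - Z \<subseteq> Y - Z" "f ` (B - Z) \<subseteq> Y - Z" using f(1) B_Y X_Y by blast+
  then obtain p where p: "p permutes (Y - Z)" "\<And>b. b \<in> B - Z \<Longrightarrow> p b = f b"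
    using permutes_extension[OF finite_Diff[OF finite_Y] _ f(2)] by blast
  have p_Y: "p permutes Y" using p(1) permutes_subset by blast
  have "p b \<in> X" if "b \<in> B" for b
  proof (cases "b \<in> Z")
    case True
    then show ?thesis using p(1) Z(2) by (auto simp: permutes_def)
  next
    case False
    then show ?thesis using p(2)[of b] f(1) that by auto
  qed
  then have into: "(p \<circ> q) ` supp Y (T y) \<subseteq> X" using supp_spread[OF yS] by (auto simp: B_def)
  \<comment> \<open>The composite is realigned with no atom required to stay fixed; that the
    resulting object belongs to \<open>x\<close> is recovered from
    \<open>spread_elem_iff\<close>.\<close>
  have pq: "p \<circ> q permutes Y - {}" using p_Y q_Y by (simp add: permutes_compose)
  have "supp Y (T y) \<subseteq> X" using supp_spread[OF yS] by simp
  then obtain r where r: "r permutes (X - {})" "map_obj r (T y) = map_obj (p \<circ> q) (T y)"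
    using realign[OF empty_subsetI pq _ into] by blast
  have r_X: "r permutes X" using r(1) by simp
  have eq: "map_obj p z = T (map_obj r y)"
    using r(2) y(3) by (simp only: spread_map_obj[OF r_X] map_obj_o)
  have "p permutes (Y - supp X x)" using p(1) Z(1) permutes_subset[of p "Y - Z" "Y - supp X x"] by blast
  then have "map_obj p (T x) = T x" using supp_fixes_spread symm_HF[OF x] by blast
  then have "map_obj p z |\<in>| elems (T x)" using z by (rule map_obj_fixed_elem)
  then have "map_obj r y |\<in>| elems x"
    using spread_elem_iff[OF x symm_map_obj[OF r_X yS]] eq by simp
  then show thesis using that[OF p(1) _ eq] by blast
qed

text \<open>Both \<open>y\<close> and \<open>T x\<close> are invariant under the permutations of
  \<open>Y\<close> that fix \<open>Z\<close>, and such permutations carry each element of either to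
  an embedded one. The two sets therefore agree once they agree on embedded elements.\<close>

lemma spread_eqI:
  assumes x: "x \<in> S" and Z: "supp X x \<subseteq> Z" "Z \<subseteq> X" "card Z + k \<le> card X"
    and sets: "x = HSet s" "y = HSet t"
    and y_fixed: "\<And>p. p permutes (Y - Z) \<Longrightarrow> map_obj p y = y"
    and sub: "\<And>x'. x' |\<in>| s \<Longrightarrow> T x' |\<in>| t"
    and move: "\<And>y'. y' |\<in>| t \<Longrightarrow> \<exists>p x'. p permutes (Y - Z) \<and> x' |\<in>| s \<and> map_obj p y' = T x'"
  shows "y = T x"
proof -
  have pull: "z |\<in>| elems w" if p: "p permutes (Y - Z)" and w: "map_obj p w = w" "map_obj p z |\<in>| elems w" for p z w
    using w map_obj_elem_iff[OF permutes_bij[OF p], of z w] by simp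
  have "z |\<in>| elems (T x)" if z: "z |\<in>| elems y" for z
  proof -
    obtain p x' where p: "p permutes (Y - Z)" and x': "x' |\<in>| s" "map_obj p z = T x'"
      using move[of z] z unfolding sets elems.simps by blast
    have "p permutes (Y - supp X x)" using p Z(1) permutes_subset[of p "Y - Z" "Y - supp X x"] by blast
    then have fixed: "map_obj p (T x) = T x" using supp_fixes_spread symm_HF[OF x] by blast
    have "x' |\<in>| elems x" using x'(1) unfolding sets elems.simps .
    from elems_spreadI[OF this] have "map_obj p z |\<in>| elems (T x)" unfolding x'(2) .
    then show ?thesis by (rule pull[OF p fixed])
  qed
  moreover have "z |\<in>| elems y" if z: "z |\<in>| elems (T x)" for z
  proof -
    obtain p x' where p: "p permutes (Y - Z)" "x' |\<in>| elems x" "map_obj p z = T x'"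
      by (rule elems_spread_move[OF x z Z])
    have "x' |\<in>| s" using p(2) unfolding sets elems.simps .
    from sub[OF this] have "map_obj p z |\<in>| elems y" unfolding p(3) sets elems.simps .
    then show ?thesis by (rule pull[OF p(1) y_fixed[OF p(1)]])
  qed
  ultimately have "elems y = elems (T x)" by (intro fset_eqI iffI)
  then show ?thesis using sets spread_HSet[of X Y s] by auto
qed

end

section \<open>Invariance of computations under permutations\<close>

definition env_maps :: "('a obj \<Rightarrow> 'a obj) \<Rightarrow> nat set \<Rightarrow> 'a assignment \<Rightarrow> 'a assignment \<Rightarrow> bool" where
  "env_maps h V e e' \<longleftrightarrow> (\<forall>v\<in>V. \<exists>x. e v = Some x \<and> e' v = Some (h x))"

lemma env_maps_mono: "env_maps h V e e' \<Longrightarrow> W \<subseteq> V \<Longrightarrow> env_maps h W e e'"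
  by (auto simp: env_maps_def)

lemma env_maps_upd: "env_maps h (V - {v}) e e' \<Longrightarrow> env_maps h V (e(v \<mapsto> a)) (e'(v \<mapsto> h a))"
  by (auto simp: env_maps_def)

text \<open>Naked inputs have no relations to preserve, so the universe and the dynamic functions
  are all that is compared.\<close>

definition state_iso :: "('a \<Rightarrow> 'a) \<Rightarrow> 'a state \<Rightarrow> 'a state \<Rightarrow> bool" where
  "state_iso p A A' \<longleftrightarrow>
     input A \<in> naked_sets \<and> input A' \<in> naked_sets \<and>
     universe (input A') = p |`| universe (input A) \<and>
     (\<forall>f xs. dyn A' f (map (map_obj p) xs) = map_obj p (dyn A f xs))"

lemma naked_sets_holds: "I \<in> naked_sets \<Longrightarrow> \<not> holds I P as"
  by (simp add: naked_sets_def structures_def)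

lemma map_obj_eq_zero_iff [simp]: "map_obj p x = zero_obj \<longleftrightarrow> x = zero_obj"
  by (cases x) (auto simp: zero_obj_def)

lemma map_obj_eq_one_iff [simp]: "map_obj p x = one_obj \<longleftrightarrow> x = one_obj"
proof
  assume eq: "map_obj p x = one_obj"
  then obtain s where s: "x = HSet s" by (cases x) (auto simp: one_obj_def)
  with eq have *: "map_obj p |`| s = {|zero_obj|}" by (simp add: one_obj_def)
  have zero: "y = zero_obj" if "y |\<in>| s" for y
  proof -
    have "map_obj p y |\<in>| map_obj p |`| s" using that by simp
    then show ?thesis unfolding * by simp
  qed
  moreover have "s \<noteq> {||}" using * by auto
  ultimately have "s = {|zero_obj|}" by auto
  then show "x = one_obj" using s by (simp add: one_obj_def)
qed simp

lemma map_obj_truth_value [simp]: "map_obj p (truth_value b) = truth_value b"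
  by (simp add: truth_value_def)

lemma map_obj_connective [simp]: "map_obj p (connective c x y) = connective c x y"
  by (simp add: connective_def)

lemma connective_map_obj [simp]: "connective c (map_obj p x) (map_obj p y) = connective c x y"
  by (simp add: connective_def is_boolean_def)

lemma in_val_Compr:
  "z |\<in>| elems (val A e (Compr t v r g)) \<longleftrightarrow>
    (\<exists>a. a |\<in>| elems (val A e r) \<and> val A (e(v \<mapsto> a)) g = one_obj \<and> z = val A (e(v \<mapsto> a)) t)"
  by auto

text \<open>Groups the names by the shape of the argument list. Over the empty input vocabulary the
  case of \<open>InputN\<close> is vacuous.\<close>

lemma signature_cases:
  assumes "signature V D f = Some (length xs, b)"
  shows "(f \<in> {EqN, AndN, OrN, ImpN, IffN, MemN, PairN} \<and> (\<exists>x y. xs = [x, y])) \<or>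
    (f \<in> {NotN, UnionN, TheUniqueN} \<and> (\<exists>x. xs = [x])) \<or>
    (f \<in> {TrueN, FalseN, EmptyN, AtomsN} \<and> xs = []) \<or>
    (\<exists>P. f = InputN P \<and> P \<in> fmdom' V) \<or>
    (\<exists>g. f = DynN g \<and> fmlookup D g = Some (length xs, b))"
  using assms
  by (cases f; auto simp: length_Suc_conv eval_nat_numeral eq_commute[of _ "length xs"] fmlookup_dom'_iff)

lemma interp_iso:
  assumes p: "bij p" and iso: "state_iso p A A'" and sig: "signature fmempty D f = Some (length xs, b)"
  shows "interp A' f (map (map_obj p) xs) = map_obj p (interp A f xs)"
  using signature_cases[OF sig]
proof (elim disjE conjE exE)
  fix x y assume f: "f \<in> {EqN, AndN, OrN, ImpN, IffN, MemN, PairN}" and xs: "xs = [x, y]"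
  then show ?thesis using map_obj_inject[OF p] map_obj_elem_iff[OF p] by auto
next
  fix x assume f: "f \<in> {NotN, UnionN, TheUniqueN}" and xs: "xs = [x]"
  have union: "HSet (ffUnion (elems |`| elems (map_obj p x))) = map_obj p (HSet (ffUnion (elems |`| elems x)))"
    by (auto simp: fset_eq_iff ffUnion.rep_eq)
  have unique: "(if \<exists>!y. y |\<in>| elems (map_obj p x) then THE y. y |\<in>| elems (map_obj p x) else zero_obj) =
    map_obj p (if \<exists>!y. y |\<in>| elems x then THE y. y |\<in>| elems x else zero_obj)"
  proof (cases "\<exists>!y. y |\<in>| elems x")
    case True
    then obtain y where y: "y |\<in>| elems x" "\<And>z. z |\<in>| elems x \<Longrightarrow> z = y" by blast
    have "elems x = {|y|}"
    proof (intro fset_eqI iffI)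
      fix z assume "z |\<in>| elems x"
      then show "z |\<in>| {|y|}" using y(2)[of z] by simp
    qed (simp add: y(1))
    then show ?thesis by simp
  next
    case False
    have "\<not> (\<exists>!y. y |\<in>| elems (map_obj p x))"
    proof
      assume "\<exists>!y. y |\<in>| elems (map_obj p x)"
      then obtain z where z: "z |\<in>| elems (map_obj p x)" "\<And>w. w |\<in>| elems (map_obj p x) \<Longrightarrow> w = z" by blast
      from z(1) obtain y where y: "y |\<in>| elems x" "z = map_obj p y" by auto
      have "w = y" if "w |\<in>| elems x" for w
        using z(2)[of "map_obj p w"] that y(2) by (simp add: map_obj_inject[OF p])
      then show False using False y(1) by blast
    qed
    then show ?thesis using False by (simp only: if_False map_obj_zero)
  qed
  from f consider "f = NotN" | "f = UnionN" | "f = TheUniqueN" by blast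
  then show ?thesis
  proof cases
    case 1
    then show ?thesis using xs by (simp add: is_boolean_def)
  next
    case 2
    then show ?thesis using union by (simp only: xs interp.simps list.map nth_Cons_0)
  next
    case 3
    then show ?thesis using unique by (simp only: xs interp.simps list.map nth_Cons_0)
  qed
next
  assume "f \<in> {TrueN, FalseN, EmptyN, AtomsN}" "xs = []"
  then show ?thesis using iso by (auto simp: state_iso_def fset.map_comp comp_def)
next
  fix g assume "f = DynN g"
  then show ?thesis using iso by (simp add: state_iso_def)
qed simp

lemma val_iso:
  assumes p: "bij p" and iso: "state_iso p A A'"
  shows "wf_trm fmempty D t \<Longrightarrow> env_maps (map_obj p) (free_vars t) e e' \<Longrightarrow>
    val A' e' t = map_obj p (val A e t)"
proof (induction t arbitrary: e e')
  case (Var v)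
  then show ?case by (auto simp: env_maps_def)
next
  case (App f ts)
  have IH: "val A' e' t = map_obj p (val A e t)" if "t \<in> set ts" for t
    using App.prems that by (intro App.IH) (auto elim: env_maps_mono)
  then have *: "map (val A' e') ts = map (map_obj p) (map (val A e) ts)" by simp
  obtain b where "signature fmempty D f = Some (length (map (val A e) ts), b)"
    using App.prems(1) by auto
  then show ?case using interp_iso[OF p iso] unfolding val.simps * by blast
next
  case (Compr t v r g)
  have r: "val A' e' r = map_obj p (val A e r)"
    using Compr.prems by (intro Compr.IH) (auto elim: env_maps_mono)
  have env: "env_maps (map_obj p) (free_vars t \<union> free_vars g) (e(v \<mapsto> a)) (e'(v \<mapsto> map_obj p a))" for a
    using Compr.prems(2) by (intro env_maps_upd) (auto elim: env_maps_mono)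
  have t: "val A' (e'(v \<mapsto> map_obj p a)) t = map_obj p (val A (e(v \<mapsto> a)) t)" for a
    by (rule Compr.IH(1)[OF _ env_maps_mono[OF env]]) (use Compr.prems(1) in auto)
  have g: "val A' (e'(v \<mapsto> map_obj p a)) g = map_obj p (val A (e(v \<mapsto> a)) g)" for a
    by (rule Compr.IH(3)[OF _ env_maps_mono[OF env]]) (use Compr.prems(1) in auto)
  have "map_obj p (val A (e(v \<mapsto> a)) t) |\<in>| elems (val A' e' (Compr t v r g))"
    if "a |\<in>| elems (val A e r)" "val A (e(v \<mapsto> a)) g = one_obj" for a
    using that t[of a] g[of a] unfolding in_val_Compr r by (intro exI[of _ "map_obj p a"]) simp
  then show ?case by (auto simp: fset_eq_iff r t g)
qed

definition map_update :: "('a obj \<Rightarrow> 'a obj) \<Rightarrow> dyn_name \<times> 'a obj list \<times> 'a obj \<Rightarrow> dyn_name \<times> 'a obj list \<times> 'a obj" where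
  "map_update h u = (case u of (f, xs, b) \<Rightarrow> (f, map h xs, h b))"

lemma map_update_simp [simp]: "map_update h (f, xs, b) = (f, map h xs, h b)"
  by (simp add: map_update_def)

lemma Den_iso:
  assumes p: "bij p" and iso: "state_iso p A A'"
  shows "wf_rule fmempty D R \<Longrightarrow> env_maps (map_obj p) (free_vars_rule R) e e' \<Longrightarrow>
    Den A' e' R = map_update (map_obj p) ` Den A e R"
proof (induction R arbitrary: e e')
  case (Update f ts t)
  have "val A' e' s = map_obj p (val A e s)" if "s \<in> set ts" for s
    using Update.prems that by (intro val_iso[OF p iso, where D = D]) (auto elim: env_maps_mono)
  moreover have "val A' e' t = map_obj p (val A e t)"
    using Update.prems by (intro val_iso[OF p iso, where D = D]) (auto elim: env_maps_mono)
  ultimately show ?case by simp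
next
  case (Cond g R1 R2)
  have "val A' e' g = map_obj p (val A e g)"
    using Cond.prems by (intro val_iso[OF p iso, where D = D]) (auto elim: env_maps_mono)
  moreover have "Den A' e' R1 = map_update (map_obj p) ` Den A e R1"
    using Cond.prems by (intro Cond.IH) (auto elim: env_maps_mono)
  moreover have "Den A' e' R2 = map_update (map_obj p) ` Den A e R2"
    using Cond.prems by (intro Cond.IH) (auto elim: env_maps_mono)
  ultimately show ?case by simp
next
  case (Forall v r R)
  have r: "val A' e' r = map_obj p (val A e r)"
    using Forall.prems by (intro val_iso[OF p iso, where D = D]) (auto elim: env_maps_mono)
  have "Den A' (e'(v \<mapsto> map_obj p a)) R = map_update (map_obj p) ` Den A (e(v \<mapsto> a)) R" for a
    using Forall.prems by (intro Forall.IH env_maps_upd) (auto elim: env_maps_mono)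
  then show ?case by (simp add: r image_UN)
qed simp

lemma clash_map_update:
  assumes "inj h"
  shows "clash (map_update h ` U) \<longleftrightarrow> clash U"
proof
  assume "clash (map_update h ` U)"
  then obtain f xs b c where "(f, xs, b) \<in> map_update h ` U" "(f, xs, c) \<in> map_update h ` U" "b \<noteq> c"
    unfolding clash_def by blast
  then obtain ys zs b' c' where "(f, ys, b') \<in> U" "(f, zs, c') \<in> U" "map h ys = map h zs" "b' \<noteq> c'"
    by (clarsimp simp: map_update_def) metis
  moreover from this have "ys = zs" using assms by (simp add: inj_map_eq_map)
  ultimately show "clash U" unfolding clash_def by blast
next
  assume "clash U"
  then obtain f xs b c where "(f, xs, b) \<in> U" "(f, xs, c) \<in> U" "b \<noteq> c"
    unfolding clash_def by blast
  then have "(f, map h xs, h b) \<in> map_update h ` U" "(f, map h xs, h c) \<in> map_update h ` U" "h b \<noteq> h c"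
    using assms by (force simp: inj_eq)+
  then show "clash (map_update h ` U)" unfolding clash_def by blast
qed

lemma input_sequel [simp]: "input (sequel R A) = input A"
  by (simp add: sequel_def Let_def)

lemma sequel_clash: "clash (Den A Map.empty R) \<Longrightarrow> sequel R A = A"
  by (simp add: sequel_def)

lemma dyn_sequel_update:
  assumes "\<not> clash (Den A Map.empty R)" "(f, xs, b) \<in> Den A Map.empty R"
  shows "dyn (sequel R A) f xs = b"
proof -
  have "(THE b. (f, xs, b) \<in> Den A Map.empty R) = b"
    using assms unfolding clash_def by blast
  moreover have "\<exists>b. (f, xs, b) \<in> Den A Map.empty R" using assms(2) by blast
  ultimately show ?thesis using assms(1) by (simp add: sequel_def Let_def)
qed

lemma dyn_sequel_other:
  assumes "\<And>b. (f, xs, b) \<notin> Den A Map.empty R"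
  shows "dyn (sequel R A) f xs = dyn A f xs"
  using assms by (simp add: sequel_def Let_def)

lemma sequel_iso:
  assumes p: "bij p" and iso: "state_iso p A A'" and R: "is_program fmempty D R"
  shows "state_iso p (sequel R A) (sequel R A')"
proof -
  have inj: "inj (map_obj p)" using p by (simp add: bij_is_inj obj.inj_map)
  have Den: "Den A' Map.empty R = map_update (map_obj p) ` Den A Map.empty R"
    using R by (intro Den_iso[OF p iso, where D = D]) (auto simp: is_program_def env_maps_def)
  show ?thesis
  proof (cases "clash (Den A Map.empty R)")
    case True
    then show ?thesis
      using iso Den clash_map_update[OF inj] by (simp add: sequel_clash)
  next
    case False
    then have False': "\<not> clash (Den A' Map.empty R)"
      using Den clash_map_update[OF inj] by simp
    have "dyn (sequel R A') f (map (map_obj p) xs) = map_obj p (dyn (sequel R A) f xs)" for f xs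
    proof (cases "\<exists>b. (f, xs, b) \<in> Den A Map.empty R")
      case True
      then obtain b where b: "(f, xs, b) \<in> Den A Map.empty R" by blast
      then have "(f, map (map_obj p) xs, map_obj p b) \<in> Den A' Map.empty R" unfolding Den by force
      then show ?thesis using dyn_sequel_update[OF False b] dyn_sequel_update[OF False'] by simp
    next
      case no: False
      then have "(f, map (map_obj p) xs, b) \<notin> Den A' Map.empty R" for b
        unfolding Den using inj_map_eq_map[OF inj] by (auto simp: map_update_def split: prod.splits)
      then show ?thesis using no iso by (simp add: dyn_sequel_other state_iso_def)
    qed
    then show ?thesis using iso by (simp add: state_iso_def)
  qed
qed

lemma halted_iso: "state_iso p A A' \<Longrightarrow> halted A' \<longleftrightarrow> halted A"
  unfolding state_iso_def halted_def by (metis list.map_disc_iff map_obj_eq_one_iff)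

lemma output_true_iso: "state_iso p A A' \<Longrightarrow> output_true A' \<longleftrightarrow> output_true A"
  unfolding state_iso_def output_true_def by (metis list.map_disc_iff map_obj_eq_one_iff)

lemma run_iso:
  assumes p: "bij p" and R: "is_program fmempty D R"
    and I: "I \<in> naked_sets" "I' \<in> naked_sets" "universe I' = p |`| universe I"
  shows "rel_option (state_iso p) (run R I i) (run R I' i)"
proof (induction i)
  case 0
  show ?case using I by (simp add: initial_state_def state_iso_def)
next
  case (Suc i)
  then show ?case
    by (cases "run R I i"; cases "run R I' i") (auto simp: halted_iso intro: sequel_iso[OF p _ R])
qed

lemma run_input: "run R I i = Some A \<Longrightarrow> input A = I"
  by (induction i arbitrary: A) (auto simp: initial_state_def split: option.splits if_splits)

text \<open>Every permutation of the universe is an automorphism of a naked input, so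
  \<open>run_iso\<close> applies with both inputs equal.\<close>

lemma run_automorphism:
  assumes R: "is_program fmempty D R" and I: "I \<in> naked_sets" and run: "run R I i = Some A"
    and p: "p permutes fset (universe I)"
  shows "state_iso p A A"
proof -
  have "universe I = p |`| universe I"
    using permutes_image[OF p] by (simp add: fset_inject[symmetric])
  then show ?thesis
    using run_iso[OF permutes_bij[OF p] R I I, of i] run by simp
qed

section \<open>Polynomially many values occur in a computation step\<close>

text \<open>Intermediate values need not be active, so they are collected here. The body of a
  comprehension is included at every element of the range, even where the guard fails.\<close>

fun values_in_trm :: "'a state \<Rightarrow> 'a obj set \<Rightarrow> 'a assignment \<Rightarrow> trm \<Rightarrow> bool" where
  "values_in_trm A C e (Var v) = (\<exists>x\<in>C. e v = Some x)"
| "values_in_trm A C e (App f ts) =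
     ((\<forall>t\<in>set ts. values_in_trm A C e t) \<and> val A e (App f ts) \<in> C)"
| "values_in_trm A C e (Compr t v r g) =
     (values_in_trm A C e r \<and>
      (\<forall>a\<in>fset (elems (val A e r)).
         values_in_trm A C (e(v \<mapsto> a)) t \<and> values_in_trm A C (e(v \<mapsto> a)) g) \<and>
      val A e (Compr t v r g) \<in> C)"

primrec values_in_rule :: "'a state \<Rightarrow> 'a obj set \<Rightarrow> 'a assignment \<Rightarrow> rule \<Rightarrow> bool" where
  "values_in_rule A C e Skip = True"
| "values_in_rule A C e (Update f ts t) =
     ((\<forall>s\<in>set ts. values_in_trm A C e s) \<and> values_in_trm A C e t)"
| "values_in_rule A C e (Cond g R1 R2) =
     (values_in_trm A C e g \<and> values_in_rule A C e R1 \<and> values_in_rule A C e R2)"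
| "values_in_rule A C e (Forall v r R) =
     (values_in_trm A C e r \<and> (\<forall>a\<in>fset (elems (val A e r)). values_in_rule A C (e(v \<mapsto> a)) R))"

lemma values_in_trm_mono: "values_in_trm A C e t \<Longrightarrow> C \<subseteq> C' \<Longrightarrow> values_in_trm A C' e t"
  by (induction A C e t rule: values_in_trm.induct) (simp_all del: val.simps, blast+)

lemma values_in_rule_mono: "values_in_rule A C e R \<Longrightarrow> C \<subseteq> C' \<Longrightarrow> values_in_rule A C' e R"
  by (induction R arbitrary: e) (auto intro: values_in_trm_mono)

lemma values_in_trm_val: "values_in_trm A C e t \<Longrightarrow> val A e t \<in> C"
  by (cases t) auto

definition env_in :: "'a obj set \<Rightarrow> nat set \<Rightarrow> 'a assignment \<Rightarrow> bool" where
  "env_in B V e \<longleftrightarrow> (\<forall>v\<in>V. \<exists>x\<in>B. e v = Some x)"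

lemma env_in_mono: "env_in B V e \<Longrightarrow> B \<subseteq> B' \<Longrightarrow> W \<subseteq> V \<Longrightarrow> env_in B' W e"
  by (fastforce simp: env_in_def)

lemma env_in_upd: "env_in B (V - {v}) e \<Longrightarrow> a \<in> B \<Longrightarrow> env_in B V (e(v \<mapsto> a))"
  by (auto simp: env_in_def)

lemma finite_free_vars: "finite (free_vars t)"
  by (induction t) auto

definition symmetric_state :: "dyn_voc \<Rightarrow> 'a state \<Rightarrow> bool" where
  "symmetric_state D A \<longleftrightarrow> is_state fmempty D A \<and>
     (\<forall>p. p permutes fset (universe (input A)) \<longrightarrow> state_iso p A A)"

text \<open>Finiteness, transitivity, invariance and containment in \<open>base_set A\<close> are
  what \<open>small_invariant_set_symm\<close> asks of a family. The other clauses ensure that a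
  basic function applied to members yields an object all of whose elements are members.\<close>

definition ample :: "'a state \<Rightarrow> 'a obj set \<Rightarrow> bool" where
  "ample A C \<longleftrightarrow> finite C \<and> C \<subseteq> base_set A \<and> transitive_set C \<and>
     (\<forall>p x. p permutes fset (universe (input A)) \<longrightarrow> x \<in> C \<longrightarrow> map_obj p x \<in> C) \<and>
     Atom ` fset (universe (input A)) \<subseteq> C \<and> zero_obj \<in> C \<and> one_obj \<in> C \<and>
     (\<forall>f xs. dyn A f xs \<in> C)"

text \<open>A base of at least two lets a sum of two powers be absorbed by one larger
  exponent.\<close>

lemma ample_card: "ample A C \<Longrightarrow> 2 \<le> card C"
proof -
  assume C: "ample A C"
  have "zero_obj \<noteq> (one_obj :: 'a obj)" by (auto simp: zero_obj_def one_obj_def)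
  then have "card {zero_obj, one_obj :: 'a obj} = 2" by simp
  moreover have "{zero_obj, one_obj} \<subseteq> C" "finite C" using C by (auto simp: ample_def)
  ultimately show ?thesis by (metis card_mono)
qed

lemma ample_elems: "ample A C \<Longrightarrow> x \<in> C \<Longrightarrow> y |\<in>| elems x \<Longrightarrow> y \<in> C"
  unfolding ample_def transitive_set_def by blast

lemma interp_elems_in:
  assumes C: "ample A C" and xs: "set xs \<subseteq> C" and sig: "signature fmempty D f = Some (length xs, b)"
    and y: "y |\<in>| elems (interp A f xs)"
  shows "y \<in> C"
proof -
  have truth: "truth_value c \<in> C" for c using C by (auto simp: ample_def truth_value_def)
  have elems: "y \<in> C" if "x \<in> C" "y |\<in>| elems x" for x y using ample_elems[OF C that] .
  show ?thesis
    using signature_cases[OF sig]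
  proof (elim disjE conjE exE)
    fix x z assume f: "f \<in> {EqN, AndN, OrN, ImpN, IffN, MemN, PairN}" and "xs = [x, z]"
    then show ?thesis
      using y xs elems[OF truth] by (auto simp: connective_def)
  next
    fix x assume f: "f \<in> {NotN, UnionN, TheUniqueN}" and x: "xs = [x]"
    then have "x \<in> C" using xs by simp
    from f consider "f = NotN" | "f = UnionN" | "f = TheUniqueN" by blast
    then show ?thesis
    proof cases
      case 1
      then show ?thesis using elems[OF truth] y by simp
    next
      case 2
      then obtain z where "z |\<in>| elems x" "y |\<in>| elems z" using y x by (auto simp: ffUnion.rep_eq)
      then show ?thesis using elems \<open>x \<in> C\<close> by blast
    next
      case 3
      show ?thesis
      proof (cases "\<exists>!z. z |\<in>| elems x")
        case True
        then have "y |\<in>| elems (THE z. z |\<in>| elems x)" using 3 x y by simp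
        then show ?thesis using theI'[OF True] elems \<open>x \<in> C\<close> by blast
      next
        case False
        then show ?thesis using 3 x y by (simp add: zero_obj_def)
      qed
    qed
  next
    assume "f \<in> {TrueN, FalseN, EmptyN, AtomsN}" "xs = []"
    then show ?thesis using y C elems by (auto simp: ample_def)
  next
    fix g assume "f = DynN g"
    moreover have "dyn A g xs \<in> C" using C by (simp add: ample_def)
    ultimately show ?thesis using y elems by simp
  qed simp
qed

lemma state_iso_id: "input A \<in> naked_sets \<Longrightarrow> state_iso id A A"
  by (simp add: state_iso_def obj.map_id0)

text \<open>Invariance under the identity permutation, read with two assignments.\<close>

lemma val_cong:
  assumes A: "input A \<in> naked_sets" and t: "wf_trm fmempty D t"
    and e: "\<And>v. v \<in> free_vars t \<Longrightarrow> e v \<noteq> None \<and> e' v = e v"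
  shows "val A e' t = val A e t"
proof -
  have "env_maps (map_obj id) (free_vars t) e e'"
    unfolding env_maps_def obj.map_id0 using e by fastforce
  then show ?thesis
    using val_iso[OF bij_id state_iso_id[OF A] t] by (simp add: obj.map_id0 del: id_apply) (simp add: obj.map_id)
qed

lemma symmetric_state_naked: "symmetric_state D A \<Longrightarrow> input A \<in> naked_sets"
  by (simp add: symmetric_state_def is_state_def naked_sets_def)

lemma symmetric_state_iso:
  "symmetric_state D A \<Longrightarrow> p permutes fset (universe (input A)) \<Longrightarrow> state_iso p A A"
  by (simp add: symmetric_state_def)

text \<open>The value of \<open>t\<close> depends only on the assignment to its free variables,
  which gives the count. Permuting the assignment permutes the value because the state is symmetric,
  and the new values bring in no elements outside \<open>C\<close>.\<close>

lemma ample_values: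
  assumes A: "symmetric_state D A" and B: "ample A B" and C: "ample A C" and t: "wf_trm fmempty D t"
    and elems: "\<And>e y. env_in B (free_vars t) e \<Longrightarrow> y |\<in>| elems (val A e t) \<Longrightarrow> y \<in> C"
  defines "W \<equiv> (\<lambda>e. val A e t) ` {e. env_in B (free_vars t) e}"
  shows "ample A (C \<union> W) \<and> card W \<le> card B ^ card (free_vars t)"
proof -
  have naked: "input A \<in> naked_sets" using A by (rule symmetric_state_naked)
  let ?F = "Pi\<^sub>E (free_vars t) (\<lambda>_. B)"
  have fin: "finite ?F" using B finite_free_vars by (intro finite_PiE) (auto simp: ample_def)
  have sub: "W \<subseteq> (\<lambda>h. val A (\<lambda>v. Some (h v)) t) ` ?F"
  proof
    fix x assume "x \<in> W"
    then obtain e where e: "env_in B (free_vars t) e" "x = val A e t" unfolding W_def by blast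
    let ?h = "restrict (\<lambda>v. the (e v)) (free_vars t)"
    have "x = val A (\<lambda>v. Some (?h v)) t"
      unfolding e(2) using e(1) by (intro val_cong[OF naked t]) (force simp: env_in_def)
    moreover have "?h \<in> ?F" using e(1) by (fastforce simp: env_in_def)
    ultimately show "x \<in> (\<lambda>h. val A (\<lambda>v. Some (h v)) t) ` ?F" by blast
  qed
  have "card W \<le> card ?F" using sub fin by (meson card_image_le card_mono finite_imageI le_trans)
  also have "\<dots> = card B ^ card (free_vars t)" by (simp add: card_PiE finite_free_vars)
  finally have card: "card W \<le> card B ^ card (free_vars t)" .
  have "finite W" using sub fin finite_subset by blast
  moreover have "W \<subseteq> base_set A"
    unfolding W_def using B A t
    by (auto simp: env_in_def ample_def symmetric_state_def intro!: val_in_base_set[where D = D and V = fmempty])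
       (meson subsetD)
  moreover have "transitive_set (C \<union> W)"
    unfolding transitive_set_def W_def using elems ample_elems[OF C] by blast
  moreover have "map_obj p x \<in> C \<union> W" if p: "p permutes fset (universe (input A))" and x: "x \<in> C \<union> W" for p x
  proof (cases "x \<in> C")
    case True
    then show ?thesis using C p by (auto simp: ample_def)
  next
    case False
    then obtain e where e: "env_in B (free_vars t) e" "x = val A e t" using x unfolding W_def by blast
    let ?e = "\<lambda>v. map_option (map_obj p) (e v)"
    have "env_maps (map_obj p) (free_vars t) e ?e" using e(1) by (fastforce simp: env_maps_def env_in_def)
    then have "map_obj p x = val A ?e t"
      unfolding e(2) by (rule val_iso[OF permutes_bij[OF p] symmetric_state_iso[OF A p] t, symmetric])
    moreover have "env_in B (free_vars t) ?e" using e(1) B p by (fastforce simp: ample_def env_in_def)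
    ultimately show ?thesis unfolding W_def by blast
  qed
  ultimately show ?thesis using C card by (auto simp: ample_def)
qed

text \<open>In the uses below, \<open>P A B C\<close> says that evaluations in \<open>A\<close> whose variables range over \<open>B\<close> stay
  within \<open>C\<close>.\<close>

definition poly_closed :: "dyn_voc \<Rightarrow> ('a state \<Rightarrow> 'a obj set \<Rightarrow> 'a obj set \<Rightarrow> bool) \<Rightarrow> bool" where
  "poly_closed D P \<longleftrightarrow> (\<exists>d. \<forall>A B. symmetric_state D A \<longrightarrow> ample A B \<longrightarrow>
     (\<exists>C. ample A C \<and> B \<subseteq> C \<and> card C \<le> card B ^ d \<and> P A B C))"

lemma poly_closed_weaken:
  assumes "poly_closed D P"
    and "\<And>A B C. symmetric_state D A \<Longrightarrow> ample A B \<Longrightarrow> ample A C \<Longrightarrow> B \<subseteq> C \<Longrightarrow> P A B C \<Longrightarrow> Q A B C"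
  shows "poly_closed D Q"
  using assms unfolding poly_closed_def by meson

lemma poly_closed_trivial: "(\<And>A B. ample A B \<Longrightarrow> P A B B) \<Longrightarrow> poly_closed D P"
  unfolding poly_closed_def by (intro exI[of _ 1]) auto

text \<open>The second closure starts from the result \<open>C1\<close> of the first, so the
  exponents multiply. With \<open>C1\<close> closed for a range term, bound variables range over
  members of \<open>C1\<close>.\<close>

lemma poly_closed_chain:
  assumes "poly_closed D P" "poly_closed D Q"
  shows "poly_closed D (\<lambda>A B C. \<exists>C1. ample A C1 \<and> B \<subseteq> C1 \<and> C1 \<subseteq> C \<and> P A B C1 \<and> Q A C1 C)"
proof -
  obtain d1 where d1: "\<And>A B. symmetric_state D A \<Longrightarrow> ample A B \<Longrightarrow>
     \<exists>C. ample A C \<and> B \<subseteq> C \<and> card C \<le> card B ^ d1 \<and> P A B C"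
    using assms(1) unfolding poly_closed_def by blast
  obtain d2 where d2: "\<And>A B. symmetric_state D A \<Longrightarrow> ample A B \<Longrightarrow>
     \<exists>C. ample A C \<and> B \<subseteq> C \<and> card C \<le> card B ^ d2 \<and> Q A B C"
    using assms(2) unfolding poly_closed_def by blast
  show ?thesis
    unfolding poly_closed_def
  proof (intro exI[of _ "d1 * d2"] allI impI)
    fix A :: "'a state" and B assume A: "symmetric_state D A" and B: "ample A B"
    obtain C1 where C1: "ample A C1" "B \<subseteq> C1" "card C1 \<le> card B ^ d1" "P A B C1"
      using d1[OF A B] by blast
    obtain C where C: "ample A C" "C1 \<subseteq> C" "card C \<le> card C1 ^ d2" "Q A C1 C"
      using d2[OF A C1(1)] by blast
    have "card C1 ^ d2 \<le> (card B ^ d1) ^ d2" using C1(3) by (rule power_mono) simp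
    then have "card C \<le> card B ^ (d1 * d2)" using C(3) by (simp add: power_mult)
    then show "\<exists>C. ample A C \<and> B \<subseteq> C \<and> card C \<le> card B ^ (d1 * d2) \<and>
      (\<exists>C1. ample A C1 \<and> B \<subseteq> C1 \<and> C1 \<subseteq> C \<and> P A B C1 \<and> Q A C1 C)"
      using C C1 by blast
  qed
qed

lemma poly_closed_values:
  assumes P: "poly_closed D P" and t: "wf_trm fmempty D t"
    and elems: "\<And>A B C e y. symmetric_state D A \<Longrightarrow> ample A B \<Longrightarrow> ample A C \<Longrightarrow> B \<subseteq> C \<Longrightarrow> P A B C \<Longrightarrow>
      env_in B (free_vars t) e \<Longrightarrow> y |\<in>| elems (val A e t) \<Longrightarrow> y \<in> C"
  shows "poly_closed D (\<lambda>A B C. (\<exists>C1\<subseteq>C. P A B C1) \<and> (\<forall>e. env_in B (free_vars t) e \<longrightarrow> val A e t \<in> C))"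
proof -
  let ?m = "card (free_vars t)"
  obtain d where d: "\<And>A B. symmetric_state D A \<Longrightarrow> ample A B \<Longrightarrow>
     \<exists>C. ample A C \<and> B \<subseteq> C \<and> card C \<le> card B ^ d \<and> P A B C"
    using P unfolding poly_closed_def by blast
  show ?thesis
    unfolding poly_closed_def
  \<comment> \<open>The two powers are both at most \<open>card B ^ (d + ?m)\<close>; the extra
    factor \<open>card B\<close> absorbs the 2 from adding them.\<close>
  proof (intro exI[of _ "d + ?m + 1"] allI impI)
    fix A :: "'a state" and B assume A: "symmetric_state D A" and B: "ample A B"
    obtain C where C: "ample A C" "B \<subseteq> C" "card C \<le> card B ^ d" "P A B C"
      using d[OF A B] by blast
    define W where "W = (\<lambda>e. val A e t) ` {e. env_in B (free_vars t) e}"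
    have W: "ample A (C \<union> W)" "card W \<le> card B ^ ?m"
      using ample_values[OF A B C(1) t elems[OF A B C(1,2,4)]] unfolding W_def by auto
    have N: "2 \<le> card B" using B by (rule ample_card)
    have "card (C \<union> W) \<le> card C + card W" by (rule card_Un_le)
    also have "\<dots> \<le> card B ^ d + card B ^ ?m" using C(3) W(2) by simp
    also have "\<dots> \<le> card B ^ (d + ?m) + card B ^ (d + ?m)"
      using N by (intro add_mono power_increasing) auto
    also have "\<dots> = 2 * card B ^ (d + ?m)" by simp
    also have "\<dots> \<le> card B ^ (d + ?m + 1)" using N by simp
    finally show "\<exists>C. ample A C \<and> B \<subseteq> C \<and> card C \<le> card B ^ (d + ?m + 1) \<and>
      (\<exists>C1\<subseteq>C. P A B C1) \<and> (\<forall>e. env_in B (free_vars t) e \<longrightarrow> val A e t \<in> C)"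
      using W(1) C(2,4) unfolding W_def by (intro exI[of _ "C \<union> W"]) (auto simp: W_def)
  qed
qed

lemma poly_closed_list:
  assumes "\<And>t. t \<in> set ts \<Longrightarrow>
    poly_closed D (\<lambda>(A :: 'a state) B C. \<forall>e. env_in B (free_vars t) e \<longrightarrow> values_in_trm A C e t)"
  shows "poly_closed D (\<lambda>(A :: 'a state) B C. \<forall>t\<in>set ts. \<forall>e. env_in B (free_vars t) e \<longrightarrow> values_in_trm A C e t)"
  using assms
proof (induction ts)
  case Nil
  show ?case by (rule poly_closed_trivial) simp
next
  case (Cons t ts)
  have "poly_closed D (\<lambda>(A :: 'a state) B C. \<forall>e. env_in B (free_vars t) e \<longrightarrow> values_in_trm A C e t)"
    using Cons.prems by simp
  moreover have "poly_closed D (\<lambda>(A :: 'a state) B C. \<forall>t\<in>set ts. \<forall>e. env_in B (free_vars t) e \<longrightarrow> values_in_trm A C e t)"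
    using Cons by simp
  ultimately show ?case
    by (rule poly_closed_weaken[OF poly_closed_chain]) (use values_in_trm_mono env_in_mono in fastforce)
qed

lemma poly_closed_trm:
  "wf_trm fmempty D t \<Longrightarrow>
    poly_closed D (\<lambda>(A :: 'a state) B C. \<forall>e. env_in B (free_vars t) e \<longrightarrow> values_in_trm A C e t)"
proof (induction t)
  case (Var v)
  show ?case by (rule poly_closed_trivial) (simp add: env_in_def)
next
  case (App f ts)
  have args: "poly_closed D (\<lambda>(A :: 'a state) B C. \<forall>t\<in>set ts. \<forall>e. env_in B (free_vars t) e \<longrightarrow> values_in_trm A C e t)"
    using App by (intro poly_closed_list) auto
  have sub: "env_in B (free_vars t) e" if "env_in B (free_vars (App f ts)) e" "t \<in> set ts" for B t and e :: "'a assignment"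
    using that(1) by (rule env_in_mono) (use that(2) in auto)
  show ?case
  proof (rule poly_closed_weaken[OF poly_closed_values[OF args App.prems]])
    fix A :: "'a state" and B C e y
    assume *: "ample A C" "\<forall>t\<in>set ts. \<forall>e. env_in B (free_vars t) e \<longrightarrow> values_in_trm A C e t"
      "env_in B (free_vars (App f ts)) e" "y |\<in>| elems (val A e (App f ts))"
    obtain b where "signature fmempty D f = Some (length (map (val A e) ts), b)" using App.prems by auto
    moreover have "set (map (val A e) ts) \<subseteq> C" using * sub values_in_trm_val by fastforce
    ultimately show "y \<in> C" using *(1,4) interp_elems_in by fastforce
  next
    fix A :: "'a state" and B C
    assume "(\<exists>C1\<subseteq>C. \<forall>t\<in>set ts. \<forall>e. env_in B (free_vars t) e \<longrightarrow> values_in_trm A C1 e t) \<and>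
      (\<forall>e. env_in B (free_vars (App f ts)) e \<longrightarrow> val A e (App f ts) \<in> C)"
    then show "\<forall>e. env_in B (free_vars (App f ts)) e \<longrightarrow> values_in_trm A C e (App f ts)"
      using sub values_in_trm_mono unfolding values_in_trm.simps by meson
  qed
next
  case (Compr t v r g)
  let ?c = "Compr t v r g"
  let ?P = "\<lambda>t (A :: 'a state) B C. \<forall>e. env_in B (free_vars t) e \<longrightarrow> values_in_trm A C e t"
  have r: "env_in B (free_vars r) e" if "env_in B (free_vars ?c) e" for B and e :: "'a assignment"
    using that by (rule env_in_mono) auto
  have tg: "env_in C (free_vars t) (e(v \<mapsto> a)) \<and> env_in C (free_vars g) (e(v \<mapsto> a))"
    if "env_in B (free_vars ?c) e" "B \<subseteq> C" "a \<in> C" for B C a and e :: "'a assignment"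
  proof -
    have "env_in C (free_vars t \<union> free_vars g - {v}) e" using that(1,2) by (rule env_in_mono) auto
    from env_in_upd[OF this that(3)] show ?thesis by (auto elim: env_in_mono)
  qed
  have parts: "poly_closed D (\<lambda>(A :: 'a state) B C. \<forall>e. env_in B (free_vars ?c) e \<longrightarrow> values_in_trm A C e r \<and>
      (\<forall>a\<in>fset (elems (val A e r)). values_in_trm A C (e(v \<mapsto> a)) t \<and> values_in_trm A C (e(v \<mapsto> a)) g))"
    (is "poly_closed D ?Q")
  proof (rule poly_closed_weaken[OF poly_closed_chain[OF _ poly_closed_chain]])
    show "poly_closed D (?P r)" "poly_closed D (?P t)" "poly_closed D (?P g)" using Compr by simp_all
    fix A :: "'a state" and B C
    assume "\<exists>C1. ample A C1 \<and> B \<subseteq> C1 \<and> C1 \<subseteq> C \<and> ?P r A B C1 \<and>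
      (\<exists>C2. ample A C2 \<and> C1 \<subseteq> C2 \<and> C2 \<subseteq> C \<and> ?P t A C1 C2 \<and> ?P g A C2 C)"
    then obtain C1 C2 where C: "ample A C1" "B \<subseteq> C1" "C1 \<subseteq> C" "?P r A B C1" "C1 \<subseteq> C2" "C2 \<subseteq> C"
      "?P t A C1 C2" "?P g A C2 C"
      by blast
    show "?Q A B C"
    proof (intro allI impI conjI ballI)
      fix e assume e: "env_in B (free_vars ?c) e"
      have rC1: "values_in_trm A C1 e r" using C(4) r[OF e] by blast
      then show "values_in_trm A C e r" using values_in_trm_mono C(3) by blast
      fix a assume "a |\<in>| elems (val A e r)"
      \<comment> \<open>Transitivity of \<open>C1\<close> puts every element of the range into
        \<open>C1\<close>, the family from which the closure for the body starts.\<close>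
      then have a: "a \<in> C1" using ample_elems[OF C(1) values_in_trm_val[OF rC1]] by blast
      have "values_in_trm A C2 (e(v \<mapsto> a)) t" using C(7) tg[OF e C(2) a] by blast
      then show "values_in_trm A C (e(v \<mapsto> a)) t" using values_in_trm_mono C(6) by blast
      have "env_in C2 (free_vars g) (e(v \<mapsto> a))" using tg[OF e, of C2 a] C(2,5) a by blast
      then show "values_in_trm A C (e(v \<mapsto> a)) g" using C(8) by blast
    qed
  qed
  show ?case
  proof (rule poly_closed_weaken[OF poly_closed_values[OF parts Compr.prems]])
    fix A :: "'a state" and B C e y
    assume *: "?Q A B C" "env_in B (free_vars ?c) e" "y |\<in>| elems (val A e ?c)"
    then obtain a where "a |\<in>| elems (val A e r)" "y = val A (e(v \<mapsto> a)) t" using in_val_Compr by blast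
    then show "y \<in> C" using *(1,2) values_in_trm_val by blast
  next
    fix A :: "'a state" and B C
    assume "(\<exists>C1\<subseteq>C. ?Q A B C1) \<and> (\<forall>e. env_in B (free_vars ?c) e \<longrightarrow> val A e ?c \<in> C)"
    then show "\<forall>e. env_in B (free_vars ?c) e \<longrightarrow> values_in_trm A C e ?c"
      using values_in_trm_mono unfolding values_in_trm.simps by meson
  qed
qed

lemma poly_closed_rule:
  "wf_rule fmempty D R \<Longrightarrow>
    poly_closed D (\<lambda>(A :: 'a state) B C. \<forall>e. env_in B (free_vars_rule R) e \<longrightarrow> values_in_rule A C e R)"
proof (induction R)
  case Skip
  show ?case by (rule poly_closed_trivial) simp
next
  case (Update f ts t)
  show ?case
  proof (rule poly_closed_weaken[OF poly_closed_list[of "t # ts"]])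
    show "poly_closed D (\<lambda>(A :: 'a state) B C. \<forall>e. env_in B (free_vars s) e \<longrightarrow> values_in_trm A C e s)"
      if "s \<in> set (t # ts)" for s
      using Update.prems that by (intro poly_closed_trm) auto
    fix A :: "'a state" and B C
    assume *: "\<forall>s\<in>set (t # ts). \<forall>e. env_in B (free_vars s) e \<longrightarrow> values_in_trm A C e s"
    show "\<forall>e. env_in B (free_vars_rule (Update f ts t)) e \<longrightarrow> values_in_rule A C e (Update f ts t)"
    proof (intro allI impI)
      fix e assume e: "env_in B (free_vars_rule (Update f ts t)) e"
      have "env_in B (free_vars s) e" if "s \<in> set (t # ts)" for s
        using e by (rule env_in_mono) (use that in auto)
      then show "values_in_rule A C e (Update f ts t)" using * by simp
    qed
  qed
next
  case (Cond g R1 R2)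
  let ?R = "Cond g R1 R2"
  let ?P = "\<lambda>R (A :: 'a state) B C. \<forall>e. env_in B (free_vars_rule R) e \<longrightarrow> values_in_rule A C e R"
  let ?G = "\<lambda>(A :: 'a state) B C. \<forall>e. env_in B (free_vars g) e \<longrightarrow> values_in_trm A C e g"
  have g: "poly_closed D ?G" using Cond.prems by (intro poly_closed_trm) simp
  have R1: "poly_closed D (?P R1)" and R2: "poly_closed D (?P R2)" using Cond by simp_all
  show ?case
  proof (rule poly_closed_weaken[OF poly_closed_chain[OF R1 poly_closed_chain[OF R2 g]]])
    fix A :: "'a state" and B C
    assume "\<exists>C1. ample A C1 \<and> B \<subseteq> C1 \<and> C1 \<subseteq> C \<and> ?P R1 A B C1 \<and>
      (\<exists>C2. ample A C2 \<and> C1 \<subseteq> C2 \<and> C2 \<subseteq> C \<and> ?P R2 A C1 C2 \<and> ?G A C2 C)"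
    then obtain C1 C2 where C: "B \<subseteq> C1" "C1 \<subseteq> C" "?P R1 A B C1" "C1 \<subseteq> C2" "C2 \<subseteq> C"
      "?P R2 A C1 C2" "?G A C2 C"
      by blast
    show "?P ?R A B C"
    proof (intro allI impI)
      fix e assume e: "env_in B (free_vars_rule ?R) e"
      have "env_in B (free_vars_rule R1) e" "env_in C1 (free_vars_rule R2) e" "env_in C2 (free_vars g) e"
        using C(1) subset_trans[OF C(1,4)] by (auto intro: env_in_mono[OF e])
      then have "values_in_rule A C1 e R1" "values_in_rule A C2 e R2" "values_in_trm A C e g"
        using C(3,6,7) by simp_all
      then show "values_in_rule A C e ?R"
        using values_in_rule_mono C(2,5) by auto
    qed
  qed
next
  case (Forall v r R)
  let ?R = "Forall v r R"
  let ?P = "\<lambda>(A :: 'a state) B C. \<forall>e. env_in B (free_vars_rule R) e \<longrightarrow> values_in_rule A C e R"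
  let ?G = "\<lambda>(A :: 'a state) B C. \<forall>e. env_in B (free_vars r) e \<longrightarrow> values_in_trm A C e r"
  have r: "poly_closed D ?G" using Forall.prems by (intro poly_closed_trm) simp
  have R: "poly_closed D ?P" using Forall by simp
  show ?case
  proof (rule poly_closed_weaken[OF poly_closed_chain[OF r R]])
    fix A :: "'a state" and B C
    assume "\<exists>C1. ample A C1 \<and> B \<subseteq> C1 \<and> C1 \<subseteq> C \<and> ?G A B C1 \<and> ?P A C1 C"
    then obtain C1 where C: "ample A C1" "B \<subseteq> C1" "C1 \<subseteq> C" "?G A B C1" "?P A C1 C" by blast
    show "\<forall>e. env_in B (free_vars_rule ?R) e \<longrightarrow> values_in_rule A C e ?R"
    proof (intro allI impI)
      fix e assume e: "env_in B (free_vars_rule ?R) e"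
      have r: "values_in_trm A C1 e r" using C(4) env_in_mono[OF e, of B "free_vars r"] by simp
      have "values_in_rule A C (e(v \<mapsto> a)) R" if "a |\<in>| elems (val A e r)" for a
      proof -
        have "a \<in> C1" using ample_elems[OF C(1) values_in_trm_val[OF r] that] .
        moreover have "env_in C1 (free_vars_rule R - {v}) e" using e C(2) by (rule env_in_mono) auto
        ultimately show ?thesis using C(5) env_in_upd by blast
      qed
      then show "values_in_rule A C e ?R" using r C(3) values_in_trm_mono by auto
    qed
  qed
qed

section \<open>The embedding commutes with computations\<close>

lemma map_obj_Union:
  "map_obj p (HSet (ffUnion (elems |`| elems x))) = HSet (ffUnion (elems |`| elems (map_obj p x)))"
  by (auto simp: fset_eq_iff ffUnion.rep_eq)

text \<open>Every bound variable enlarges the set of relevant atoms by at most \<open>k\<close>, so \<open>k\<close> times the weight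
  bounds the number of atoms needed to evaluate a term.\<close>

fun trm_weight :: "trm \<Rightarrow> nat" where
  "trm_weight (Var v) = 1"
| "trm_weight (App f ts) = Suc (sum_list (map trm_weight ts))"
| "trm_weight (Compr t v r g) = Suc (trm_weight t + trm_weight r + trm_weight g)"

lemma trm_weight_arg: "t \<in> set ts \<Longrightarrow> trm_weight t \<le> sum_list (map trm_weight ts)"
  by (simp add: member_le_sum_list)

primrec rule_weight :: "rule \<Rightarrow> nat" where
  "rule_weight Skip = 1"
| "rule_weight (Update f ts t) = Suc (sum_list (map trm_weight ts) + trm_weight t)"
| "rule_weight (Cond g R1 R2) = Suc (trm_weight g + rule_weight R1 + rule_weight R2)"
| "rule_weight (Forall v r R) = Suc (trm_weight r + rule_weight R)"

context spreading
begin

section \<open>Constants and basic functions under the embedding\<close>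

lemma supp_least_X:
  assumes "2 * card Z < card X" "Z \<subseteq> X" "\<And>p. p permutes (X - Z) \<Longrightarrow> map_obj p x = x"
  shows "supp X x \<subseteq> Z"
  using finite_X assms by (rule supp_least)

lemma spread_fixed:
  assumes "p permutes (Y - Z)" "x \<in> S" "supp X x \<subseteq> Z"
  shows "map_obj p (T x) = T x"
proof -
  have "p permutes (Y - supp X x)" using assms(1,3) by (auto elim: permutes_subset)
  then show ?thesis using supp_fixes_spread symm_HF[OF assms(2)] by blast
qed

lemma symm_fixed:
  assumes "p permutes (X - Z)" "supp X x \<subseteq> Z"
  shows "map_obj p x = x"
proof -
  have "p permutes (X - supp X x)" using assms by (auto elim: permutes_subset)
  then show ?thesis by (rule supp_fixes[OF finite_X])
qed

lemma zero_symm: "zero_obj \<in> S" and supp_zero: "supp X zero_obj = {}"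
proof -
  have "supp X zero_obj \<subseteq> {}" using k_X by (intro supp_least_X) auto
  then show "supp X zero_obj = {}" by simp
  then show "zero_obj \<in> S" unfolding zero_obj_def by (intro symm_HSet) auto
qed

lemma one_symm: "one_obj \<in> S" and supp_one: "supp X one_obj = {}"
proof -
  have "supp X one_obj \<subseteq> {}" using k_X by (intro supp_least_X) auto
  then show "supp X one_obj = {}" by simp
  then show "one_obj \<in> S" unfolding one_obj_def using zero_symm by (intro symm_HSet) auto
qed

lemma spread_zero [simp]: "T zero_obj = zero_obj"
proof -
  obtain t where t: "T zero_obj = HSet t" using spread_HSet unfolding zero_obj_def by blast
  have "z |\<notin>| t" for z using elems_spread[of z zero_obj] t by (simp add: zero_obj_def)
  then have "t = {||}" by blast
  then show ?thesis using t by (simp add: zero_obj_def)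
qed

lemma spread_one [simp]: "T one_obj = one_obj"
proof -
  have "one_obj = T one_obj"
    using k_X supp_one
    by (intro spread_eqI[OF one_symm, where Z = "{}" and s = "{|zero_obj|}" and t = "{|zero_obj|}"])
       (auto simp: one_obj_def intro: permutes_id)
  then show ?thesis by simp
qed

lemma spread_truth_value [simp]: "T (truth_value b) = truth_value b"
  by (simp add: truth_value_def)

lemma spread_eq_zero_iff: "x \<in> S \<Longrightarrow> T x = zero_obj \<longleftrightarrow> x = zero_obj"
  using spread_eq_iff[OF _ zero_symm] by simp

lemma spread_eq_one_iff: "x \<in> S \<Longrightarrow> T x = one_obj \<longleftrightarrow> x = one_obj"
  using spread_eq_iff[OF _ one_symm] by simp

lemma connective_spread: "x \<in> S \<Longrightarrow> y \<in> S \<Longrightarrow> connective c (T x) (T y) = connective c x y"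
  by (simp add: connective_def is_boolean_def spread_eq_zero_iff spread_eq_one_iff)

lemma spread_connective [simp]: "T (connective c x y) = connective c x y"
  by (simp add: connective_def)

text \<open>The only element of \<open>x\<close> is fixed by every permutation that fixes
  \<open>x\<close>, so its support lies in that of \<open>x\<close> and the closure adds nothing to
  \<open>T y\<close>. Conversely, distinct elements stay distinct by injectivity.\<close>

lemma spread_unique_elem:
  assumes x: "x \<in> S"
  shows "(if \<exists>!y. y |\<in>| elems (T x) then THE y. y |\<in>| elems (T x) else zero_obj) =
    T (if \<exists>!y. y |\<in>| elems x then THE y. y |\<in>| elems x else zero_obj)"
proof (cases "\<exists>!y. y |\<in>| elems x")
  case True
  then obtain y where y: "y |\<in>| elems x" "\<And>z. z |\<in>| elems x \<Longrightarrow> z = y" by blast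
  have yS: "y \<in> S" using symm_elems[OF x y(1)] .
  have "supp X y \<subseteq> supp X x"
  proof (rule supp_least_X)
    show "2 * card (supp X x) < card X" using card_supp[OF x] k_X by simp
    fix p assume "p permutes (X - supp X x)"
    then have "map_obj p x = x" by (rule supp_fixes[OF finite_X])
    then have "map_obj p y |\<in>| elems x" using y(1) by (rule map_obj_fixed_elem)
    then show "map_obj p y = y" by (rule y(2))
  qed simp
  then have "z = T y" if "z |\<in>| elems (T x)" for z
    using that y(2) spread_fixed[OF _ yS] by (metis elems_spreadE)
  then have "elems (T x) = {|T y|}" using elems_spreadI[OF y(1)] by (intro fset_eqI) (metis fsingleton_iff)
  moreover have "elems x = {|y|}" using y by (intro fset_eqI) (metis fsingleton_iff)
  ultimately show ?thesis by simp
next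
  case False
  have "\<not> (\<exists>!z. z |\<in>| elems (T x))"
  proof
    assume "\<exists>!z. z |\<in>| elems (T x)"
    then obtain z where z: "z |\<in>| elems (T x)" "\<And>w. w |\<in>| elems (T x) \<Longrightarrow> w = z" by blast
    obtain y where y: "y |\<in>| elems x" using z(1) by (rule elems_spreadE)
    have "w = y" if "w |\<in>| elems x" for w
      using z(2)[OF elems_spreadI[OF that]] z(2)[OF elems_spreadI[OF y]]
        spread_inj[OF symm_elems[OF x that] symm_elems[OF x y]] by simp
    then show False using False y by blast
  qed
  then show ?thesis using False by (simp only: if_False spread_zero)
qed

text \<open>A pair may have a support of size \<open>2 * k\<close>, so its membership in
  \<open>S\<close> is a hypothesis. The two supports leave room for \<open>k\<close> more atoms, as
  \<open>elems_spread_move\<close> demands.\<close>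

lemma spread_Pair:
  assumes large: "6 * k < card X" and x: "x \<in> S" "y \<in> S" and xy: "HSet {|x, y|} \<in> S"
  shows "HSet {|T x, T y|} = T (HSet {|x, y|})"
proof (rule spread_eqI[OF xy, where Z = "supp X x \<union> supp X y"])
  let ?Z = "supp X x \<union> supp X y"
  have "card ?Z \<le> card (supp X x) + card (supp X y)" by (rule card_Un_le)
  then have Z: "card ?Z \<le> 2 * k" using card_supp[OF x(1)] card_supp[OF x(2)] by simp
  then show "card ?Z + k \<le> card X" using large by simp
  show "?Z \<subseteq> X" by simp
  show "supp X (HSet {|x, y|}) \<subseteq> ?Z"
  proof (rule supp_least_X)
    show "2 * card ?Z < card X" using Z large by simp
    show "map_obj p (HSet {|x, y|}) = HSet {|x, y|}" if "p permutes (X - ?Z)" for p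
      using symm_fixed[OF that] by simp
  qed simp
  show "map_obj p (HSet {|T x, T y|}) = HSet {|T x, T y|}" if "p permutes (Y - ?Z)" for p
    using spread_fixed[OF that] x by simp
  show "\<exists>p x'. p permutes (Y - ?Z) \<and> x' |\<in>| {|x, y|} \<and> map_obj p y' = T x'" if "y' |\<in>| {|T x, T y|}" for y'
    using that by (intro exI[of _ id]) (auto simp: obj.map_id permutes_id)
qed auto

text \<open>An element of an element \<open>v\<close> of \<open>T x\<close> needs two moves: the
  first carries \<open>v\<close> to some embedded \<open>T w\<close>, the second carries the element
  of \<open>T w\<close> to an embedded one while also fixing the support of
  \<open>w\<close>.\<close>

lemma spread_Union:
  assumes large: "6 * k < card X" and x: "x \<in> S" and u: "HSet (ffUnion (elems |`| elems x)) \<in> S"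
  shows "HSet (ffUnion (elems |`| elems (T x))) = T (HSet (ffUnion (elems |`| elems x)))"
proof (rule spread_eqI[OF u, where Z = "supp X x"])
  let ?Z = "supp X x"
  have Z: "card ?Z \<le> k" using card_supp[OF x] .
  then show "card ?Z + k \<le> card X" using large by simp
  show "supp X (HSet (ffUnion (elems |`| elems x))) \<subseteq> ?Z"
  proof (rule supp_least_X)
    show "2 * card ?Z < card X" using Z large by simp
    show "map_obj p (HSet (ffUnion (elems |`| elems x))) = HSet (ffUnion (elems |`| elems x))"
      if "p permutes (X - ?Z)" for p
      unfolding map_obj_Union symm_fixed[OF that subset_refl] ..
  qed simp
  show "map_obj p (HSet (ffUnion (elems |`| elems (T x)))) = HSet (ffUnion (elems |`| elems (T x)))"
    if "p permutes (Y - ?Z)" for p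
    unfolding map_obj_Union spread_fixed[OF that x subset_refl] ..
  show "T x' |\<in>| ffUnion (elems |`| elems (T x))" if x': "x' |\<in>| ffUnion (elems |`| elems x)" for x'
  proof -
    obtain w where "w |\<in>| elems x" "x' |\<in>| elems w" using x' by (auto simp: ffUnion.rep_eq)
    then have "T w |\<in>| elems (T x)" "T x' |\<in>| elems (T w)" using elems_spreadI by blast+
    then show ?thesis by (auto simp: ffUnion.rep_eq)
  qed
  show "\<exists>p x'. p permutes (Y - ?Z) \<and> x' |\<in>| ffUnion (elems |`| elems x) \<and> map_obj p y' = T x'"
    if y': "y' |\<in>| ffUnion (elems |`| elems (T x))" for y'
  proof -
    obtain v where v: "v |\<in>| elems (T x)" "y' |\<in>| elems v" using y' by (auto simp: ffUnion.rep_eq)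
    obtain p w where p: "p permutes (Y - ?Z)" "w |\<in>| elems x" "map_obj p v = T w"
      by (rule elems_spread_move[OF x v(1) subset_refl supp_subset]) (use Z large in simp)
    have w: "w \<in> S" using symm_elems[OF x p(2)] .
    have "map_obj p y' |\<in>| elems (map_obj p v)" using v(2) unfolding elems_map_obj by (rule fimageI)
    then have z: "map_obj p y' |\<in>| elems (T w)" unfolding p(3) .
    have "card (?Z \<union> supp X w) \<le> card ?Z + card (supp X w)" by (rule card_Un_le)
    then have card: "card (?Z \<union> supp X w) + k \<le> card X" using Z card_supp[OF w] large by simp
    obtain q x' where q: "q permutes (Y - (?Z \<union> supp X w))" "x' |\<in>| elems w" "map_obj q (map_obj p y') = T x'"
      by (rule elems_spread_move[OF w z Un_upper2 _ card]) auto
    have "q permutes (Y - ?Z)" using q(1) by (rule permutes_subset) auto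
    then have "q \<circ> p permutes (Y - ?Z)" using p(1) by (intro permutes_compose)
    moreover have "x' |\<in>| ffUnion (elems |`| elems x)" using q(2) p(2) by (auto simp: ffUnion.rep_eq)
    ultimately show ?thesis using q(3) by (metis map_obj_o)
  qed
qed auto

text \<open>Both sets have empty support, and a transposition brings any atom of \<open>Y\<close>
  into \<open>X\<close>.\<close>

lemma spread_Atoms:
  assumes "fset AX = X" "fset AY = Y" "HSet (Atom |`| AX) \<in> S"
  shows "HSet (Atom |`| AY) = T (HSet (Atom |`| AX))"
proof (rule spread_eqI[OF assms(3), where Z = "{}"])
  show "supp X (HSet (Atom |`| AX)) \<subseteq> {}"
  proof (rule supp_least_X)
    fix p assume "p permutes X - {}"
    then have "p ` X = X" by (simp add: permutes_image)
    then have "p |`| AX = AX" by (simp add: assms(1) fset_inject[symmetric])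
    then show "map_obj p (HSet (Atom |`| AX)) = HSet (Atom |`| AX)"
      by (metis (no_types, lifting) fset.map_comp fset.map_cong0 comp_apply obj.map(1) obj.map(2))
  qed (use k_X in auto)
  show "map_obj p (HSet (Atom |`| AY)) = HSet (Atom |`| AY)" if "p permutes Y - {}" for p
  proof -
    have "p ` Y = Y" using that by (simp add: permutes_image)
    then have "p |`| AY = AY" by (simp add: assms(2) fset_inject[symmetric])
    then show ?thesis
      by (metis (no_types, lifting) fset.map_comp fset.map_cong0 comp_apply obj.map(1) obj.map(2))
  qed
  show "T x' |\<in>| Atom |`| AY" if "x' |\<in>| Atom |`| AX" for x'
    using that X_Y assms(1,2) by auto
  show "\<exists>p x'. p permutes Y - {} \<and> x' |\<in>| Atom |`| AX \<and> map_obj p y' = T x'" if y': "y' |\<in>| Atom |`| AY" for y'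
  proof -
    obtain b where b: "y' = Atom b" "b \<in> Y" using y' assms(2) by auto
    obtain a where a: "a \<in> X" using k_X by fastforce
    have "transpose b a permutes Y" using a b(2) X_Y by (intro permutes_swap_id) auto
    then show ?thesis using a b(1) assms(1)
      by (intro exI[of _ "transpose b a"] exI[of _ "Atom a"]) auto
  qed
qed (use k_X in auto)

text \<open>The dynamic functions are tied together at embedded arguments only. Other arguments over
  \<open>Y\<close> are reached through the symmetry of \<open>A'\<close>.\<close>

definition spread_state :: "dyn_voc \<Rightarrow> 'a state \<Rightarrow> 'a state \<Rightarrow> bool" where
  "spread_state D A A' \<longleftrightarrow> fset (universe (input A)) = X \<and> fset (universe (input A')) = Y \<and>
     symmetric_state D A \<and> symmetric_state D A' \<and>
     (\<forall>f xs b. fmlookup D f = Some (length xs, b) \<longrightarrow> set xs \<subseteq> S \<longrightarrow>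
        dyn A' f (map T xs) = T (dyn A f xs))"

lemma interp_spread:
  assumes large: "6 * k < card X" and st: "spread_state D A A'"
    and sig: "signature fmempty D f = Some (length xs, b)" and xs: "set xs \<subseteq> S" and i: "interp A f xs \<in> S"
  shows "interp A' f (map T xs) = T (interp A f xs)"
  using signature_cases[OF sig]
proof (elim disjE conjE exE)
  fix x y assume f: "f \<in> {EqN, AndN, OrN, ImpN, IffN, MemN, PairN}" and xy: "xs = [x, y]"
  have S: "x \<in> S" "y \<in> S" using xs xy by auto
  have "HSet {|T x, T y|} = T (HSet {|x, y|})" if "f = PairN"
    using spread_Pair[OF large S] i xy that by simp
  then show ?thesis
    using f xy S by (auto simp: spread_eq_iff spread_elem_iff connective_spread)
next
  fix x assume f: "f \<in> {NotN, UnionN, TheUniqueN}" and x: "xs = [x]"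
  have S: "x \<in> S" using xs x by auto
  from f consider "f = NotN" | "f = UnionN" | "f = TheUniqueN" by blast
  then show ?thesis
  proof cases
    case 1
    then show ?thesis using x S by (simp add: is_boolean_def spread_eq_zero_iff spread_eq_one_iff)
  next
    case 2
    have "HSet (ffUnion (elems |`| elems x)) \<in> S"
      using i unfolding 2 x interp.simps nth_Cons_0 .
    from spread_Union[OF large S this] show ?thesis
      unfolding 2 x interp.simps list.map nth_Cons_0 .
  next
    case 3
    show ?thesis
      using spread_unique_elem[OF S] unfolding 3 x interp.simps list.map nth_Cons_0 .
  qed
next
  assume f: "f \<in> {TrueN, FalseN, EmptyN, AtomsN}" "xs = []"
  have "HSet (Atom |`| universe (input A')) = T (HSet (Atom |`| universe (input A)))" if "f = AtomsN"
    using spread_Atoms st i that by (simp add: spread_state_def)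
  then show ?thesis using f by auto
next
  fix g assume "f = DynN g" "fmlookup D g = Some (length xs, b)"
  then show ?thesis using st xs by (simp add: spread_state_def)
qed simp

section \<open>Terms under the embedding\<close>

definition env_spread :: "'a set \<Rightarrow> nat set \<Rightarrow> 'a assignment \<Rightarrow> 'a assignment \<Rightarrow> bool" where
  "env_spread Z V e e' \<longleftrightarrow>
     (\<forall>v\<in>V. \<exists>x\<in>S. e v = Some x \<and> e' v = Some (T x) \<and> supp X x \<subseteq> Z)"

lemma env_spread_mono: "env_spread Z V e e' \<Longrightarrow> W \<subseteq> V \<Longrightarrow> env_spread Z W e e'"
  by (fastforce simp: env_spread_def)

lemma env_spread_upd:
  assumes "env_spread Z V e e'" "W - {v} \<subseteq> V" "a \<in> S"
  shows "env_spread (Z \<union> supp X a) W (e(v \<mapsto> a)) (e'(v \<mapsto> T a))"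
  unfolding env_spread_def
proof
  fix u assume u: "u \<in> W"
  show "\<exists>x\<in>S. (e(v \<mapsto> a)) u = Some x \<and> (e'(v \<mapsto> T a)) u = Some (T x) \<and> supp X x \<subseteq> Z \<union> supp X a"
  proof (cases "u = v")
    case False
    then have "u \<in> V" using u assms(2) by blast
    then obtain x where "x \<in> S" "e u = Some x" "e' u = Some (T x)" "supp X x \<subseteq> Z"
      using assms(1) unfolding env_spread_def by blast
    then show ?thesis using False by auto
  qed (use assms(3) in auto)
qed

lemma env_spread_fixed:
  assumes "env_spread Z V e e'" "p permutes (Y - Z)"
  shows "env_maps (map_obj p) V e' e'"
  unfolding env_maps_def
proof
  fix v assume "v \<in> V"
  then obtain x where x: "x \<in> S" "e' v = Some (T x)" "supp X x \<subseteq> Z"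
    using assms(1) unfolding env_spread_def by blast
  then show "\<exists>y. e' v = Some y \<and> e' v = Some (map_obj p y)"
    using spread_fixed[OF assms(2) x(1,3)] by simp
qed

lemma env_spread_fixed_X:
  assumes "env_spread Z V e e'" "p permutes (X - Z)"
  shows "env_maps (map_obj p) V e e"
  unfolding env_maps_def
proof
  fix v assume "v \<in> V"
  then obtain x where x: "e v = Some x" "supp X x \<subseteq> Z"
    using assms(1) unfolding env_spread_def by blast
  then show "\<exists>y. e v = Some y \<and> e v = Some (map_obj p y)"
    using symm_fixed[OF assms(2) x(2)] by simp
qed

lemma spread_state_iso:
  assumes "spread_state D A A'"
  shows "p permutes (X - Z) \<Longrightarrow> state_iso p A A" "p permutes (Y - Z) \<Longrightarrow> state_iso p A' A'"
  using assms symmetric_state_iso permutes_subset[of p "X - Z" X] permutes_subset[of p "Y - Z" Y]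
  unfolding spread_state_def by blast+

lemma supp_val_subset:
  assumes st: "spread_state D A A'" and t: "wf_trm fmempty D t" and e: "env_spread Z (free_vars t) e e'"
    and Z: "2 * card Z < card X" "Z \<subseteq> X"
  shows "supp X (val A e t) \<subseteq> Z"
proof (rule supp_least_X[OF Z])
  fix p assume p: "p permutes (X - Z)"
  show "map_obj p (val A e t) = val A e t"
    using val_iso[OF permutes_bij[OF p] spread_state_iso(1)[OF st p] t env_spread_fixed_X[OF e p]] by simp
qed

text \<open>For a comprehension, \<open>spread_eqI\<close> reduces the claim to moving each value
  over \<open>Y\<close>. It arises from an element \<open>b\<close> of the embedded range; an
  automorphism of \<open>A'\<close> that fixes \<open>Z\<close>, and hence the other variables,
  carries \<open>b\<close> to an embedded \<open>T a\<close>, where the induction hypothesis applies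
  with \<open>supp X a\<close> added to \<open>Z\<close>. The summand 3 secures
  \<open>6 * k < card X\<close> for the basic functions.\<close>

lemma val_spread:
  assumes st: "spread_state D A A'"
  shows "wf_trm fmempty D t \<Longrightarrow> values_in_trm A S e t \<Longrightarrow> env_spread Z (free_vars t) e e' \<Longrightarrow> Z \<subseteq> X \<Longrightarrow>
    2 * (card Z + k * (trm_weight t + 3)) < card X \<Longrightarrow> val A' e' t = T (val A e t)"
proof (induction t arbitrary: e e' Z)
  case (Var v)
  then show ?case by (auto simp: env_spread_def)
next
  case (App f ts)
  have "val A' e' t = T (val A e t)" if t: "t \<in> set ts" for t
  proof (rule App.IH[OF t, where Z = Z])
    have "2 * (card Z + k * (trm_weight t + 3)) \<le> 2 * (card Z + k * (trm_weight (App f ts) + 3))"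
      using trm_weight_arg[OF t] by (intro mult_le_mono add_le_mono) auto
    then show "2 * (card Z + k * (trm_weight t + 3)) < card X"
      using App.prems(5) by (rule le_less_trans)
  qed (use App.prems t in \<open>auto elim: env_spread_mono\<close>)
  then have *: "map (val A' e') ts = map T (map (val A e) ts)" by simp
  obtain b where sig: "signature fmempty D f = Some (length (map (val A e) ts), b)"
    using App.prems(1) by auto
  have large: "6 * k < card X" using App.prems(5) by (simp add: algebra_simps)
  have "set (map (val A e) ts) \<subseteq> S" using App.prems(2) by (auto intro: values_in_trm_val)
  moreover have "interp A f (map (val A e) ts) \<in> S" using App.prems(2) by simp
  ultimately show ?case using interp_spread[OF large st sig] by (simp only: val.simps *)
next
  case (Compr t v r g)
  let ?c = "Compr t v r g"
  note bound = Compr.prems(5)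
  have r: "val A' e' r = T (val A e r)"
  proof (rule Compr.IH(2)[where Z = Z])
    show "2 * (card Z + k * (trm_weight r + 3)) < card X" using bound by (simp add: algebra_simps)
  qed (use Compr.prems in \<open>auto elim: env_spread_mono\<close>)
  have cardZ: "2 * (card Z + k) < card X" using bound by (simp add: algebra_simps)
  have valr: "val A e r \<in> S" using Compr.prems(2) values_in_trm_val by auto
  have suppr: "supp X (val A e r) \<subseteq> Z"
    using Compr.prems cardZ by (intro supp_val_subset[OF st, where e' = e']) (auto elim: env_spread_mono)
  have body: "val A' (e'(v \<mapsto> T a)) t = T (val A (e(v \<mapsto> a)) t) \<and>
      val A' (e'(v \<mapsto> T a)) g = T (val A (e(v \<mapsto> a)) g) \<and> val A (e(v \<mapsto> a)) g \<in> S"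
    if a: "a |\<in>| elems (val A e r)" for a
  proof -
    have aS: "a \<in> S" using symm_elems[OF valr a] .
    have env: "env_spread (Z \<union> supp X a) W (e(v \<mapsto> a)) (e'(v \<mapsto> T a))"
      if "W - {v} \<subseteq> free_vars ?c" for W
      using env_spread_upd[OF Compr.prems(3) that aS] .
    have "card (Z \<union> supp X a) \<le> card Z + k"
      using card_Un_le[of Z "supp X a"] card_supp[OF aS] by linarith
    then have "2 * (card (Z \<union> supp X a) + k * (trm_weight t + 3)) < card X"
      and "2 * (card (Z \<union> supp X a) + k * (trm_weight g + 3)) < card X"
      using bound by (simp_all add: algebra_simps)
    moreover have "values_in_trm A S (e(v \<mapsto> a)) t" "values_in_trm A S (e(v \<mapsto> a)) g"
      using Compr.prems(2) a by auto
    moreover have "wf_trm fmempty D t" "wf_trm fmempty D g" using Compr.prems(1) by auto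
    moreover have "Z \<union> supp X a \<subseteq> X" using Compr.prems(4) by simp
    moreover have "env_spread (Z \<union> supp X a) (free_vars t) (e(v \<mapsto> a)) (e'(v \<mapsto> T a))"
      "env_spread (Z \<union> supp X a) (free_vars g) (e(v \<mapsto> a)) (e'(v \<mapsto> T a))"
      by (auto intro!: env)
    ultimately show ?thesis using Compr.IH(1,3) values_in_trm_val by blast
  qed
  show ?case
  proof (rule spread_eqI[OF _ _ Compr.prems(4) _ val.simps(3) val.simps(3)])
    show "val A e ?c \<in> S" using Compr.prems(2) by simp
    show "supp X (val A e ?c) \<subseteq> Z"
      using cardZ by (intro supp_val_subset[OF st Compr.prems(1,3) _ Compr.prems(4)]) simp
    show "card Z + k \<le> card X" using cardZ by simp
    show "map_obj p (val A' e' ?c) = val A' e' ?c" if p: "p permutes (Y - Z)" for p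
      using val_iso[OF permutes_bij[OF p] spread_state_iso(2)[OF st p] Compr.prems(1)
          env_spread_fixed[OF Compr.prems(3) p]] by (rule sym)
    fix x' assume "x' |\<in>| (\<lambda>a. val A (e(v \<mapsto> a)) t) |`|
      ffilter (\<lambda>a. val A (e(v \<mapsto> a)) g = one_obj) (elems (val A e r))"
    then obtain a where a: "a |\<in>| elems (val A e r)" "val A (e(v \<mapsto> a)) g = one_obj" "x' = val A (e(v \<mapsto> a)) t"
      by auto
    have "T a |\<in>| elems (val A' e' r)" unfolding r using a(1) by (rule elems_spreadI)
    moreover have "val A' (e'(v \<mapsto> T a)) g = one_obj" "T x' = val A' (e'(v \<mapsto> T a)) t"
      using body[OF a(1)] a(2,3) by simp_all
    ultimately show "T x' |\<in>| (\<lambda>a. val A' (e'(v \<mapsto> a)) t) |`|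
      ffilter (\<lambda>a. val A' (e'(v \<mapsto> a)) g = one_obj) (elems (val A' e' r))" by auto
  next
    fix y' assume "y' |\<in>| (\<lambda>a. val A' (e'(v \<mapsto> a)) t) |`|
      ffilter (\<lambda>a. val A' (e'(v \<mapsto> a)) g = one_obj) (elems (val A' e' r))"
    then obtain b where b: "b |\<in>| elems (T (val A e r))" "val A' (e'(v \<mapsto> b)) g = one_obj"
      "y' = val A' (e'(v \<mapsto> b)) t"
      unfolding r by auto
    obtain p a where p: "p permutes (Y - Z)" and a: "a |\<in>| elems (val A e r)" "map_obj p b = T a"
      using cardZ by (auto intro: elems_spread_move[OF valr b(1) suppr Compr.prems(4)])
    have maps: "env_maps (map_obj p) W (e'(v \<mapsto> b)) (e'(v \<mapsto> T a))" if "W - {v} \<subseteq> free_vars ?c" for W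
      using env_maps_upd[of "map_obj p" W v e' e' b] env_spread_fixed[OF env_spread_mono[OF Compr.prems(3) that] p]
      unfolding a(2) by blast
    have "val A' (e'(v \<mapsto> T a)) t = map_obj p y'"
      unfolding b(3) using Compr.prems(1)
      by (intro val_iso[OF permutes_bij[OF p] spread_state_iso(2)[OF st p]] maps) auto
    moreover have "val A' (e'(v \<mapsto> T a)) g = map_obj p (val A' (e'(v \<mapsto> b)) g)"
      using Compr.prems(1)
      by (intro val_iso[OF permutes_bij[OF p] spread_state_iso(2)[OF st p]] maps) auto
    ultimately have "map_obj p y' = T (val A (e(v \<mapsto> a)) t)" "val A (e(v \<mapsto> a)) g = one_obj"
      using body[OF a(1)] b(2) spread_eq_one_iff by auto
    then show "\<exists>p x'. p permutes (Y - Z) \<and> x' |\<in>| (\<lambda>a. val A (e(v \<mapsto> a)) t) |`|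
      ffilter (\<lambda>a. val A (e(v \<mapsto> a)) g = one_obj) (elems (val A e r)) \<and> map_obj p y' = T x'"
      using p a(1) by (intro exI[of _ p] exI[of _ "val A (e(v \<mapsto> a)) t"]) auto
  qed
qed

section \<open>Updates and runs under the embedding\<close>

lemma spread_list_inj:
  assumes "set xs \<subseteq> S" "set ys \<subseteq> S" "map T xs = map T ys"
  shows "xs = ys"
proof -
  have "inj_on T (set xs \<union> set ys)" using assms(1,2) spread_inj by (blast intro: inj_onI)
  then show ?thesis using assms(3) by (rule map_inj_on[rotated])
qed

lemma spread_list_fixed:
  assumes "p permutes (Y - Z)" "set xs \<subseteq> S" "(\<Union>x\<in>set xs. supp X x) \<subseteq> Z"
  shows "map (map_obj p) (map T xs) = map T xs"
proof -
  have "map_obj p (T x) = T x" if "x \<in> set xs" for x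
    by (rule spread_fixed[OF assms(1)]) (use that assms(2,3) in blast)+
  then show ?thesis by simp
qed

lemma card_supp_list: "set xs \<subseteq> S \<Longrightarrow> card (\<Union>x\<in>set xs. supp X x) \<le> k * length xs"
proof (induction xs)
  case (Cons x xs)
  then show ?case
    using card_Un_le[of "supp X x" "\<Union>x\<in>set xs. supp X x"] card_supp[of x] by fastforce
qed simp

lemma spread_state_dyn:
  "spread_state D A A' \<Longrightarrow> fmlookup D f = Some (length xs, b) \<Longrightarrow> set xs \<subseteq> S \<Longrightarrow>
    dyn A' f (map T xs) = T (dyn A f xs)"
  by (simp add: spread_state_def)

lemma Den_spread:
  assumes st: "spread_state D A A'"
  shows "wf_rule fmempty D R \<Longrightarrow> values_in_rule A S e R \<Longrightarrow> env_spread Z (free_vars_rule R) e e' \<Longrightarrow>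
    Z \<subseteq> X \<Longrightarrow> 2 * (card Z + k * (rule_weight R + 3)) < card X \<Longrightarrow> (f, xs, b) \<in> Den A e R \<Longrightarrow>
    set xs \<subseteq> S \<and> b \<in> S \<and> (f, map T xs, T b) \<in> Den A' e' R"
proof (induction R arbitrary: e e' Z)
  case (Update h ts t)
  have "val A' e' s = T (val A e s)" if s: "s \<in> set (t # ts)" for s
  proof (rule val_spread[OF st, where Z = Z])
    have "trm_weight s \<le> rule_weight (Update h ts t)" using s trm_weight_arg[of s ts] by auto
    then have "2 * (card Z + k * (trm_weight s + 3)) \<le> 2 * (card Z + k * (rule_weight (Update h ts t) + 3))"
      by (intro mult_le_mono add_le_mono) auto
    then show "2 * (card Z + k * (trm_weight s + 3)) < card X"
      using Update.prems(5) by (rule le_less_trans)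
  qed (use Update.prems s in \<open>auto elim: env_spread_mono\<close>)
  moreover have "val A e s \<in> S" if "s \<in> set (t # ts)" for s
    using Update.prems(2) that by (auto intro: values_in_trm_val)
  ultimately show ?case using Update.prems(6) by auto
next
  case (Cond g R1 R2)
  note bound = Cond.prems(5)
  have "val A' e' g = T (val A e g)"
  proof (rule val_spread[OF st, where Z = Z])
    show "2 * (card Z + k * (trm_weight g + 3)) < card X" using bound by (simp add: algebra_simps)
  qed (use Cond.prems in \<open>auto elim: env_spread_mono\<close>)
  moreover have "val A e g \<in> S" using Cond.prems(2) by (auto intro: values_in_trm_val)
  ultimately have g: "val A' e' g = one_obj \<longleftrightarrow> val A e g = one_obj" by (simp add: spread_eq_one_iff)
  have "2 * (card Z + k * (rule_weight R1 + 3)) < card X" "2 * (card Z + k * (rule_weight R2 + 3)) < card X"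
    using bound by (simp_all add: algebra_simps)
  moreover have "env_spread Z (free_vars_rule R1) e e'" "env_spread Z (free_vars_rule R2) e e'"
    using Cond.prems(3) by (auto elim: env_spread_mono)
  ultimately show ?case
    using Cond.IH[of e Z e'] Cond.prems(1,2,4,6) g by (auto split: if_splits)
next
  case (Forall v r R)
  note bound = Forall.prems(5)
  have r: "val A' e' r = T (val A e r)"
  proof (rule val_spread[OF st, where Z = Z])
    show "2 * (card Z + k * (trm_weight r + 3)) < card X" using bound by (simp add: algebra_simps)
  qed (use Forall.prems in \<open>auto elim: env_spread_mono\<close>)
  obtain a where a: "a |\<in>| elems (val A e r)" and D: "(f, xs, b) \<in> Den A (e(v \<mapsto> a)) R"
    using Forall.prems(6) by auto
  have aS: "a \<in> S" using symm_elems[OF _ a] Forall.prems(2) by (auto intro: values_in_trm_val)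
  have "card (Z \<union> supp X a) \<le> card Z + k"
    using card_Un_le[of Z "supp X a"] card_supp[OF aS] by linarith
  then have bound': "2 * (card (Z \<union> supp X a) + k * (rule_weight R + 3)) < card X"
    using bound by (simp add: algebra_simps)
  have wf: "wf_rule fmempty D R" and vals: "values_in_rule A S (e(v \<mapsto> a)) R" and ZX: "Z \<union> supp X a \<subseteq> X"
    using Forall.prems(1,2,4) a by simp_all
  have env: "env_spread (Z \<union> supp X a) (free_vars_rule R) (e(v \<mapsto> a)) (e'(v \<mapsto> T a))"
    by (rule env_spread_upd[OF Forall.prems(3) _ aS]) auto
  have "set xs \<subseteq> S \<and> b \<in> S \<and> (f, map T xs, T b) \<in> Den A' (e'(v \<mapsto> T a)) R"
    by (rule Forall.IH[OF wf vals env ZX bound' D])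
  then show ?case using elems_spreadI[OF a] r by auto
qed simp

text \<open>The converse of \<open>Den_spread\<close> holds up to automorphisms of \<open>A'\<close>
  fixing \<open>Z\<close>. Each enclosing \<open>Forall\<close> contributes one move, which carries
  the value of its variable to an embedded object.\<close>

lemma Den_spread_move:
  assumes st: "spread_state D A A'"
  shows "wf_rule fmempty D R \<Longrightarrow> values_in_rule A S e R \<Longrightarrow> env_spread Z (free_vars_rule R) e e' \<Longrightarrow>
    Z \<subseteq> X \<Longrightarrow> 2 * (card Z + k * (rule_weight R + 3)) < card X \<Longrightarrow> u \<in> Den A' e' R \<Longrightarrow>
    \<exists>p w. p permutes (Y - Z) \<and> w \<in> Den A e R \<and> map_update (map_obj p) u = map_update T w"
proof (induction R arbitrary: e e' Z u)
  case (Update h ts t)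
  have "val A' e' s = T (val A e s)" if s: "s \<in> set (t # ts)" for s
  proof (rule val_spread[OF st, where Z = Z])
    have "trm_weight s \<le> rule_weight (Update h ts t)" using s trm_weight_arg[of s ts] by auto
    then have "2 * (card Z + k * (trm_weight s + 3)) \<le> 2 * (card Z + k * (rule_weight (Update h ts t) + 3))"
      by (intro mult_le_mono add_le_mono) auto
    then show "2 * (card Z + k * (trm_weight s + 3)) < card X"
      using Update.prems(5) by (rule le_less_trans)
  qed (use Update.prems s in \<open>auto elim: env_spread_mono\<close>)
  then have "u = map_update T (h, map (val A e) ts, val A e t)" using Update.prems(6) by simp
  then show ?case
    by (intro exI[of _ id] exI[of _ "(h, map (val A e) ts, val A e t)"])
       (simp add: permutes_id[unfolded id_def] obj.map_ident)
next
  case (Cond g R1 R2)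
  note bound = Cond.prems(5)
  have "val A' e' g = T (val A e g)"
  proof (rule val_spread[OF st, where Z = Z])
    show "2 * (card Z + k * (trm_weight g + 3)) < card X" using bound by (simp add: algebra_simps)
  qed (use Cond.prems in \<open>auto elim: env_spread_mono\<close>)
  moreover have "val A e g \<in> S" using Cond.prems(2) by (auto intro: values_in_trm_val)
  ultimately have g: "val A' e' g = one_obj \<longleftrightarrow> val A e g = one_obj" by (simp add: spread_eq_one_iff)
  have "2 * (card Z + k * (rule_weight R1 + 3)) < card X" "2 * (card Z + k * (rule_weight R2 + 3)) < card X"
    using bound by (simp_all add: algebra_simps)
  moreover have "env_spread Z (free_vars_rule R1) e e'" "env_spread Z (free_vars_rule R2) e e'"
    using Cond.prems(3) by (auto elim: env_spread_mono)
  ultimately show ?case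
    using Cond.IH[of e Z e' u] Cond.prems(1,2,4,6) g by (auto split: if_splits)
next
  case (Forall v r R)
  note bound = Forall.prems(5)
  have r: "val A' e' r = T (val A e r)"
  proof (rule val_spread[OF st, where Z = Z])
    show "2 * (card Z + k * (trm_weight r + 3)) < card X" using bound by (simp add: algebra_simps)
  qed (use Forall.prems in \<open>auto elim: env_spread_mono\<close>)
  have valr: "val A e r \<in> S" using Forall.prems(2) by (auto intro: values_in_trm_val)
  have cardZ: "2 * (card Z + k) < card X" using bound by (simp add: algebra_simps)
  have suppr: "supp X (val A e r) \<subseteq> Z"
    using Forall.prems cardZ by (intro supp_val_subset[OF st, where e' = e']) (auto elim: env_spread_mono)
  obtain c where c: "c |\<in>| elems (T (val A e r))" "u \<in> Den A' (e'(v \<mapsto> c)) R"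
    using Forall.prems(6) unfolding Den.simps r by blast
  obtain p a where p: "p permutes (Y - Z)" and a: "a |\<in>| elems (val A e r)" "map_obj p c = T a"
    using cardZ by (auto intro: elems_spread_move[OF valr c(1) suppr Forall.prems(4)])
  have aS: "a \<in> S" using symm_elems[OF valr a(1)] .
  have "env_spread Z (free_vars_rule R - {v}) e e'"
    using Forall.prems(3) by (rule env_spread_mono) auto
  then have "env_maps (map_obj p) (free_vars_rule R - {v}) e' e'" using p by (rule env_spread_fixed)
  from env_maps_upd[OF this, of c]
  have "env_maps (map_obj p) (free_vars_rule R) (e'(v \<mapsto> c)) (e'(v \<mapsto> T a))" unfolding a(2) .
  then have "Den A' (e'(v \<mapsto> T a)) R = map_update (map_obj p) ` Den A' (e'(v \<mapsto> c)) R"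
    using Forall.prems(1) by (intro Den_iso[OF permutes_bij[OF p] spread_state_iso(2)[OF st p]]) auto
  then have pu: "map_update (map_obj p) u \<in> Den A' (e'(v \<mapsto> T a)) R" using c(2) by blast
  have "card (Z \<union> supp X a) \<le> card Z + k"
    using card_Un_le[of Z "supp X a"] card_supp[OF aS] by linarith
  then have bound': "2 * (card (Z \<union> supp X a) + k * (rule_weight R + 3)) < card X"
    using bound by (simp add: algebra_simps)
  have wf: "wf_rule fmempty D R" and vals: "values_in_rule A S (e(v \<mapsto> a)) R" and ZX: "Z \<union> supp X a \<subseteq> X"
    using Forall.prems(1,2,4) a(1) by simp_all
  have env: "env_spread (Z \<union> supp X a) (free_vars_rule R) (e(v \<mapsto> a)) (e'(v \<mapsto> T a))"
    by (rule env_spread_upd[OF Forall.prems(3) _ aS]) auto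
  obtain q w where q: "q permutes (Y - (Z \<union> supp X a))" and w: "w \<in> Den A (e(v \<mapsto> a)) R"
    "map_update (map_obj q) (map_update (map_obj p) u) = map_update T w"
    using Forall.IH[OF wf vals env ZX bound' pu] by blast
  have "q permutes (Y - Z)" using q by (rule permutes_subset) auto
  then have "q \<circ> p permutes (Y - Z)" using p by (intro permutes_compose)
  moreover have "map_update (map_obj (q \<circ> p)) u = map_update T w"
    using w(2) by (cases u) (simp add: map_obj_comp comp_def)
  moreover have "w \<in> Den A e (Forall v r R)" using w(1) a(1) by auto
  ultimately show ?case by blast
qed simp

text \<open>The term \<open>k * (m + 1)\<close> reserves room for the supports of at most
  \<open>m\<close> arguments and one value of an update, which have to be held fixed while a second
  update is moved.\<close>

lemma sequel_spread:
  assumes st: "spread_state D A A'" and R: "is_program fmempty D R" and vals: "values_in_rule A S Map.empty R"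
    and arity: "\<And>f n b. fmlookup D f = Some (n, b) \<Longrightarrow> n \<le> m"
    and large: "2 * (k * (m + 1) + k * (rule_weight R + 3)) < card X"
    and sym: "symmetric_state D (sequel R A)" "symmetric_state D (sequel R A')"
  shows "spread_state D (sequel R A) (sequel R A')"
proof -
  let ?U = "Den A Map.empty R" and ?U' = "Den A' Map.empty R"
  have wf: "wf_rule fmempty D R" and closed: "free_vars_rule R = {}" using R by (auto simp: is_program_def)
  have env: "env_spread Z (free_vars_rule R) Map.empty Map.empty" for Z
    by (simp add: closed env_spread_def)
  have bound: "2 * (card Z + k * (rule_weight R + 3)) < card X" if "card Z \<le> k * (m + 1)" for Z :: "'a set"
  proof -
    have "2 * (card Z + k * (rule_weight R + 3)) \<le> 2 * (k * (m + 1) + k * (rule_weight R + 3))"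
      using that by (intro mult_le_mono add_le_mono) auto
    then show ?thesis using large by (rule le_less_trans)
  qed
  have forth: "set xs \<subseteq> S \<and> b \<in> S \<and> (f, map T xs, T b) \<in> ?U'" if "(f, xs, b) \<in> ?U" for f xs b
    using Den_spread[OF st wf vals env[of "{}"] empty_subsetI bound that] by simp
  have move: "\<exists>p xs b. p permutes (Y - Z) \<and> (f, xs, b) \<in> ?U \<and> map (map_obj p) ys = map T xs \<and> map_obj p c = T b"
    if u: "(f, ys, c) \<in> ?U'" and Z: "Z \<subseteq> X" "card Z \<le> k * (m + 1)" for f ys c Z
  proof -
    obtain p w where "p permutes (Y - Z)" "w \<in> ?U" "map_update (map_obj p) (f, ys, c) = map_update T w"
      using Den_spread_move[OF st wf vals env Z(1) bound[OF Z(2)] u] by blast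
    then show ?thesis by (cases w) auto
  qed
  have invariant: "(f, map (map_obj p) ys, map_obj p c) \<in> ?U'" if "p permutes (Y - Z)" "(f, ys, c) \<in> ?U'" for p Z f ys c
  proof -
    have "?U' = map_update (map_obj p) ` ?U'"
      using that(1) by (intro Den_iso[OF permutes_bij spread_state_iso(2)[OF st] wf])
        (auto simp: closed env_maps_def)
    moreover have "map_update (map_obj p) (f, ys, c) \<in> map_update (map_obj p) ` ?U'"
      using that(2) by (rule imageI)
    ultimately show ?thesis by simp
  qed
  have len: "length xs \<le> m" if "(f, xs, b) \<in> ?U" for f xs b
  proof -
    have "is_state fmempty D A" using st by (simp add: spread_state_def symmetric_state_def)
    then have "finite ?U \<and> (\<forall>(f, xs, y)\<in>?U. \<exists>b. fmlookup D f = Some (length xs, b) \<and>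
       set xs \<subseteq> base_set A \<and> y \<in> base_set A \<and> (b \<longrightarrow> is_boolean y))"
      by (rule Den_wf[OF _ wf]) (simp add: closed)
    from bspec[OF conjunct2[OF this] that] show ?thesis using arity by auto
  qed
  have clash: "clash ?U' \<longleftrightarrow> clash ?U"
  proof
    assume "clash ?U"
    then obtain f xs b c where "(f, xs, b) \<in> ?U" "(f, xs, c) \<in> ?U" "b \<noteq> c" unfolding clash_def by blast
    then have "(f, map T xs, T b) \<in> ?U'" "(f, map T xs, T c) \<in> ?U'" "T b \<noteq> T c"
      using forth spread_eq_iff by blast+
    then show "clash ?U'" unfolding clash_def by blast
  next
    assume "clash ?U'"
    then obtain f ys c c' where c: "(f, ys, c) \<in> ?U'" "(f, ys, c') \<in> ?U'" "c \<noteq> c'" unfolding clash_def by blast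
    obtain p xs b where p: "p permutes (Y - {})" and b: "(f, xs, b) \<in> ?U"
      "map (map_obj p) ys = map T xs" "map_obj p c = T b"
      using move[OF c(1) empty_subsetI] by auto
    have S: "set xs \<subseteq> S" "b \<in> S" using forth[OF b(1)] by auto
    \<comment> \<open>After the first update has been moved to an embedded one, the second is moved
      with the location and the value of the first held fixed. It lands at the same location, and
      its value still differs because permutations act injectively.\<close>
    define Z where "Z = (\<Union>x\<in>set xs. supp X x) \<union> supp X b"
    have "k * length xs \<le> k * m" using len[OF b(1)] by (rule mult_le_mono2)
    then have "card Z \<le> k * m + k"
      unfolding Z_def using card_Un_le[of "\<Union>x\<in>set xs. supp X x" "supp X b"]
        card_supp_list[OF S(1)] card_supp[OF S(2)] by linarith
    then have "card Z \<le> k * (m + 1)" by simp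
    moreover have "Z \<subseteq> X" by (auto simp: Z_def supp_def)
    ultimately obtain q xs' b' where q: "q permutes (Y - Z)" and b': "(f, xs', b') \<in> ?U"
      "map (map_obj q) (map (map_obj p) ys) = map T xs'" "map_obj q (map_obj p c') = T b'"
      using move[OF invariant[OF p c(2)]] by blast
    have "map T xs' = map T xs"
      using b'(2) spread_list_fixed[OF q S(1)] b(2) by (auto simp: Z_def)
    then have "xs' = xs" using spread_list_inj forth[OF b'(1)] S(1) by blast
    moreover have "b' \<noteq> b"
    proof
      assume "b' = b"
      then have "map_obj q (map_obj p c') = map_obj q (map_obj p c)"
        using b'(3) b(3) spread_fixed[OF q S(2)] by (simp add: Z_def)
      then have "c' = c"
        by (simp only: map_obj_inject[OF permutes_bij[OF p]] map_obj_inject[OF permutes_bij[OF q]])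
      then show False using c(3) by simp
    qed
    ultimately show "clash ?U" using b(1) b'(1) unfolding clash_def by blast
  qed
  have "dyn (sequel R A') f (map T xs) = T (dyn (sequel R A) f xs)"
    if f: "fmlookup D f = Some (length xs, b)" and S: "set xs \<subseteq> S" for f xs b
  proof (cases "clash ?U")
    case True
    then show ?thesis using st f S clash by (auto simp: sequel_clash spread_state_def)
  next
    case False
    then have False': "\<not> clash ?U'" using clash by blast
    show ?thesis
    proof (cases "\<exists>c. (f, xs, c) \<in> ?U")
      case True
      then obtain c where c: "(f, xs, c) \<in> ?U" by blast
      show ?thesis
        using dyn_sequel_update[OF False c] dyn_sequel_update[OF False'] forth[OF c] by blast
    next
      case no: False
      have "(f, map T xs, c) \<notin> ?U'" for c
      proof
        assume c: "(f, map T xs, c) \<in> ?U'"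
        \<comment> \<open>An update over \<open>Y\<close> at an embedded location can be moved to an
          embedded one without disturbing the location, and so would come from an update of
          \<open>xs\<close> over \<open>X\<close>.\<close>
        let ?Z = "\<Union>x\<in>set xs. supp X x"
        have "k * length xs \<le> k * m" using arity[OF f] by (rule mult_le_mono2)
        with card_supp_list[OF S] have "card ?Z \<le> k * m" by (rule le_trans)
        then have "card ?Z \<le> k * (m + 1)" by simp
        moreover have "?Z \<subseteq> X" by (auto simp: supp_def)
        ultimately obtain q xs' b' where q: "q permutes (Y - ?Z)" and b': "(f, xs', b') \<in> ?U"
          "map (map_obj q) (map T xs) = map T xs'"
          using move[OF c] by blast
        have "map T xs' = map T xs" using b'(2) spread_list_fixed[OF q S] by simp
        then have "xs' = xs" using spread_list_inj forth[OF b'(1)] S by blast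
        then show False using no b'(1) by blast
      qed
      then show ?thesis using no st f S by (simp add: dyn_sequel_other spread_state_def)
    qed
  qed
  then show ?thesis using st sym by (simp add: spread_state_def)
qed

text \<open>The embedding fixes \<open>one_obj\<close> and is injective on \<open>S\<close>, so
  \<open>Halt\<close>, whose value is in \<open>S\<close>, holds on both sides at the same
  steps.\<close>

lemma run_spread:
  assumes I: "I \<in> naked_sets" "I' \<in> naked_sets" "fset (universe I) = X" "fset (universe I') = Y"
    and R: "is_program fmempty D R"
    and arity: "\<And>f n b. fmlookup D f = Some (n, b) \<Longrightarrow> n \<le> m"
    and large: "2 * (k * (m + 1) + k * (rule_weight R + 3)) < card X"
    and vals: "\<And>i A. i < l \<Longrightarrow> run R I i = Some A \<Longrightarrow> values_in_rule A S Map.empty R"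
    and Halt: "\<And>i A. i \<le> l \<Longrightarrow> run R I i = Some A \<Longrightarrow> dyn A Halt [] \<in> S"
  shows "i \<le> l \<Longrightarrow> run R I i = Some A \<Longrightarrow> \<exists>A'. run R I' i = Some A' \<and> spread_state D A A'"
proof (induction i arbitrary: A)
  have sym: "symmetric_state D A" if "J \<in> naked_sets" "run R J i = Some A" for J :: "'a istruct" and i A
    using that run_is_state[OF _ R that(2)] run_automorphism[OF R that] run_input[OF that(2)]
    by (simp add: symmetric_state_def naked_sets_def)
  {
    case 0
    have A: "A = initial_state I" using 0 by simp
    have "symmetric_state D (initial_state I')" "symmetric_state D (initial_state I)"
      using sym[OF I(2), of 0] sym[OF I(1), of 0] by simp_all
    then have "spread_state D A (initial_state I')"
      unfolding A spread_state_def using I(3,4) by (simp add: initial_state_def)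
    then show ?case by simp
  next
    case (Suc i)
    obtain B where B: "run R I i = Some B" "\<not> halted B" "A = sequel R B"
      using Suc.prems(2) by (auto split: option.splits if_splits)
    obtain B' where B': "run R I' i = Some B'" "spread_state D B B'" using Suc B(1) by auto
    have "fmlookup D Halt = Some (0, True)" using R by (simp add: is_program_def is_dyn_voc_def)
    then have "dyn B' Halt [] = T (dyn B Halt [])" using spread_state_dyn[OF B'(2), of Halt "[]"] by simp
    then have "\<not> halted B'" using B(2) Halt[OF _ B(1)] Suc.prems(1) by (simp add: halted_def spread_eq_one_iff)
    then have run': "run R I' (Suc i) = Some (sequel R B')" using B'(1) by simp
    have "spread_state D (sequel R B) (sequel R B')"
      using Suc.prems(1) B(1) sym[OF I(1) Suc.prems(2)] sym[OF I(2) run'] unfolding B(3)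
      by (intro sequel_spread[OF B'(2) R vals arity large]) auto
    then show ?case using run' B(3) by blast
  }
qed

end

section \<open>Counting bounds and active objects\<close>

lemma TC_self: "x \<in> TC x"
  by (simp add: TC_def)

lemma TC_closed: "y \<in> TC x \<Longrightarrow> z |\<in>| elems y \<Longrightarrow> z \<in> TC x"
  unfolding TC_def transitive_set_def by blast

lemma TC_least: "transitive_set Z \<Longrightarrow> x \<in> Z \<Longrightarrow> TC x \<subseteq> Z"
  unfolding TC_def by blast

lemma TC_map_obj: "y \<in> TC x \<Longrightarrow> map_obj p y \<in> TC (map_obj p x)"
proof -
  have "TC x \<subseteq> {y. map_obj p y \<in> TC (map_obj p x)}"
  proof (rule TC_least)
    show "transitive_set {y. map_obj p y \<in> TC (map_obj p x)}"
      unfolding transitive_set_def using TC_closed by (fastforce simp: fimageI)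
  qed (simp add: TC_self)
  then show "y \<in> TC x \<Longrightarrow> map_obj p y \<in> TC (map_obj p x)" by blast
qed

lemma critical_cases:
  assumes "x \<in> critical D A"
  obtains a where "x = Atom a" "a |\<in>| universe (input A)"
  | "x = zero_obj" | "x = one_obj"
  | f xs b where "fmlookup D f = Some (length xs, b)" "set xs \<subseteq> base_set A" "x = dyn A f xs"
  | f xs b where "fmlookup D f = Some (length xs, b)" "set xs \<subseteq> base_set A"
      "dyn A f xs \<noteq> zero_obj" "x \<in> set xs"
  using assms unfolding critical_def by blast

lemma critical_base_set:
  assumes "is_state V D A" "x \<in> critical D A"
  shows "x \<in> base_set A"
  using assms(2)
  by (cases rule: critical_cases) (auto simp: base_set_def intro: HF.intros dyn_in_base_set[OF assms(1), unfolded base_set_def])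

lemma critical_map_obj:
  assumes A: "symmetric_state D A" and p: "p permutes fset (universe (input A))" and x: "x \<in> critical D A"
  shows "map_obj p x \<in> critical D A"
proof -
  have iso: "dyn A f (map (map_obj p) xs) = map_obj p (dyn A f xs)" for f xs
    using symmetric_state_iso[OF A p] by (simp add: state_iso_def)
  have base: "map_obj p y \<in> base_set A" if "y \<in> base_set A" for y
    using that permutes_image[OF p] unfolding base_set_def by (intro map_obj_HF) auto
  from x show ?thesis
  proof (cases rule: critical_cases)
    case (1 a)
    then show ?thesis using permutes_in_image[OF p, of a] by (auto simp: critical_def)
  next
    case (4 f xs b)
    then have "fmlookup D f = Some (length (map (map_obj p) xs), b)" "set (map (map_obj p) xs) \<subseteq> base_set A"
      "map_obj p x = dyn A f (map (map_obj p) xs)"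
      using base by (auto simp: iso)
    then show ?thesis unfolding critical_def by blast
  next
    case (5 f xs b)
    then have "fmlookup D f = Some (length (map (map_obj p) xs), b)" "set (map (map_obj p) xs) \<subseteq> base_set A"
      "dyn A f (map (map_obj p) xs) \<noteq> zero_obj" "map_obj p x \<in> set (map (map_obj p) xs)"
      using base by (auto simp: iso)
    then show ?thesis unfolding critical_def by blast
  qed (simp_all add: critical_def)
qed

text \<open>The link to the resource bound: the active objects are the initial family whose closure
  captures the values of the next step.\<close>

lemma ample_active:
  assumes A: "symmetric_state D A" and fin: "finite (active D A)"
  shows "ample A (active D A)"
proof -
  have st: "is_state fmempty D A" using A by (simp add: symmetric_state_def)
  have crit: "x \<in> active D A" if "x \<in> critical D A" for x
    using that TC_self by (auto simp: active_def)
  have "transitive_set (base_set A)"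
    unfolding transitive_set_def base_set_def using elems_in_HF by blast
  then have "active D A \<subseteq> base_set A"
    unfolding active_def using TC_least critical_base_set[OF st] by blast
  moreover have "transitive_set (active D A)"
    unfolding transitive_set_def active_def using TC_closed by blast
  moreover have "map_obj p x \<in> active D A" if "p permutes fset (universe (input A))" "x \<in> active D A" for p x
    using that(2) TC_map_obj critical_map_obj[OF A that(1)] unfolding active_def by blast
  moreover have "dyn A f xs \<in> active D A" for f xs
  proof (cases "dyn A f xs = zero_obj")
    case True
    then show ?thesis using crit by (simp add: critical_def)
  next
    case False
    then have "(xs, dyn A f xs) \<in> Extent A f" by (simp add: Extent_def)
    then obtain b where "fmlookup D f = Some (length xs, b)" "set xs \<subseteq> base_set A"
      using st unfolding is_state_def by blast
    then have "dyn A f xs \<in> critical D A" unfolding critical_def by blast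
    then show ?thesis by (rule crit)
  qed
  moreover have "Atom ` fset (universe (input A)) \<subseteq> active D A" "zero_obj \<in> active D A" "one_obj \<in> active D A"
    using crit by (auto simp: critical_def)
  ultimately show ?thesis using fin by (simp add: ample_def)
qed

section \<open>Polynomials compared with binomial coefficients and exponentials\<close>

lemma int_poly_bound: "\<exists>c. \<forall>n\<ge>c. \<bar>poly p (int n)\<bar> \<le> int n ^ c"
proof (induction p)
  case 0
  show ?case by auto
next
  case (pCons a p)
  then obtain c where c: "\<And>n. c \<le> n \<Longrightarrow> \<bar>poly p (int n)\<bar> \<le> int n ^ c" by blast
  \<comment> \<open>One number serves as threshold and exponent: it exceeds \<open>c\<close>, the
    new coefficient and 1, and adds one power for the factor \<open>n\<close> and one for the factor
    2.\<close>
  let ?c = "c + nat \<bar>a\<bar> + 2"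
  have "\<bar>poly (pCons a p) (int n)\<bar> \<le> int n ^ ?c" if n: "?c \<le> n" for n
  proof -
    have "\<bar>poly (pCons a p) (int n)\<bar> \<le> \<bar>a\<bar> + \<bar>int n * poly p (int n)\<bar>" by simp
    also have "\<dots> = \<bar>a\<bar> + int n * \<bar>poly p (int n)\<bar>" by (simp add: abs_mult)
    also have "\<dots> \<le> int n + int n * int n ^ c"
      using n c[of n] by (intro add_mono mult_left_mono) auto
    also have "\<dots> \<le> int n ^ (c + 1) + int n ^ (c + 1)"
    proof -
      have "int n ^ 1 \<le> int n ^ (c + 1)" using n by (intro power_increasing) auto
      then show ?thesis by simp
    qed
    also have "\<dots> = 2 * int n ^ (c + 1)" by simp
    also have "\<dots> \<le> int n * int n ^ (c + 1)" using n by (intro mult_right_mono) auto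
    also have "\<dots> = int n ^ (c + 2)" by simp
    also have "\<dots> \<le> int n ^ ?c" using n by (intro power_increasing) auto
    finally show ?thesis .
  qed
  then show ?case by blast
qed

lemma power_le_choose:
  assumes "k \<le> n" "1 \<le> k"
  shows "n ^ k \<le> k ^ k * (n choose k)"
proof -
  have "(real n / real k) ^ k \<le> real (n choose k)" using assms(1) by (rule binomial_ge_n_over_k_pow_k)
  then have "real n ^ k \<le> real k ^ k * real (n choose k)"
    using assms(2) by (simp add: power_divide field_simps)
  then have "real (n ^ k) \<le> real (k ^ k * (n choose k))" by simp
  then show ?thesis by (simp only: of_nat_le_iff)
qed

text \<open>The lower bound \<open>(n / (k + 1)) ^ (k + 1)\<close> for the binomial coefficient has
  one more factor \<open>n\<close>, which beats the constant.\<close>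

lemma power_less_choose:
  assumes n: "(k + 1) ^ (k + 1) < n"
  shows "n ^ k < n choose (k + 1)"
proof -
  have "k + 1 \<le> (k + 1) ^ (k + 1)" by (rule self_le_power) auto
  then have "k + 1 \<le> n" using n by simp
  have "(k + 1) ^ (k + 1) * n ^ k < n * n ^ k" using n by (intro mult_strict_right_mono) auto
  also have "\<dots> = n ^ (k + 1)" by simp
  also have "\<dots> \<le> (k + 1) ^ (k + 1) * (n choose (k + 1))"
    using \<open>k + 1 \<le> n\<close> by (rule power_le_choose) simp
  finally show ?thesis by (simp only: mult_less_cancel1)
qed

text \<open>Here \<open>2 ^ j\<close> is at least \<open>j choose (k + 1)\<close>, of order
  \<open>j ^ (k + 1)\<close>, while \<open>n\<close> is at most \<open>2 * K * j\<close>. The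
  summand \<open>k + 3\<close> in the threshold yields \<open>k + 1 \<le> j\<close>.\<close>

lemma power_less_exp:
  fixes k :: nat
  defines "K \<equiv> 2 * (k + 2)"
  assumes n: "K * ((2 * K) ^ k * (k + 1) ^ (k + 1) + k + 3) < n"
  shows "n ^ k < 2 ^ ((n - 1) div K)"
proof -
  define j where "j = (n - 1) div K"
  have K: "0 < K" by (simp add: K_def)
  have "(2 * K) ^ k * (k + 1) ^ (k + 1) + k + 3 \<le> j"
    unfolding j_def using n K by (simp add: less_eq_div_iff_mult_less_eq mult.commute)
  then have j: "(2 * K) ^ k * (k + 1) ^ (k + 1) < j" "k + 1 \<le> j" by simp_all
  have "n - 1 < K * (j + 1)" unfolding j_def using K by (metis Suc_eq_plus1 dividend_less_times_div mult_Suc_right)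
  then have "n \<le> K * (j + 1)" by simp
  also have "\<dots> \<le> K * (2 * j)" using j(2) by (intro mult_le_mono2) simp
  finally have "n ^ k \<le> (2 * K * j) ^ k" by (intro power_mono) (simp_all add: ac_simps)
  then have "(k + 1) ^ (k + 1) * n ^ k \<le> (k + 1) ^ (k + 1) * (2 * K * j) ^ k" by (rule mult_le_mono2)
  also have "\<dots> = ((2 * K) ^ k * (k + 1) ^ (k + 1)) * j ^ k" by (simp add: power_mult_distrib)
  also have "\<dots> < j * j ^ k" using j by (intro mult_strict_right_mono) auto
  also have "\<dots> = j ^ (k + 1)" by simp
  also have "\<dots> \<le> (k + 1) ^ (k + 1) * (j choose (k + 1))" using j(2) by (rule power_le_choose) simp
  also have "\<dots> \<le> (k + 1) ^ (k + 1) * 2 ^ j" by (intro mult_le_mono2 binomial_le_pow2)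
  finally show ?thesis unfolding j_def by (simp only: mult_less_cancel1)
qed

lemma eventually_counting_bounds:
  "\<exists>N. \<forall>n\<ge>N. n ^ k < n choose (k + 1) \<and> n ^ k < 2 ^ ((n - 1) div (2 * (k + 2)))"
proof -
  define K where "K = 2 * (k + 2)"
  let ?N = "(k + 1) ^ (k + 1) + K * ((2 * K) ^ k * (k + 1) ^ (k + 1) + k + 3) + 1"
  have "n ^ k < n choose (k + 1) \<and> n ^ k < 2 ^ ((n - 1) div (2 * (k + 2)))" if "?N \<le> n" for n
    using that power_less_choose[of k n] power_less_exp[of k n] unfolding K_def by linarith
  then show ?thesis by blast
qed

section \<open>Large naked sets are indistinguishable\<close>

text \<open>A program has no free variables, so the empty assignment qualifies; one exponent serves
  all inputs and all steps.\<close>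

lemma closed_set_of_run:
  assumes P: "is_program fmempty D R"
  obtains d where "\<And>(I :: 'a istruct) i A. I \<in> naked_sets \<Longrightarrow> run R I i = Some A \<Longrightarrow> finite (active D A) \<Longrightarrow>
    \<exists>C. ample A C \<and> card C \<le> card (active D A) ^ d \<and> values_in_rule A C Map.empty R"
proof -
  have "wf_rule fmempty D R" "free_vars_rule R = {}" using P by (simp_all add: is_program_def)
  then obtain d where d: "\<And>(A :: 'a state) B. symmetric_state D A \<Longrightarrow> ample A B \<Longrightarrow>
    \<exists>C. ample A C \<and> B \<subseteq> C \<and> card C \<le> card B ^ d \<and> (\<forall>e. env_in B {} e \<longrightarrow> values_in_rule A C e R)"
    using poly_closed_rule[of D R] unfolding poly_closed_def by metis
  show thesis
  proof
    fix I :: "'a istruct" and i A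
    assume run: "I \<in> naked_sets" "run R I i = Some A" and fin: "finite (active D A)"
    have A: "symmetric_state D A"
      using run_is_state[OF _ P run(2)] run_automorphism[OF P run] run_input[OF run(2)] run(1)
      by (simp add: symmetric_state_def naked_sets_def)
    obtain C where "ample A C" "card C \<le> card (active D A) ^ d" "\<forall>e. env_in (active D A) {} e \<longrightarrow> values_in_rule A C e R"
      using d[OF A ample_active[OF A fin]] by blast
    then show "\<exists>C. ample A C \<and> card C \<le> card (active D A) ^ d \<and> values_in_rule A C Map.empty R"
      by (auto simp: env_in_def)
  qed
qed

lemma run_extends_to_superset:
  assumes P: "is_ptime_program fmempty P"
  obtains N where "\<And>(I :: 'a istruct) I' l A. I \<in> naked_sets \<Longrightarrow> I' \<in> naked_sets \<Longrightarrow>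
    fset (universe I) \<subseteq> fset (universe I') \<Longrightarrow> N \<le> struct_size I \<Longrightarrow> within_bounds P I l \<Longrightarrow>
    run (program P) I l = Some A \<Longrightarrow>
    \<exists>A'. run (program P) I' l = Some A' \<and> (halted A' \<longleftrightarrow> halted A) \<and> (output_true A' \<longleftrightarrow> output_true A)"
proof -
  define D R where "D = dynamics P" and "R = program P"
  have R: "is_program fmempty D R" using P by (simp add: is_ptime_program_def D_def R_def)
  obtain d where d: "\<And>(I :: 'a istruct) i A. I \<in> naked_sets \<Longrightarrow> run R I i = Some A \<Longrightarrow> finite (active D A) \<Longrightarrow>
    \<exists>C. ample A C \<and> card C \<le> card (active D A) ^ d \<and> values_in_rule A C Map.empty R"
    using closed_set_of_run[OF R] by blast
  obtain c where c: "\<And>n. c \<le> n \<Longrightarrow> \<bar>poly (active_bound P) (int n)\<bar> \<le> int n ^ c"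
    using int_poly_bound by blast
  \<comment> \<open>At most \<open>n ^ c\<close> active objects generate a closed family of at most
    \<open>n ^ (c * d)\<close> objects; adding 1 makes \<open>k\<close> positive.\<close>
  define k where "k = c * d + 1"
  obtain N0 where N0: "\<And>n. N0 \<le> n \<Longrightarrow> n ^ k < n choose (k + 1) \<and> n ^ k < 2 ^ ((n - 1) div (2 * (k + 2)))"
    using eventually_counting_bounds by blast
  \<comment> \<open>The sum of all arities bounds each of them.\<close>
  define m where "m = (\<Sum>f\<in>fmdom' D. fst (the (fmlookup D f)))"
  have arity: "n \<le> m" if "fmlookup D f = Some (n, b)" for f n b
    unfolding m_def using that member_le_sum[of f "fmdom' D" "\<lambda>f. fst (the (fmlookup D f))"]
    by (simp add: fmlookup_dom'_iff)
  define N where "N = N0 + c + 3 + 2 * (k * (m + 1) + k * (rule_weight R + 3))"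
  show thesis
  proof (rule that)
    fix I I' :: "'a istruct" and l A
    assume I: "I \<in> naked_sets" "I' \<in> naked_sets" "fset (universe I) \<subseteq> fset (universe I')"
      and N: "N \<le> struct_size I" and l: "within_bounds P I l" and A: "run (program P) I l = Some A"
    let ?X = "fset (universe I)"
    define n where "n = card ?X"
    have n: "struct_size I = n" by (simp add: struct_size_def n_def fcard.rep_eq)
    have kX: "2 * (k * (m + 1) + k * (rule_weight R + 3)) < n" "3 \<le> n" "N0 \<le> n" "c \<le> n"
      using N by (simp_all add: n N_def)
    interpret spreading ?X "fset (universe I')" k
    proof
      show "1 \<le> k" by (simp add: k_def)
      show "2 * k < card ?X" using kX(1) by (simp add: n_def algebra_simps)
    qed (use I(3) in simp_all)
    \<comment> \<open>Within the bounds, all values met in a step lie in a family too small to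
      contain an object outside \<open>S\<close>.\<close>
    have good: "values_in_rule B S Map.empty R \<and> dyn B Halt [] \<in> S \<and> dyn B Output [] \<in> S"
      if i: "i \<le> l" and B: "run R I i = Some B" for i B
    proof -
      have sub: "active D B \<subseteq> active_upto D R I l" using i B by (auto simp: active_upto_def)
      have fin: "finite (active_upto D R I l)" using l by (simp add: within_bounds_def D_def R_def)
      then have finB: "finite (active D B)" using sub by (rule finite_subset[rotated])
      obtain C where C: "ample B C" "card C \<le> card (active D B) ^ d" "values_in_rule B C Map.empty R"
        using d[OF I(1) B finB] by blast
      have "int (card (active_upto D R I l)) \<le> poly (active_bound P) (int n)"
        using l by (simp add: within_bounds_def D_def R_def n)
      then have "int (card (active D B)) \<le> int n ^ c"
        using c[OF kX(4)] card_mono[OF fin sub] by linarith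
      then have "card (active D B) \<le> n ^ c" by (simp only: of_nat_power[symmetric] of_nat_le_iff)
      then have "card C \<le> (n ^ c) ^ d" using C(2) power_mono le_trans by blast
      also have "\<dots> = n ^ (c * d)" by (simp add: power_mult)
      also have "\<dots> \<le> n ^ k" using kX(2) by (intro power_increasing) (auto simp: k_def)
      finally have small: "card C \<le> n ^ k" .
      have X: "fset (universe (input B)) = ?X" using run_input[OF B] by simp
      have ample: "finite C" "transitive_set C" "\<And>p x. p permutes ?X \<Longrightarrow> x \<in> C \<Longrightarrow> map_obj p x \<in> C"
        "C \<subseteq> HF ?X" "\<And>f xs. dyn B f xs \<in> C"
        using C(1) unfolding ample_def base_set_def X by auto
      have "x \<in> S" if "x \<in> C" for x
      proof (rule small_invariant_set_symm[OF _ _ _ ample(1,2,3)])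
        show "card C < card ?X choose (k + 1)" "card C < 2 ^ ((card ?X - 1) div (2 * (k + 2)))"
          using small N0[OF kX(3)] by (simp_all only: n_def[symmetric]) linarith+
      qed (use that ample(4) kX(2) in \<open>auto simp: n_def k_def\<close>)
      then have "C \<subseteq> S" by blast
      then show ?thesis using values_in_rule_mono[OF C(3)] ample(5) by blast
    qed
    have "\<exists>A'. run R I' l = Some A' \<and> spread_state D A A'"
    proof (rule run_spread[OF I(1,2) refl refl R arity _ _ _ le_refl])
      show "2 * (k * (m + 1) + k * (rule_weight R + 3)) < card ?X" using kX(1) by (simp add: n_def)
      show "run R I l = Some A" using A by (simp add: R_def)
      show "values_in_rule B S Map.empty R" if "i < l" "run R I i = Some B" for i B
        using good[of i B] that by simp
      show "dyn B Halt [] \<in> S" if "i \<le> l" "run R I i = Some B" for i B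
        using good[of i B] that by simp
    qed
    then obtain A' where A': "run R I' l = Some A'" "spread_state D A A'" by blast
    have "fmlookup D Halt = Some (0, True)" "fmlookup D Output = Some (0, True)"
      using R by (simp_all add: is_program_def is_dyn_voc_def)
    then have "dyn A' Halt [] = T (dyn A Halt [])" "dyn A' Output [] = T (dyn A Output [])"
      using spread_state_dyn[OF A'(2), of _ "[]"] by simp_all
    then have "halted A' \<longleftrightarrow> halted A" "output_true A' \<longleftrightarrow> output_true A"
      using good[OF le_refl, of A] A by (simp_all add: halted_def output_true_def spread_eq_one_iff R_def)
    then show "\<exists>A'. run (program P) I' l = Some A' \<and> (halted A' \<longleftrightarrow> halted A) \<and> (output_true A' \<longleftrightarrow> output_true A)"
      using A'(1) by (auto simp: R_def)
  qed
qed

lemma run_after_halt: "run R I i = Some A \<Longrightarrow> halted A \<Longrightarrow> i < j \<Longrightarrow> run R I j = None"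
proof (induction j)
  case (Suc j)
  then show ?case by (cases "i = j") auto
qed simp

lemma halting_state_unique:
  assumes "run R I i = Some A" "halted A" "run R I j = Some B" "halted B"
  shows "A = B"
  using assms run_after_halt[OF assms(1,2), of j] run_after_halt[OF assms(3,4), of i]
  by (cases i j rule: linorder_cases) auto

text \<open>A large structure of \<open>K1\<close> is embedded in a structure of \<open>K2\<close>
  that is no smaller. Acceptance of the first makes the run on the second halt with true output,
  while rejection makes it halt with false output; a run has only one halting state.\<close>

lemma no_separation:
  fixes K1 K2 :: "'a istruct set"
  assumes K: "K1 \<subseteq> naked_sets" "K2 \<subseteq> naked_sets"
    and inf: "infinite (struct_size ` K1)" "infinite (struct_size ` K2)"
  shows "(K1, K2) \<notin> CPTime_pairs fmempty"
proof
  assume "(K1, K2) \<in> CPTime_pairs fmempty"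
  then obtain P where P: "is_ptime_program fmempty P"
    and acc: "\<And>I. I \<in> K1 \<Longrightarrow> accepts P I" and rej: "\<And>I. I \<in> K2 \<Longrightarrow> rejects P I"
    unfolding CPTime_pairs_def by blast
  define R where "R = program P"
  have R: "is_program fmempty (dynamics P) R" using P by (simp add: is_ptime_program_def R_def)
  obtain N where N: "\<And>(I :: 'a istruct) I' l A. I \<in> naked_sets \<Longrightarrow> I' \<in> naked_sets \<Longrightarrow>
    fset (universe I) \<subseteq> fset (universe I') \<Longrightarrow> N \<le> struct_size I \<Longrightarrow> within_bounds P I l \<Longrightarrow>
    run R I l = Some A \<Longrightarrow>
    \<exists>A'. run R I' l = Some A' \<and> (halted A' \<longleftrightarrow> halted A) \<and> (output_true A' \<longleftrightarrow> output_true A)"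
    using run_extends_to_superset[OF P] unfolding R_def by blast
  obtain I1 where I1: "I1 \<in> K1" "N \<le> struct_size I1"
    using inf(1) unfolding infinite_nat_iff_unbounded_le by blast
  obtain I2 where I2: "I2 \<in> K2" "struct_size I1 \<le> struct_size I2"
    using inf(2) unfolding infinite_nat_iff_unbounded_le by blast
  let ?X = "fset (universe I1)" and ?Y = "fset (universe I2)"
  have "card ?X \<le> card ?Y" using I2(2) by (simp add: struct_size_def fcard.rep_eq)
  then obtain f where f: "f ` ?X \<subseteq> ?Y" "inj_on f ?X" using card_le_inj[of ?X ?Y] by auto
  obtain p where p: "p permutes (?X \<union> ?Y)" "\<And>a. a \<in> ?X \<Longrightarrow> p a = f a"
    using permutes_extension[of "?X \<union> ?Y" ?X f] f by auto
  have bij: "bij p" using p(1) by (rule permutes_bij)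
  \<comment> \<open>An isomorphic copy of \<open>I2\<close> whose universe contains that of
    \<open>I1\<close>: \<open>p\<close> maps \<open>?X\<close> into \<open>?Y\<close>, so its
    inverse takes \<open>?Y\<close> to a superset of \<open>?X\<close>.\<close>
  define I where "I = (I2 \<lparr>universe := inv p |`| universe I2\<rparr> :: 'a istruct)"
  have naked: "I1 \<in> naked_sets" "I2 \<in> naked_sets" using I1 I2 K by auto
  have I: "I \<in> naked_sets"
    using naked_sets_holds[OF naked(2)] by (simp add: I_def naked_sets_def structures_def)
  have "a \<in> inv p ` ?Y" if "a \<in> ?X" for a
    using that f(1) p(2)[OF that] bij by (metis bij_inv_eq_iff image_eqI image_subset_iff)
  then have sub: "?X \<subseteq> fset (universe I)" by (auto simp: I_def)
  have "universe I2 = p |`| universe I"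
    using bij by (simp add: I_def fset_inject[symmetric] image_image surj_f_inv_f[OF bij_is_surj])
  then have iso: "rel_option (state_iso p) (run R I i) (run R I2 i)" for i
    using run_iso[OF bij R I naked(2)] by blast
  obtain A1 l where A1: "within_bounds P I1 l" "run R I1 l = Some A1" "halted A1" "output_true A1"
    using acc[OF I1(1)] unfolding accepts_def final_state_def R_def by blast
  obtain A where A: "run R I l = Some A" "halted A" "output_true A"
    using N[OF naked(1) I sub I1(2) A1(1,2)] A1(3,4) by blast
  obtain B where B: "run R I2 l = Some B" "state_iso p A B" using iso[of l] A(1) by (auto simp: option_rel_Some1)
  obtain B' l' where B': "run R I2 l' = Some B'" "halted B'" "\<not> output_true B'"
    using rej[OF I2(1)] unfolding rejects_def final_state_def R_def by blast
  have "halted B" "output_true B" using A(2,3) halted_iso[OF B(2)] output_true_iso[OF B(2)] by simp_all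
  then show False using halting_state_unique[OF B(1) _ B'(1,2)] B'(3) by blast
qed

text \<open>An infinite type of atoms has naked sets of every finite size, so both parities occur
  unboundedly.\<close>

lemma naked_set_of_size:
  assumes "infinite (UNIV :: 'a set)"
  shows "\<exists>I :: 'a istruct. I \<in> naked_sets \<and> struct_size I = n"
proof -
  obtain X :: "'a set" where X: "finite X" "card X = n"
    using infinite_arbitrarily_large[OF assms] by blast
  let ?I = "\<lparr>universe = Abs_fset X, holds = \<lambda>_ _. False\<rparr>"
  have "?I \<in> naked_sets" by (simp add: naked_sets_def structures_def)
  moreover have "struct_size ?I = n" using X by (simp add: struct_size_def fcard.rep_eq Abs_fset_inverse)
  ultimately show ?thesis by blast
qed

theorem theorem10:
  assumes "infinite (UNIV :: 'a set)"
  shows "{I \<in> naked_sets. even (struct_size I)} \<notin> (CPTime fmempty :: 'a istruct set set) \<and>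
    (\<forall>K1 K2 :: 'a istruct set.
       K1 \<subseteq> naked_sets \<and> K2 \<subseteq> naked_sets \<and> K1 \<inter> K2 = {} \<and> infinite K1 \<and> infinite K2 \<and>
       infinite (struct_size ` K1) \<and> infinite (struct_size ` K2) \<longrightarrow>
       (K1, K2) \<notin> CPTime_pairs fmempty)"
proof (intro conjI allI impI)
  let ?E = "{I :: 'a istruct. I \<in> naked_sets \<and> even (struct_size I)}"
  have "infinite (struct_size ` ?E)"
    unfolding infinite_nat_iff_unbounded_le
  proof
    fix m
    obtain I :: "'a istruct" where "I \<in> naked_sets" "struct_size I = 2 * m"
      using naked_set_of_size[OF assms] by blast
    then show "\<exists>n\<ge>m. n \<in> struct_size ` ?E" by (intro exI[of _ "2 * m"]) force
  qed
  moreover have "infinite (struct_size ` (naked_sets - ?E))"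
    unfolding infinite_nat_iff_unbounded_le
  proof
    fix m
    obtain I :: "'a istruct" where "I \<in> naked_sets" "struct_size I = 2 * m + 1"
      using naked_set_of_size[OF assms] by blast
    then show "\<exists>n\<ge>m. n \<in> struct_size ` (naked_sets - ?E)" by (intro exI[of _ "2 * m + 1"]) force
  qed
  ultimately have "(?E, naked_sets - ?E) \<notin> CPTime_pairs fmempty" by (intro no_separation) auto
  then show "?E \<notin> CPTime fmempty" by (simp add: CPTime_def naked_sets_def)
next
  fix K1 K2 :: "'a istruct set"
  assume "K1 \<subseteq> naked_sets \<and> K2 \<subseteq> naked_sets \<and> K1 \<inter> K2 = {} \<and> infinite K1 \<and> infinite K2 \<and>
    infinite (struct_size ` K1) \<and> infinite (struct_size ` K2)"
  then show "(K1, K2) \<notin> CPTime_pairs fmempty" by (intro no_separation) auto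
qed

end
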